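(* Let $G$ be a connected bipartite graph on the vertex set $\{1,\dots,n\}$ (with $n\ge 2$), let $R=k[x_1,\dots,x_n]$ be a polynomial ring over a field $k$, and let $I=I(G)\subset R$ be the edge ideal of $G$. Then $$\operatorname{dstab}(I)=s(G)+1.$$
   Context: All graphs are finite and simple. The edge ideal $I(G)\subset R=k[x_1,\dots,x_n]$ is generated by the monomials $x_ix_j$ with $\{i,j\}$ an edge of $G$. For a homogeneous ideal $I$, $\operatorname{dstab}(I)$ (index of depth stability) is the smallest integer $s\ge 1$ such that $\operatorname{depth} R/I^t=\operatorname{depth} R/I^s$ for all $t\ge s$ (it exists by a theorem of Brodmann). Ears. An open path is a sequence of distinct vertices $v_1,\dots,v_r$ ($r\ge 2$) with consecutive vertices adjacent; its endpoints are $v_1,v_r$. A cycle is a closed path $v_1,\dots,v_r=v_1$ of length at least $3$ with $v_1,\dots,v_{r-1}$ distinct; it has a single endpoint $v_1$. A 2-cycle is a closed walk $u,v,u$ along one edge $\{u,v\}$; it has length $2$, a single endpoint $u$, and edge set $\{\{u,v\}\}$. (So a single edge may be used either as a path of length 1 with two endpoints or as a 2-cycle with a specified endpoint.) A generalized ear decomposition of a connected graph $G$ with at least two vertices is a sequence $L_1,\dots,L_r$, each term (called an ear) being an open path, a cycle or a 2-cycle, whose edge sets partition the edge set of $G$, such that $L_1$ is a cycle or a 2-cycle and, for $i\ge 2$, the vertices of $L_i$ that belong to $L_1+\dots+L_{i-1}$ (the union of the previous ears) are exactly the endpoints of $L_i$. An ear is even if its length is even (2-cycles are even). Every connected graph with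 at least two vertices has a generalized ear decomposition. $\varphi(G)$ is the minimal number of even ears in a generalized ear decomposition of $G$, and $\mu(G):=(\varphi(G)+v(G)-1)/2$, where $v(G)$ is the number of vertices of $G$. For $U\subseteq V(G)$, $G_U$ denotes the induced subgraph on $U$; it is called dominating if every vertex of $V(G)\setminus U$ is adjacent to a vertex of $U$. For a connected bipartite graph $G$: if $G$ is not a complete bipartite graph, $s(G):=\min\{\mu(G_U)\mid G_U$ is a dominating connected induced subgraph of $G\}$ (such a $U$ automatically has at least two vertices); if $G$ is a complete bipartite graph, $s(G):=0$. *)

theory Defs
  imports Complex_Main "HOL-Library.Poly_Mapping" "HOL-Library.Extended_Nat"
    "HOL-Algebra.QuotRing" "HOL-Algebra.Ideal_Product"
begin

section \<open>Polynomial rings, depth and the index of depth stability\<close>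

type_synonym ('v, 'k) mpoly = "('v \<Rightarrow>\<^sub>0 nat) \<Rightarrow>\<^sub>0 'k"

text \<open>The polynomial ring over the field \<open>'k\<close> in the variables \<open>x\<^sub>v\<close>, \<open>v \<in> V\<close>:
  polynomials are finitely supported functions on exponent vectors.\<close>

definition mpoly_ring :: "'v set \<Rightarrow> ('v, 'k::field) mpoly ring" where
  "mpoly_ring V =
    \<lparr> carrier = {p. \<forall>m \<in> Poly_Mapping.keys p. Poly_Mapping.keys m \<subseteq> V},
      mult = (*), one = 1, zero = 0, add = (+) \<rparr>"

definition mvar :: "'v \<Rightarrow> ('v, 'k::field) mpoly" where
  "mvar v = Poly_Mapping.single (Poly_Mapping.single v 1) 1"

lemma cring_mpoly_ring: "cring (mpoly_ring V :: ('v, 'k::field) mpoly ring)"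
proof (rule cringI)
  show "abelian_group (mpoly_ring V :: ('v, 'k) mpoly ring)"
  proof (rule abelian_groupI)
    fix p q :: "('v, 'k) mpoly"
    assume "p \<in> carrier (mpoly_ring V)" "q \<in> carrier (mpoly_ring V)"
    then show "p \<oplus>\<^bsub>mpoly_ring V\<^esub> q \<in> carrier (mpoly_ring V)"
      using Poly_Mapping.keys_add[of p q] unfolding mpoly_ring_def by fastforce
  next
    fix p :: "('v, 'k) mpoly"
    assume "p \<in> carrier (mpoly_ring V)"
    then have "- p \<in> carrier (mpoly_ring V)"
      by (simp add: mpoly_ring_def)
    then show "\<exists>q \<in> carrier (mpoly_ring V). q \<oplus>\<^bsub>mpoly_ring V\<^esub> p = \<zero>\<^bsub>mpoly_ring V\<^esub>"
      by (intro bexI[of _ "- p"]) (simp_all add: mpoly_ring_def)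
  qed (auto simp: mpoly_ring_def algebra_simps)
  show "Group.comm_monoid (mpoly_ring V :: ('v, 'k) mpoly ring)"
  proof (rule comm_monoidI)
    fix p q :: "('v, 'k) mpoly"
    assume pq: "p \<in> carrier (mpoly_ring V)" "q \<in> carrier (mpoly_ring V)"
    have "Poly_Mapping.keys m \<subseteq> V" if m: "m \<in> Poly_Mapping.keys (p * q)" for m
    proof -
      obtain a b where "m = a + b" "a \<in> Poly_Mapping.keys p" "b \<in> Poly_Mapping.keys q"
        using m Poly_Mapping.keys_mult[of p q] by blast
      then show ?thesis
        using pq Poly_Mapping.keys_add[of a b] unfolding mpoly_ring_def by fastforce
    qed
    then show "p \<otimes>\<^bsub>mpoly_ring V\<^esub> q \<in> carrier (mpoly_ring V)"
      by (simp add: mpoly_ring_def)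
  qed (auto simp: mpoly_ring_def algebra_simps)
qed (auto simp: mpoly_ring_def algebra_simps)

definition max_hom_ideal :: "'v set \<Rightarrow> ('v, 'k::field) mpoly set" where
  "max_hom_ideal V = Idl\<^bsub>mpoly_ring V\<^esub> (mvar ` V)"

definition nonzerodivisor :: "('a, 'b) ring_scheme \<Rightarrow> 'a \<Rightarrow> bool" where
  "nonzerodivisor A a \<longleftrightarrow>
    a \<in> carrier A \<and> (\<forall>b \<in> carrier A. a \<otimes>\<^bsub>A\<^esub> b = \<zero>\<^bsub>A\<^esub> \<longrightarrow> b = \<zero>\<^bsub>A\<^esub>)"

text \<open>Regular sequences on the module \<open>A/J\<close>. Here \<open>(A/J)/(f\<^sub>0, \<dots>, f\<^sub>i\<^sub>-\<^sub>1)(A/J)\<close> is written as the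
  quotient of \<open>A\<close> by the ideal generated by \<open>J\<close> and \<open>f\<^sub>0, \<dots>, f\<^sub>i\<^sub>-\<^sub>1\<close>.\<close>

definition regular_seq_on_quot :: "('a, 'b) ring_scheme \<Rightarrow> 'a set \<Rightarrow> 'a list \<Rightarrow> bool" where
  "regular_seq_on_quot A J fs \<longleftrightarrow>
    set fs \<subseteq> carrier A \<and>
    (\<forall>i < length fs.
      let K = Idl\<^bsub>A\<^esub> (J \<union> set (take i fs)) in nonzerodivisor (A Quot K) (K +>\<^bsub>A\<^esub> (fs ! i))) \<and>
    Idl\<^bsub>A\<^esub> (J \<union> set fs) \<noteq> carrier A"

text \<open>The depth of \<open>R/J\<close> with respect to the maximal homogeneous ideal. The supremum is taken in
  \<^typ>\<open>enat\<close>, so that no boundedness is presupposed.\<close>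

definition depth_quot :: "'v set \<Rightarrow> ('v, 'k::field) mpoly set \<Rightarrow> enat" where
  "depth_quot V J =
    Sup {enat (length fs) |fs. regular_seq_on_quot (mpoly_ring V) J fs \<and> set fs \<subseteq> max_hom_ideal V}"

definition ideal_pow :: "'v set \<Rightarrow> ('v, 'k::field) mpoly set \<Rightarrow> nat \<Rightarrow> ('v, 'k) mpoly set" where
  "ideal_pow V I t = I [^]\<^bsub>ideals_set (mpoly_ring V)\<^esub> t"

definition dstab :: "'v set \<Rightarrow> ('v, 'k::field) mpoly set \<Rightarrow> nat" where
  "dstab V I = (LEAST s. s \<ge> 1 \<and>
    (\<forall>t \<ge> s. depth_quot V (ideal_pow V I t) = depth_quot V (ideal_pow V I s)))"


section \<open>Graphs\<close>

text \<open>A graph is given by its vertex set \<open>V\<close> and its set \<open>E\<close> of two-element edges.\<close>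

definition simple_graph :: "'v set \<Rightarrow> 'v set set \<Rightarrow> bool" where
  "simple_graph V E \<longleftrightarrow> finite V \<and> E \<subseteq> {{u, v} |u v. u \<in> V \<and> v \<in> V \<and> u \<noteq> v}"

definition connected_graph :: "'v set \<Rightarrow> 'v set set \<Rightarrow> bool" where
  "connected_graph V E \<longleftrightarrow> V \<noteq> {} \<and> (\<forall>u \<in> V. \<forall>v \<in> V. (u, v) \<in> {(x, y). {x, y} \<in> E}\<^sup>*)"

definition bipartition :: "'v set \<Rightarrow> 'v set set \<Rightarrow> 'v set \<Rightarrow> 'v set \<Rightarrow> bool" where
  "bipartition V E A B \<longleftrightarrow>
    A \<union> B = V \<and> A \<inter> B = {} \<and> E \<subseteq> {{a, b} |a b. a \<in> A \<and> b \<in> B}"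

definition bipartite_graph :: "'v set \<Rightarrow> 'v set set \<Rightarrow> bool" where
  "bipartite_graph V E \<longleftrightarrow> (\<exists>A B. bipartition V E A B)"

definition complete_bipartite_graph :: "'v set \<Rightarrow> 'v set set \<Rightarrow> bool" where
  "complete_bipartite_graph V E \<longleftrightarrow>
    (\<exists>A B. A \<noteq> {} \<and> B \<noteq> {} \<and> A \<union> B = V \<and> A \<inter> B = {} \<and> E = {{a, b} |a b. a \<in> A \<and> b \<in> B})"

definition induced_edges :: "'v set set \<Rightarrow> 'v set \<Rightarrow> 'v set set" where
  "induced_edges E U = {e \<in> E. e \<subseteq> U}"

definition dominating :: "'v set \<Rightarrow> 'v set set \<Rightarrow> 'v set \<Rightarrow> bool" where
  "dominating V E U \<longleftrightarrow> (\<forall>v \<in> V - U. \<exists>u \<in> U. {u, v} \<in> E)"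

definition edge_ideal :: "'v set \<Rightarrow> 'v set set \<Rightarrow> ('v, 'k::field) mpoly set" where
  "edge_ideal V E = Idl\<^bsub>mpoly_ring V\<^esub> {mvar i * mvar j |i j. {i, j} \<in> E}"


section \<open>Generalized ear decompositions\<close>

text \<open>Ears are represented by the list of vertices they traverse. A closed ear repeats its
  endpoint at the end of the list, so a 2-cycle is \<open>[u, v, u]\<close>.\<close>

definition walk_edges :: "'v list \<Rightarrow> 'v set set" where
  "walk_edges w = {{w ! i, w ! Suc i} |i. Suc i < length w}"

definition walk_length :: "'v list \<Rightarrow> nat" where
  "walk_length w = length w - 1"

definition endpoints :: "'v list \<Rightarrow> 'v set" where
  "endpoints w = {hd w, last w}"

definition is_open_path :: "'v set set \<Rightarrow> 'v list \<Rightarrow> bool" where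
  "is_open_path E w \<longleftrightarrow> length w \<ge> 2 \<and> distinct w \<and> walk_edges w \<subseteq> E"

definition is_cycle :: "'v set set \<Rightarrow> 'v list \<Rightarrow> bool" where
  "is_cycle E w \<longleftrightarrow>
    walk_length w \<ge> 3 \<and> hd w = last w \<and> distinct (butlast w) \<and> walk_edges w \<subseteq> E"

definition is_2cycle :: "'v set set \<Rightarrow> 'v list \<Rightarrow> bool" where
  "is_2cycle E w \<longleftrightarrow> (\<exists>u v. w = [u, v, u] \<and> {u, v} \<in> E)"

definition generalized_ear_decomposition :: "'v set set \<Rightarrow> 'v list list \<Rightarrow> bool" where
  "generalized_ear_decomposition E Ls \<longleftrightarrow>
    Ls \<noteq> [] \<and>
    (\<forall>L \<in> set Ls. is_open_path E L \<or> is_cycle E L \<or> is_2cycle E L) \<and>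
    (\<Union>L \<in> set Ls. walk_edges L) = E \<and>
    (\<forall>i < length Ls. \<forall>j < length Ls. i \<noteq> j \<longrightarrow> walk_edges (Ls ! i) \<inter> walk_edges (Ls ! j) = {}) \<and>
    (is_cycle E (Ls ! 0) \<or> is_2cycle E (Ls ! 0)) \<and>
    (\<forall>i. 1 \<le> i \<and> i < length Ls \<longrightarrow> set (Ls ! i) \<inter> (\<Union>j < i. set (Ls ! j)) = endpoints (Ls ! i))"

text \<open>In a connected graph with at least two vertices the edges determine the vertex set, so \<open>\<phi>\<close> is
  defined from the edge set alone.\<close>

definition ear_phi :: "'v set set \<Rightarrow> nat" where
  "ear_phi E =
    Inf {length (filter (\<lambda>L. even (walk_length L)) Ls) |Ls. generalized_ear_decomposition E Ls}"

definition ear_mu :: "'v set \<Rightarrow> 'v set set \<Rightarrow> real" where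
  "ear_mu V E = (real (ear_phi E) + real (card V) - 1) / 2"

definition s_invariant :: "'v set \<Rightarrow> 'v set set \<Rightarrow> real" where
  "s_invariant V E =
    (if complete_bipartite_graph V E then 0
     else Min {ear_mu U (induced_edges E U) |U.
       U \<subseteq> V \<and> connected_graph U (induced_edges E U) \<and> dominating V E U})"

end

theory Submission
  imports Defs
begin

text \<open>For a bipartite graph with parts \<open>A\<close>, \<open>B\<close>, Koenig's theorem gives \<open>I\<^sup>t = \<Inter>\<^sub>C P\<^sub>C\<^sup>t\<close> over the
  vertex covers \<open>C\<close>, so \<open>depth R/I\<^sup>t \<ge> 1\<close>. Depth \<open>1\<close> occurs exactly if some degree complex, whose
  facets are the complements of the minimal covers of weight less than \<open>t\<close> under an exponent vector
  \<open>\<beta>\<close>, is disconnected. By submodularity of cover weights its facets are then just \<open>A\<close> and \<open>B\<close>, and one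
  may take \<open>\<beta>(A) = \<beta>(B) = t - 1\<close>. Such a \<open>\<beta>\<close> is the degree vector of a multiset \<open>M\<close> of \<open>t - 1\<close> edges,
  and the condition on covers says that the support \<open>U\<close> of \<open>\<beta>\<close> is dominating and strongly connected when
  edges are directed from \<open>A\<close> to \<open>B\<close>, those of \<open>M\<close> in both directions. Directed ear decompositions of
  this digraph match generalized ear decompositions of \<open>G\<^sub>U\<close> with \<open>2|M| = \<phi> + |U| - 1\<close>.

  Depth at least \<open>2\<close> is witnessed by two power sums whose exponents are ordered oppositely: on each
  \<open>R/P\<^sub>C\<^sup>t\<close> their leading forms are powers of different variables.\<close>

section \<open>Vertex covers of bipartite graphs\<close>

text \<open>Both bounds on the depth are therefore obtained from explicit elements. For the upper
  bound it is enough to have one regular element and a socle element in its quotient. For the lower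
  bound the power sums get pairwise distinct exponents. Modulo P_C^t the leading variable is the one
  of largest exponent outside C, and reversing the order of the exponents replaces it by the one of
  smallest exponent. The two differ because a minimal cover omits at least two vertices, except in
  stars, where s(G) = 0 anyway. Division then works for each cover separately and the quotients have
  to be glued; the obstruction to gluing is precisely a disconnected degree complex. On the
  combinatorial side only inequalities between weights, sizes of edge sets and ear counts are
  proved. They give equality because both sides are minima.\<close>

lemma sum_fun_upd_decrement:
  fixes f :: "'a \<Rightarrow> nat"
  assumes "finite C" "0 < f u"
  shows "sum f C = sum (f(u := f u - 1)) C + of_bool (u \<in> C)"
proof (cases "u \<in> C")
  case True
  then have "sum f C = f u + sum f (C - {u})"
    and "sum (f(u := f u - 1)) C = f u - 1 + sum f (C - {u})"
    using assms by (simp_all add: sum.remove[of C u])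
  then show ?thesis using True assms by simp
next
  case False
  then have "sum (f(u := f u - 1)) C = sum f C"
    by (intro sum.cong) auto
  then show ?thesis using False by simp
qed

locale bip_graph =
  fixes V A B :: "'v set" and E :: "'v set set"
  assumes finV: "finite V"
    and AB_V: "A \<union> B = V"
    and AB_disj: "A \<inter> B = {}"
    and edges: "E \<subseteq> {{a, b} |a b. a \<in> A \<and> b \<in> B}"
begin

lemma finA: "finite A" and finB: "finite B"
  using finV AB_V by auto

lemma A_sub: "A \<subseteq> V" and B_sub: "B \<subseteq> V"
  using AB_V by auto

lemma finE: "finite E"
proof -
  have "E \<subseteq> Pow V" using edges AB_V by auto
  then show ?thesis using finV finite_subset by blast
qed

lemma edge_cases:
  assumes "{x, y} \<in> E"
  shows "x \<in> A \<and> y \<in> B \<or> x \<in> B \<and> y \<in> A"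
proof -
  obtain a b where "{x, y} = {a, b}" "a \<in> A" "b \<in> B" using assms edges by blast
  then show ?thesis by (auto simp: doubleton_eq_iff)
qed

lemma edge_AB: "{x, y} \<in> E \<Longrightarrow> x \<in> A \<Longrightarrow> y \<in> B"
  and edge_BA: "{x, y} \<in> E \<Longrightarrow> x \<in> B \<Longrightarrow> y \<in> A"
  using edge_cases AB_disj by blast+

lemma edge_V: "{x, y} \<in> E \<Longrightarrow> x \<in> V \<and> y \<in> V"
  using edge_cases AB_V by blast

lemma edge_neq: "{x, y} \<in> E \<Longrightarrow> x \<noteq> y"
  using edge_cases AB_disj by blast

definition cover :: "'v set \<Rightarrow> bool" where
  "cover C \<longleftrightarrow> C \<subseteq> V \<and> (\<forall>x y. {x, y} \<in> E \<longrightarrow> x \<in> C \<or> y \<in> C)"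

lemma cover_fin: "cover C \<Longrightarrow> finite C"
  using finV finite_subset cover_def by blast

lemma cover_A: "cover A" and cover_B: "cover B"
  using edge_cases AB_V unfolding cover_def by blast+

text \<open>\<open>cov_meet\<close> and \<open>cov_join\<close> are the lattice operations for the
  order in which a smaller cover has less of \<open>A\<close> and more of \<open>B\<close>. Weights
  are modular for them, so the covers of least weight are closed under both.\<close>

definition cov_meet :: "'v set \<Rightarrow> 'v set \<Rightarrow> 'v set" where
  "cov_meet C D = (C \<inter> D \<inter> A) \<union> ((C \<union> D) \<inter> B)"

definition cov_join :: "'v set \<Rightarrow> 'v set \<Rightarrow> 'v set" where
  "cov_join C D = ((C \<union> D) \<inter> A) \<union> (C \<inter> D \<inter> B)"

text \<open>If the meet misses a vertex of \<open>A\<close>, then \<open>C\<close> or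
  \<open>D\<close> misses it and contains all its neighbours, and these enter the meet. Dually for
  the join.\<close>

lemma cover_meet_join:
  assumes "cover C" "cover D"
  shows "cover (cov_meet C D)" "cover (cov_join C D)"
  using assms edge_cases unfolding cover_def cov_meet_def cov_join_def by blast+

lemma sum_split_AB:
  fixes f :: "'v \<Rightarrow> nat"
  assumes "C \<subseteq> V"
  shows "sum f C = sum f (C \<inter> A) + sum f (C \<inter> B)"
proof -
  have "C = (C \<inter> A) \<union> (C \<inter> B)" using assms AB_V by auto
  moreover have "finite C" using assms finV finite_subset by blast
  ultimately show ?thesis
    using AB_disj sum.union_disjoint[of "C \<inter> A" "C \<inter> B" f] by (metis finite_Int inf_assoc inf_bot_right inf_left_commute)
qed

lemma sum_meet_join:
  fixes f :: "'v \<Rightarrow> nat"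
  assumes "C \<subseteq> V" "D \<subseteq> V"
  shows "sum f (cov_meet C D) + sum f (cov_join C D) = sum f C + sum f D"
proof -
  have fin: "finite C" "finite D" using assms finV finite_subset by blast+
  have "cov_meet C D \<subseteq> V" "cov_join C D \<subseteq> V"
    using assms by (auto simp: cov_meet_def cov_join_def)
  note s = sum_split_AB[OF this(1), of f] sum_split_AB[OF this(2), of f]
    sum_split_AB[OF assms(1), of f] sum_split_AB[OF assms(2), of f]
  have e: "cov_meet C D \<inter> A = (C \<inter> A) \<inter> (D \<inter> A)" "cov_meet C D \<inter> B = (C \<inter> B) \<union> (D \<inter> B)"
    "cov_join C D \<inter> A = (C \<inter> A) \<union> (D \<inter> A)" "cov_join C D \<inter> B = (C \<inter> B) \<inter> (D \<inter> B)"
    using AB_disj by (auto simp: cov_meet_def cov_join_def)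
  have "sum f ((C \<inter> A) \<union> (D \<inter> A)) + sum f ((C \<inter> A) \<inter> (D \<inter> A)) = sum f (C \<inter> A) + sum f (D \<inter> A)"
    "sum f ((C \<inter> B) \<union> (D \<inter> B)) + sum f ((C \<inter> B) \<inter> (D \<inter> B)) = sum f (C \<inter> B) + sum f (D \<inter> B)"
    using fin by (simp_all add: sum.union_inter)
  then show ?thesis unfolding s e by linarith
qed

text \<open>If \<open>u\<close> shared a tight cover with each of its positive neighbours, the lattice operation on
  tight covers would give one containing \<open>u\<close> and all of them, from which \<open>u\<close> could be removed.\<close>

lemma koenig_step:
  fixes f :: "'v \<Rightarrow> nat"
  assumes "\<And>C. cover C \<Longrightarrow> Suc t \<le> sum f C"
  shows "\<exists>u \<in> A. \<exists>v \<in> B. {u, v} \<in> E \<and> 0 < f u \<and> 0 < f v \<and>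
    (\<forall>C. cover C \<longrightarrow> t \<le> sum (f(u := f u - 1, v := f v - 1)) C)"
  using assms
proof (induction "sum f V" arbitrary: f rule: less_induct)
  case less
  note lower = less.prems
  show ?case
  \<comment> \<open>As long as some positive weight can be lowered without a cover dropping below
    \<open>Suc t\<close>, lower it and recurse: an edge found for the smaller weight also serves
    \<open>f\<close>. Otherwise every vertex of positive weight lies in a cover of weight exactly
    \<open>Suc t\<close>.\<close>
  proof (cases "\<exists>u \<in> V. 0 < f u \<and> (\<forall>C. cover C \<longrightarrow> Suc t \<le> sum (f(u := f u - 1)) C)")
    case True
    then obtain u where u: "u \<in> V" "0 < f u"
      and cov: "\<And>C. cover C \<Longrightarrow> Suc t \<le> sum (f(u := f u - 1)) C" by blast
    let ?g = "f(u := f u - 1)"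
    have "sum ?g V < sum f V"
      using sum_fun_upd_decrement[of V f u] u finV by simp
    then obtain a b where ab: "a \<in> A" "b \<in> B" "{a, b} \<in> E" "0 < ?g a" "0 < ?g b"
      and cov': "\<And>C. cover C \<Longrightarrow> t \<le> sum (?g(a := ?g a - 1, b := ?g b - 1)) C"
      using less.hyps[of ?g] cov by blast
    have "t \<le> sum (f(a := f a - 1, b := f b - 1)) C" if "cover C" for C
      by (rule order_trans[OF cov'[OF that] sum_mono]) auto
    moreover have "0 < f a" "0 < f b" using ab by (auto split: if_splits)
    ultimately show ?thesis using ab by blast
  next
    case False
    have tight: "\<exists>C. cover C \<and> sum f C = Suc t \<and> u \<in> C" if u: "u \<in> V" "0 < f u" for u
    proof -
      obtain C where C: "cover C" "\<not> Suc t \<le> sum (f(u := f u - 1)) C" using False u by blast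
      then have "sum f C = Suc t \<and> u \<in> C"
        using lower[OF C(1)] sum_fun_upd_decrement[of C f u] cover_fin[OF C(1)] u
        by (cases "u \<in> C") auto
      then show ?thesis using C by blast
    qed
    have "sum f A \<noteq> 0" using lower[OF cover_A] by linarith
    then obtain u where u: "u \<in> A" "0 < f u" by (metis gr0I sum.neutral)
    show ?thesis
    proof (rule ccontr)
      assume neg: "\<not> ?thesis"
      have shared: "\<exists>C. cover C \<and> sum f C = Suc t \<and> u \<in> C \<and> v \<in> C"
        if v: "v \<in> B" "{u, v} \<in> E" "0 < f v" for v
      proof -
        obtain C where C: "cover C" "\<not> t \<le> sum (f(u := f u - 1, v := f v - 1)) C"
          using neg u v by blast
        have uv: "u \<noteq> v" using v edge_neq by blast
        have "sum f C = sum (f(u := f u - 1, v := f v - 1)) C + of_bool (u \<in> C) + of_bool (v \<in> C)"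
          using sum_fun_upd_decrement[of C f u] sum_fun_upd_decrement[of C "f(u := f u - 1)" v]
            cover_fin[OF C(1)] u v uv by simp
        then show ?thesis using C lower[OF C(1)]
          by (intro exI[of _ C]) (auto simp: of_bool_def split: if_splits)
      qed
      let ?N = "{v \<in> B. {u, v} \<in> E \<and> 0 < f v}"
      have "\<exists>D. cover D \<and> sum f D = Suc t \<and> u \<in> D \<and> X \<subseteq> D" if "finite X" "X \<subseteq> ?N" for X
        using that
      proof (induction X rule: finite_induct)
        case empty
        then show ?case using tight[of u] u A_sub by blast
      next
        case (insert v X)
        have "X \<subseteq> ?N" using insert.prems by simp
        then obtain D where D: "cover D" "sum f D = Suc t" "u \<in> D" "X \<subseteq> D"
          using insert.IH by meson
        obtain C where C: "cover C" "sum f C = Suc t" "u \<in> C" "v \<in> C"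
          using shared[of v] insert.prems by auto
        have le: "Suc t \<le> sum f (cov_meet C D)" "Suc t \<le> sum f (cov_join C D)"
          using lower cover_meet_join C D by blast+
        have "sum f (cov_meet C D) + sum f (cov_join C D) = Suc t + Suc t"
          using sum_meet_join[of C D f] C D unfolding cover_def by simp
        then have "sum f (cov_meet C D) = Suc t" using le by linarith
        moreover have "insert v X \<subseteq> cov_meet C D" "u \<in> cov_meet C D"
          using insert C D u by (auto simp: cov_meet_def)
        ultimately show ?case using cover_meet_join(1)[OF C(1) D(1)] by blast
      qed
      from this[of ?N] finB obtain D where D: "cover D" "sum f D = Suc t" "u \<in> D" "?N \<subseteq> D" by auto
      \<comment> \<open>\<open>D\<close> contains the neighbours of \<open>u\<close> that have
        positive weight. Adding those of weight zero is free and makes \<open>u\<close> itself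
        removable, which lowers the weight by \<open>f u\<close>.\<close>
      let ?Z = "{v \<in> B. {u, v} \<in> E \<and> f v = 0}"
      let ?D = "(D - {u}) \<union> ?Z"
      have "cover ?D"
        unfolding cover_def
      proof (intro conjI allI impI)
        show "?D \<subseteq> V" using D B_sub unfolding cover_def by blast
        fix x y assume xy: "{x, y} \<in> E"
        have nb: "v \<in> ?D" if "{u, v} \<in> E" for v
        proof -
          have "v \<in> B" "v \<noteq> u" using edge_AB[OF that u(1)] edge_neq[OF that] by simp_all
          then show ?thesis using subsetD[OF D(4), of v] that by (cases "f v = 0") simp_all
        qed
        show "x \<in> ?D \<or> y \<in> ?D"
        proof (cases "x = u \<or> y = u")
          case True
          then have "{u, y} \<in> E \<or> {u, x} \<in> E" using xy by (auto simp: insert_commute)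
          then have "y \<in> ?D \<or> x \<in> ?D" using nb[of y] nb[of x] by argo
          then show ?thesis by argo
        next
          case False
          have "x \<in> D \<or> y \<in> D" using D(1) xy unfolding cover_def by simp
          then show ?thesis using False by auto
        qed
      qed
      moreover have "sum f ?D < Suc t"
      proof -
        have "sum f ?D \<le> sum f (D - {u}) + sum f ?Z"
          using cover_fin[OF D(1)] finB by (intro sum_Un_nat[THEN eq_refl, THEN order_trans]) auto
        also have "sum f ?Z = 0" by simp
        also have "sum f D = f u + sum f (D - {u})"
          using D cover_fin[OF D(1)] by (simp add: sum.remove)
        then have "sum f (D - {u}) + 0 < sum f D" using u by simp
        finally show ?thesis using D by simp
      qed
      ultimately show False using lower by fastforce
    qed
  qed
qed

text \<open>Iterating \<open>koenig_step\<close> writes \<open>f\<close> as the degree vector of a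
  multiset of \<open>s\<close> edges, and \<open>M\<close> is the underlying set. The last clause
  records what is kept of the multiplicities: each of these edges that meets \<open>Y\<close> ends
  in an \<open>M\<close>-neighbour of \<open>Y\<close>.\<close>

lemma koenig_matching:
  fixes f :: "'v \<Rightarrow> nat"
  assumes "sum f A = s" "sum f B = s" "\<And>C. cover C \<Longrightarrow> s \<le> sum f C"
  shows "\<exists>M \<subseteq> E. card M \<le> s \<and> (\<forall>e \<in> M. \<forall>x \<in> e. 0 < f x) \<and>
    (\<forall>Y \<subseteq> B. sum f Y \<le> sum f {a \<in> A. \<exists>b \<in> Y. {a, b} \<in> M})"
  using assms
proof (induction s arbitrary: f)
  case 0
  have "sum f Y = 0" if "Y \<subseteq> B" for Y
    using sum_mono2[OF finB that, of f] 0 by simp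
  then show ?case by (intro exI[of _ "{}"]) auto
next
  case (Suc s)
  obtain u v where uv: "u \<in> A" "v \<in> B" "{u, v} \<in> E" "0 < f u" "0 < f v"
    and cov: "\<And>C. cover C \<Longrightarrow> s \<le> sum (f(u := f u - 1, v := f v - 1)) C"
    using koenig_step[of s f] Suc.prems by blast
  let ?g = "f(u := f u - 1, v := f v - 1)"
  have neq: "u \<noteq> v" using uv edge_neq by blast
  have eq: "sum f C = sum ?g C + of_bool (u \<in> C) + of_bool (v \<in> C)" if "finite C" for C
    using sum_fun_upd_decrement[of C f u] sum_fun_upd_decrement[of C "f(u := f u - 1)" v]
      that uv neq by simp
  have "v \<notin> A" "u \<notin> B" using uv AB_disj by auto
  then have "sum ?g A = s" "sum ?g B = s"
    using eq[OF finA] eq[OF finB] Suc.prems uv by simp_all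
  then obtain M where M: "M \<subseteq> E" "card M \<le> s" "\<forall>e \<in> M. \<forall>x \<in> e. 0 < ?g x"
    "\<And>Y. Y \<subseteq> B \<Longrightarrow> sum ?g Y \<le> sum ?g {a \<in> A. \<exists>b \<in> Y. {a, b} \<in> M}"
    using Suc.IH[of ?g] cov by blast
  let ?M = "insert {u, v} M"
  have "sum f Y \<le> sum f {a \<in> A. \<exists>b \<in> Y. {a, b} \<in> ?M}" if Y: "Y \<subseteq> B" for Y
  proof -
    let ?K = "\<lambda>M. {a \<in> A. \<exists>b \<in> Y. {a, b} \<in> M}"
    have fin: "finite Y" "finite (?K ?M)" using Y finB finA finite_subset by auto
    have "u \<notin> Y" using Y \<open>u \<notin> B\<close> by blast
    then have "sum f Y = sum ?g Y + of_bool (v \<in> Y)" using eq[OF fin(1)] by simp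
    also have "\<dots> \<le> sum ?g (?K M) + of_bool (v \<in> Y)" using M(4)[OF Y] by simp
    also have "\<dots> \<le> sum ?g (?K ?M) + of_bool (u \<in> ?K ?M)"
      using uv sum_mono2[OF fin(2), of "?K M" ?g] by (intro add_mono) auto
    also have "\<dots> \<le> sum f (?K ?M)" using eq[OF fin(2)] by linarith
    finally show ?thesis .
  qed
  moreover have "\<forall>e \<in> ?M. \<forall>x \<in> e. 0 < f x" using M(3) uv by (auto split: if_splits)
  moreover have "card ?M \<le> Suc s" using M(1,2) finite_subset[OF M(1) finE] by (simp add: card_insert_if)
  ultimately show ?case using uv M(1) by (intro exI[of _ ?M]) auto
qed

end

section \<open>Ear decompositions\<close>

lemma walk_edges_simps [simp]:
  "walk_edges [] = {}" "walk_edges [x] = {}"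
  "walk_edges (x # y # zs) = insert {x, y} (walk_edges (y # zs))"
proof -
  show "walk_edges [] = {}" "walk_edges [x] = {}" by (auto simp: walk_edges_def)
  show "walk_edges (x # y # zs) = insert {x, y} (walk_edges (y # zs))"
  proof (rule Set.set_eqI)
    fix e
    have "e \<in> walk_edges (x # y # zs) \<longleftrightarrow>
      (\<exists>i < Suc (length zs). e = {(x # y # zs) ! i, (x # y # zs) ! Suc i})"
      by (auto simp: walk_edges_def)
    also have "\<dots> \<longleftrightarrow> e = {x, y} \<or> (\<exists>i < length zs. e = {(y # zs) ! i, (y # zs) ! Suc i})"
      unfolding Ex_less_Suc2 by simp
    also have "\<dots> \<longleftrightarrow> e \<in> insert {x, y} (walk_edges (y # zs))"
      by (auto simp: walk_edges_def)
    finally show "e \<in> walk_edges (x # y # zs) \<longleftrightarrow> e \<in> insert {x, y} (walk_edges (y # zs))" .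
  qed
qed

lemma walk_edges_nth: "Suc i < length L \<Longrightarrow> {L ! i, L ! Suc i} \<in> walk_edges L"
  by (auto simp: walk_edges_def)

lemma walk_edges_sub: "e \<in> walk_edges L \<Longrightarrow> e \<subseteq> set L"
  by (auto simp: walk_edges_def)

definition is_ear :: "'v set set \<Rightarrow> 'v list \<Rightarrow> bool" where
  "is_ear E L \<longleftrightarrow> is_open_path E L \<or> is_cycle E L \<or> is_2cycle E L"

text \<open>All three kinds of ears attached to \<open>W\<close> have the same shape: a walk that leaves \<open>W\<close>,
  passes through distinct new vertices and returns to \<open>W\<close>.\<close>

lemma ear_shape:
  assumes loopfree: "\<And>x. {x} \<notin> E"
  shows "is_ear E L \<and> set L \<inter> W = endpoints L \<longleftrightarrow>
    (\<exists>a xs b. L = a # xs @ [b] \<and> a \<in> W \<and> b \<in> W \<and> distinct xs \<and> set xs \<inter> W = {} \<and>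
      walk_edges L \<subseteq> E \<and> (xs = [] \<longrightarrow> a \<noteq> b))" (is "?l \<longleftrightarrow> ?r")
proof
  assume l: ?l
  then have len: "2 \<le> length L"
    by (auto simp: is_ear_def is_open_path_def is_cycle_def is_2cycle_def walk_length_def)
  then obtain a ys where a: "L = a # ys" "ys \<noteq> []" by (cases L) fastforce+
  then obtain xs b where L: "L = a # xs @ [b]" by (metis append_butlast_last_id)
  have ep: "endpoints L = {a, b}" by (simp add: L endpoints_def)
  have "distinct xs \<and> a \<notin> set xs \<and> b \<notin> set xs \<and> (xs = [] \<longrightarrow> a \<noteq> b) \<and> walk_edges L \<subseteq> E"
  proof -
    consider "is_open_path E L" | "is_cycle E L" | "is_2cycle E L"
      using l by (auto simp: is_ear_def)
    then show ?thesis
    proof cases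
      case 1
      then show ?thesis by (auto simp: L is_open_path_def)
    next
      case 2
      have "butlast L = a # xs" by (simp add: L butlast_append)
      then show ?thesis using 2 by (auto simp: L is_cycle_def walk_length_def)
    next
      case 3
      then obtain u v where uv: "L = [u, v, u]" "{u, v} \<in> E" by (auto simp: is_2cycle_def)
      then have "xs = [v] \<and> a = u \<and> b = u" using L by (cases xs) auto
      then show ?thesis using uv loopfree[of u] by (auto simp: insert_commute)
    qed
  qed
  moreover have "set L \<inter> W = {a, b}" using l ep by simp
  ultimately show ?r using L by (intro exI[of _ a] exI[of _ xs] exI[of _ b]) auto
next
  assume ?r
  then obtain a xs b where L: "L = a # xs @ [b]" and ab: "a \<in> W" "b \<in> W"
    and xs: "distinct xs" "set xs \<inter> W = {}" "walk_edges L \<subseteq> E" "xs = [] \<longrightarrow> a \<noteq> b" by blast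
  have "set L \<inter> W = endpoints L" using ab xs by (auto simp: L endpoints_def)
  moreover have "is_ear E L"
  proof (cases "a = b")
    case False
    then have "is_open_path E L" using ab xs by (auto simp: L is_open_path_def)
    then show ?thesis by (simp add: is_ear_def)
  next
    case True
    then obtain x ys where x: "xs = x # ys" using xs by (cases xs) auto
    show ?thesis
    proof (cases ys)
      case Nil
      then have "is_2cycle E L" using xs True by (auto simp: L x is_2cycle_def)
      then show ?thesis by (simp add: is_ear_def)
    next
      case (Cons y zs)
      have "butlast L = a # xs" by (simp add: L butlast_append)
      then have "is_cycle E L"
        using ab xs True Cons x by (auto simp: is_cycle_def walk_length_def L)
      then show ?thesis by (simp add: is_ear_def)
    qed
  qed
  ultimately show ?l by simp
qed

definition ear_verts :: "'v \<Rightarrow> 'v list list \<Rightarrow> 'v set" where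
  "ear_verts r Ls = insert r (\<Union>L \<in> set Ls. set L)"

definition ear_edges :: "'v list list \<Rightarrow> 'v set set" where
  "ear_edges Ls = (\<Union>L \<in> set Ls. walk_edges L)"

definition n_even :: "'v list list \<Rightarrow> nat" where
  "n_even Ls = length (filter (\<lambda>L. even (walk_length L)) Ls)"

text \<open>Started from a single vertex \<open>r\<close>, the closed first ear is an ear like all others.\<close>

inductive ear_seq :: "'v set set \<Rightarrow> 'v \<Rightarrow> 'v list list \<Rightarrow> bool" for E r where
  Nil: "ear_seq E r []"
| snoc: "ear_seq E r Ls \<Longrightarrow> is_ear E L \<Longrightarrow> set L \<inter> ear_verts r Ls = endpoints L \<Longrightarrow>
    walk_edges L \<inter> ear_edges Ls = {} \<Longrightarrow> ear_seq E r (Ls @ [L])"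

lemma nth_image_take:
  assumes "k \<le> length xs"
  shows "(\<Union>j < k. f (xs ! j)) = (\<Union>x \<in> set (take k xs). f x)"
  using nth_image[OF assms] by (metis image_image atLeast0LessThan)

lemma ear_seq_of_decomposition:
  assumes "generalized_ear_decomposition E Ls"
  shows "ear_seq E (hd (hd Ls)) Ls"
proof -
  let ?r = "hd (hd Ls)"
  note d = assms[unfolded generalized_ear_decomposition_def]
  have ne: "Ls \<noteq> []" and ear: "\<And>L. L \<in> set Ls \<Longrightarrow> is_ear E L"
    and dis: "\<And>i j. i < length Ls \<Longrightarrow> j < length Ls \<Longrightarrow> i \<noteq> j \<Longrightarrow>
      walk_edges (Ls ! i) \<inter> walk_edges (Ls ! j) = {}"
    and closed: "is_cycle E (Ls ! 0) \<or> is_2cycle E (Ls ! 0)"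
    and ends: "\<And>i. 1 \<le> i \<Longrightarrow> i < length Ls \<Longrightarrow>
      set (Ls ! i) \<inter> (\<Union>j < i. set (Ls ! j)) = endpoints (Ls ! i)"
    using d unfolding is_ear_def by blast+
  have hd0: "Ls ! 0 = hd Ls" using ne by (simp add: hd_conv_nth)
  have nonempty: "Ls ! 0 \<noteq> []" using closed by (auto simp: is_cycle_def is_2cycle_def walk_length_def)
  have "endpoints (Ls ! 0) = {?r}"
    using closed hd0 by (auto simp: is_cycle_def is_2cycle_def endpoints_def)
  then have first: "set (Ls ! 0) \<inter> {?r} = endpoints (Ls ! 0)" using nonempty hd0 by auto
  have "k \<le> length Ls \<Longrightarrow> ear_seq E ?r (take k Ls)" for k
  proof (induction k)
    case 0
    show ?case by (simp add: ear_seq.Nil)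
  next
    case (Suc k)
    then have k: "k < length Ls" by simp
    have "set (Ls ! k) \<inter> ear_verts ?r (take k Ls) = endpoints (Ls ! k)"
    proof (cases "k = 0")
      case True
      then show ?thesis using first by (simp add: ear_verts_def)
    next
      case False
      then have "?r \<in> set (Ls ! 0)" using nonempty hd0 by simp
      then have "?r \<in> (\<Union>j < k. set (Ls ! j))" using False by blast
      then have "ear_verts ?r (take k Ls) = (\<Union>j < k. set (Ls ! j))"
        using k by (auto simp: ear_verts_def nth_image_take)
      then show ?thesis using ends[of k] False k by simp
    qed
    moreover have "walk_edges (Ls ! k) \<inter> ear_edges (take k Ls) = {}"
    proof -
      have "ear_edges (take k Ls) = (\<Union>j < k. walk_edges (Ls ! j))"
        using k by (simp add: ear_edges_def nth_image_take)
      moreover have "walk_edges (Ls ! k) \<inter> walk_edges (Ls ! j) = {}" if "j < k" for j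
        using dis[of k j] k that by simp
      ultimately show ?thesis by blast
    qed
    ultimately have "ear_seq E ?r (take k Ls @ [Ls ! k])"
      using Suc k ear by (intro ear_seq.snoc) auto
    then show ?case using k by (simp add: take_Suc_conv_app_nth)
  qed
  from this[of "length Ls"] show ?thesis by simp
qed

lemma ear_seq_ears: "ear_seq E r Ls \<Longrightarrow> L \<in> set Ls \<Longrightarrow> is_ear E L"
  by (induction rule: ear_seq.induct) auto

lemma ear_seq_disjoint:
  "ear_seq E r Ls \<Longrightarrow> i < length Ls \<Longrightarrow> j < i \<Longrightarrow> walk_edges (Ls ! i) \<inter> walk_edges (Ls ! j) = {}"
proof (induction rule: ear_seq.induct)
  case (snoc Ls L)
  show ?case
  proof (cases "i = length Ls")
    case True
    then have "walk_edges (Ls ! j) \<subseteq> ear_edges Ls" using snoc by (auto simp: ear_edges_def)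
    then show ?thesis using snoc True by (auto simp: nth_append)
  next
    case False
    then show ?thesis using snoc by (auto simp: nth_append)
  qed
qed simp

lemma ear_seq_ends:
  "ear_seq E r Ls \<Longrightarrow> i < length Ls \<Longrightarrow>
    set (Ls ! i) \<inter> (insert r (\<Union>j < i. set (Ls ! j))) = endpoints (Ls ! i)"
proof (induction rule: ear_seq.induct)
  case (snoc Ls L)
  show ?case
  proof (cases "i = length Ls")
    case True
    have "(\<Union>j < i. set ((Ls @ [L]) ! j)) = (\<Union>j < i. set (Ls ! j))"
      using True by (intro SUP_cong) (auto simp: nth_append)
    also have "insert r \<dots> = ear_verts r Ls"
      using nth_image_take[of i Ls set] True by (simp add: ear_verts_def)
    finally show ?thesis using snoc True by (simp add: nth_append)
  next
    case False
    then have "(\<Union>j < i. set ((Ls @ [L]) ! j)) = (\<Union>j < i. set (Ls ! j))"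
      using snoc.prems by (intro SUP_cong) (auto simp: nth_append)
    then show ?thesis using snoc False by (simp add: nth_append)
  qed
qed simp

text \<open>The first ear meets \<open>{r}\<close> exactly in its endpoints, so these coincide and
  the ear is not an open path.\<close>

lemma decomposition_of_ear_seq:
  assumes "\<And>x. {x} \<notin> E" "ear_seq E r Ls" "Ls \<noteq> []" "ear_edges Ls = E"
  shows "generalized_ear_decomposition E Ls"
proof -
  have ear: "is_ear E (Ls ! 0)" using ear_seq_ears assms by (metis length_greater_0_conv nth_mem)
  have "set (Ls ! 0) \<inter> {r} = endpoints (Ls ! 0)" using ear_seq_ends[OF assms(2), of 0] assms(3) by simp
  then have "{hd (Ls ! 0), last (Ls ! 0)} \<subseteq> {r}" unfolding endpoints_def by blast
  then have "hd (Ls ! 0) = last (Ls ! 0)" by simp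
  then have "\<not> is_open_path E (Ls ! 0)"
    by (cases "Ls ! 0") (auto simp: is_open_path_def split: if_splits)
  then have first: "is_cycle E (Ls ! 0) \<or> is_2cycle E (Ls ! 0)" using ear by (simp add: is_ear_def)
  have nonempty: "Ls ! 0 \<noteq> []" using first by (auto simp: is_cycle_def is_2cycle_def walk_length_def)
  have "hd (Ls ! 0) \<in> endpoints (Ls ! 0)" by (simp add: endpoints_def)
  then have r: "r \<in> set (Ls ! 0)" unfolding \<open>set (Ls ! 0) \<inter> {r} = endpoints (Ls ! 0)\<close>[symmetric]
    by blast
  have "set (Ls ! i) \<inter> (\<Union>j < i. set (Ls ! j)) = endpoints (Ls ! i)"
    if "1 \<le> i" "i < length Ls" for i
  proof -
    have "r \<in> (\<Union>j < i. set (Ls ! j))" using r that by force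
    then have "insert r (\<Union>j < i. set (Ls ! j)) = (\<Union>j < i. set (Ls ! j))" by blast
    then show ?thesis using ear_seq_ends[OF assms(2) that(2)] by simp
  qed
  then have ends: "\<forall>i. 1 \<le> i \<and> i < length Ls \<longrightarrow>
    set (Ls ! i) \<inter> (\<Union>j < i. set (Ls ! j)) = endpoints (Ls ! i)" by simp
  have "walk_edges (Ls ! i) \<inter> walk_edges (Ls ! j) = {}"
    if "i < length Ls" "j < length Ls" "i \<noteq> j" for i j
    using ear_seq_disjoint[OF assms(2), of i j] ear_seq_disjoint[OF assms(2), of j i] that
    by (cases "i < j") (simp_all add: Int_commute)
  then have disj: "\<forall>i < length Ls. \<forall>j < length Ls. i \<noteq> j \<longrightarrow>
    walk_edges (Ls ! i) \<inter> walk_edges (Ls ! j) = {}" by simp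
  have ears: "\<forall>L \<in> set Ls. is_open_path E L \<or> is_cycle E L \<or> is_2cycle E L"
    using ear_seq_ears[OF assms(2)] by (simp add: is_ear_def)
  have union: "(\<Union>L \<in> set Ls. walk_edges L) = E" using assms(4) by (simp add: ear_edges_def)
  show ?thesis
    unfolding generalized_ear_decomposition_def
    by (intro conjI assms(3) ears union disj first ends)
qed

lemma ear_verts_simps [simp]:
  "ear_verts r [] = {r}" "ear_verts r (Ls @ [L]) = ear_verts r Ls \<union> set L"
  by (auto simp: ear_verts_def)

lemma ear_edges_simps [simp]:
  "ear_edges [] = {}" "ear_edges (Ls @ [L]) = ear_edges Ls \<union> walk_edges L"
  by (auto simp: ear_edges_def)

lemma n_even_simps [simp]:
  "n_even [] = 0" "n_even (Ls @ [L]) = n_even Ls + of_bool (even (walk_length L))"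
  by (auto simp: n_even_def)

lemma ear_seq_finite: "finite (ear_verts r Ls)"
  by (auto simp: ear_verts_def)

lemma ear_edges_sub: "e \<in> ear_edges Ls \<Longrightarrow> e \<subseteq> ear_verts r Ls"
  using walk_edges_sub by (fastforce simp: ear_edges_def ear_verts_def)

lemma ear_seq_edges: "ear_seq E r Ls \<Longrightarrow> ear_edges Ls \<subseteq> E"
  by (induction rule: ear_seq.induct)
    (auto simp: is_ear_def is_open_path_def is_cycle_def is_2cycle_def insert_commute)

section \<open>From ear sequences to strongly connected digraphs\<close>

context bip_graph
begin

definition dgraph :: "'v set set \<Rightarrow> ('v \<times> 'v) set" where
  "dgraph M = {(x, y). {x, y} \<in> E \<and> (x \<in> A \<or> {x, y} \<in> M)}"

lemma loopfree: "{x} \<notin> E"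
  using edge_neq[of x x] by auto

lemma walk_alternates:
  assumes "walk_edges L \<subseteq> E" "2 \<le> length L" "i < length L"
  shows "L ! i \<in> A \<longleftrightarrow> (L ! 0 \<in> A \<longleftrightarrow> even i)"
  using assms(3)
proof (induction i)
  case (Suc i)
  have e: "{L ! i, L ! Suc i} \<in> E" using walk_edges_nth[OF Suc.prems] assms(1) by blast
  then have "L ! Suc i \<in> A \<longleftrightarrow> L ! i \<notin> A" using edge_cases[OF e] AB_disj by blast
  then show ?case using Suc by auto
qed simp

lemma walk_in_V:
  assumes "walk_edges L \<subseteq> E" "2 \<le> length L" "x \<in> set L"
  shows "x \<in> V"
proof -
  obtain i where i: "i < length L" "x = L ! i" using assms(3) by (metis in_set_conv_nth)
  show ?thesis
  proof (cases "Suc i < length L")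
    case True
    then have "{L ! i, L ! Suc i} \<in> E" using walk_edges_nth assms(1) by blast
    then show ?thesis using i edge_V by blast
  next
    case False
    then obtain j where j: "i = Suc j" using i assms(2) by (cases i) auto
    then have "{L ! j, L ! Suc j} \<in> E" using walk_edges_nth[of j L] assms(1) i by blast
    then show ?thesis using i j edge_V by blast
  qed
qed

lemma dgraph_mono: "M \<subseteq> M' \<Longrightarrow> dgraph M \<subseteq> dgraph M'"
  by (auto simp: dgraph_def)

text \<open>Along an ear every second edge is put into \<open>M\<close>, so that the ear can be traversed in one of
  its two directions.\<close>

lemma ear_matching_step:
  assumes L: "L = a # xs @ [b]" "walk_edges L \<subseteq> E"
    and conn: "\<forall>x \<in> W. (r, x) \<in> (dgraph M)\<^sup>* \<and> (x, r) \<in> (dgraph M)\<^sup>*"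
    and W: "a \<in> W" "b \<in> W"
  shows "\<exists>M'. M \<subseteq> M' \<and> M' \<subseteq> M \<union> walk_edges L \<and> card M' \<le> card M + (length xs + 1) div 2 \<and>
    (\<forall>x \<in> W \<union> set L. (r, x) \<in> (dgraph M')\<^sup>* \<and> (x, r) \<in> (dgraph M')\<^sup>*)"
proof -
  \<comment> \<open>These are the edges at odd positions. If \<open>a\<close> lies in
    \<open>A\<close>, they are the steps from \<open>B\<close> to \<open>A\<close> of the forward
    traversal, otherwise those of the backward traversal. One choice thus serves both cases, and the
    remaining edges already point the right way.\<close>
  define N where "N = (\<lambda>j. {L ! (2 * j + 1), L ! Suc (2 * j + 1)}) ` {..<(length xs + 1) div 2}"
  define M' where "M' = M \<union> N"
  have len: "length L = length xs + 2" by (simp add: L)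
  have ends: "L ! 0 = a" "L ! (length xs + 1) = b" by (simp_all add: L nth_append)
  have "N \<subseteq> walk_edges L"
    unfolding N_def
  proof (rule image_subsetI, rule walk_edges_nth)
    fix j assume "j \<in> {..<(length xs + 1) div 2}"
    then have "j < (length xs + 1) div 2" by simp
    then show "Suc (2 * j + 1) < length L" unfolding len by linarith
  qed
  have "card N \<le> (length xs + 1) div 2"
    unfolding N_def by (rule card_image_le[THEN order_trans]) simp_all
  then have card: "card M' \<le> card M + (length xs + 1) div 2"
    unfolding M'_def using card_Un_le[of M N] by linarith
  let ?R = "(dgraph M')\<^sup>*"
  have conn': "(r, x) \<in> ?R \<and> (x, r) \<in> ?R" if "x \<in> W" for x
    using conn that rtrancl_mono[OF dgraph_mono[of M M']] unfolding M'_def by blast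
  have edge: "{L ! i, L ! Suc i} \<in> E" if "i < length xs + 1" for i
    using walk_edges_nth[of i L] that len L(2) by auto
  have odd_edge: "{L ! i, L ! Suc i} \<in> M'" if i: "i < length xs + 1" "odd i" for i
  proof -
    obtain j where j: "i = 2 * j + 1" using i(2) by (rule oddE)
    then have "j < (length xs + 1) div 2" using i(1) by simp
    then show ?thesis unfolding M'_def N_def j by blast
  qed
  have A: "L ! i \<in> A \<longleftrightarrow> (a \<in> A \<longleftrightarrow> even i)" if "i < length xs + 2" for i
    using walk_alternates[OF L(2)] that len ends by simp
  have "(r, L ! i) \<in> ?R \<and> (L ! i, r) \<in> ?R" if i: "i \<le> length xs + 1" for i
  proof (cases "a \<in> A")
    case True
    have arc: "(L ! j, L ! Suc j) \<in> dgraph M'" if "j < length xs + 1" for j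
      using edge[OF that] odd_edge[OF that] A[of j] that True unfolding dgraph_def by auto
    have "(a, L ! i) \<in> ?R"
      using i
    proof (induction i)
      case (Suc i)
      then show ?case using arc[of i] by (auto intro: rtrancl_into_rtrancl)
    qed (simp add: ends)
    moreover have "(L ! i, b) \<in> ?R"
      using i
    proof (induction rule: inc_induct)
      case (step j)
      then show ?case using arc[of j] by (auto intro: converse_rtrancl_into_rtrancl)
    qed (simp add: ends[simplified])
    ultimately show ?thesis using conn'[OF W(1)] conn'[OF W(2)] by (meson rtrancl_trans)
  next
    case False
    have arc: "(L ! Suc j, L ! j) \<in> dgraph M'" if "j < length xs + 1" for j
      using edge[OF that] odd_edge[OF that] A[of "Suc j"] that False
      unfolding dgraph_def by (auto simp: insert_commute)
    have "(L ! i, a) \<in> ?R"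
      using i
    proof (induction i)
      case (Suc i)
      then show ?case using arc[of i] by (auto intro: converse_rtrancl_into_rtrancl)
    qed (simp add: ends)
    moreover have "(b, L ! i) \<in> ?R"
      using i
    proof (induction rule: inc_induct)
      case (step j)
      then show ?case using arc[of j] by (auto intro: rtrancl_into_rtrancl)
    qed (simp add: ends[simplified])
    ultimately show ?thesis using conn'[OF W(1)] conn'[OF W(2)] by (meson rtrancl_trans)
  qed
  then have "(r, x) \<in> ?R \<and> (x, r) \<in> ?R" if "x \<in> set L" for x
    using that len by (metis in_set_conv_nth Suc_eq_plus1 add_2_eq_Suc' less_Suc_eq_le)
  then show ?thesis
    using conn' card \<open>N \<subseteq> walk_edges L\<close> by (intro exI[of _ M']) (auto simp: M'_def)
qed

text \<open>An ear with k inner vertices has length k + 1 and costs (k + 1) div 2 edges of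
  \<open>M\<close>. Twice that number is k, plus one if the ear is even. Summing over the ears gives
  the bound; the root accounts for the summand 1.\<close>

lemma matching_of_ear_seq:
  assumes "ear_seq E r Ls"
  shows "\<exists>M \<subseteq> ear_edges Ls. 2 * card M + 1 \<le> n_even Ls + card (ear_verts r Ls) \<and>
    (\<forall>x \<in> ear_verts r Ls. (r, x) \<in> (dgraph M)\<^sup>* \<and> (x, r) \<in> (dgraph M)\<^sup>*)"
  using assms
proof (induction rule: ear_seq.induct)
  case Nil
  then show ?case by simp
next
  case (snoc Ls L)
  let ?W = "ear_verts r Ls"
  obtain M where M: "M \<subseteq> ear_edges Ls" "2 * card M + 1 \<le> n_even Ls + card ?W"
    "\<forall>x \<in> ?W. (r, x) \<in> (dgraph M)\<^sup>* \<and> (x, r) \<in> (dgraph M)\<^sup>*" using snoc.IH by blast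
  obtain a xs b where L: "L = a # xs @ [b]" and ab: "a \<in> ?W" "b \<in> ?W"
    and xs: "distinct xs" "set xs \<inter> ?W = {}" "walk_edges L \<subseteq> E"
    using ear_shape[OF loopfree, of L ?W] snoc.hyps by blast
  obtain M' where M': "M' \<subseteq> M \<union> walk_edges L" "card M' \<le> card M + (length xs + 1) div 2"
    "\<forall>x \<in> ?W \<union> set L. (r, x) \<in> (dgraph M')\<^sup>* \<and> (x, r) \<in> (dgraph M')\<^sup>*"
    using ear_matching_step[OF L xs(3) M(3) ab] by blast
  have "?W \<union> set L = ?W \<union> set xs" using ab by (auto simp: L)
  then have "card (?W \<union> set L) = card ?W + length xs"
    using xs card_Un_disjoint[OF ear_seq_finite, of "set xs" r Ls] by (simp add: distinct_card Int_commute)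
  moreover have "2 * ((length xs + 1) div 2) = length xs + of_bool (even (walk_length L))"
    by (cases "even (length xs)") (auto simp: L walk_length_def elim!: evenE oddE)
  ultimately have "2 * card M' + 1 \<le> n_even (Ls @ [L]) + card (?W \<union> set L)"
    using M(2) M'(2) by simp
  then show ?case using M M' by (intro exI[of _ M']) auto
qed

section \<open>From strongly connected digraphs back to ear sequences\<close>

lemma shortest_return:
  assumes "(x, w) \<in> R\<^sup>*" "w \<in> W" "x \<notin> W"
  shows "\<exists>xs b. xs \<noteq> [] \<and> hd xs = x \<and> distinct xs \<and> set xs \<inter> W = {} \<and> b \<in> W \<and>
    (\<forall>i < length xs. ((xs @ [b]) ! i, (xs @ [b]) ! Suc i) \<in> R)"
  using assms
proof (induction rule: converse_rtrancl_induct)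
  case base
  then show ?case by (rule notE[rotated])
next
  case (step x y)
  show ?case
  proof (cases "y \<in> W")
    case True
    then show ?thesis using step by (intro exI[of _ "[x]"] exI[of _ y]) auto
  next
    case False
    then obtain ys b where ys: "ys \<noteq> []" "hd ys = y" "distinct ys" "set ys \<inter> W = {}" "b \<in> W"
      "\<forall>i < length ys. ((ys @ [b]) ! i, (ys @ [b]) ! Suc i) \<in> R" using step by blast
    show ?thesis
    proof (cases "x \<in> set ys")
      case False
      have "((x # ys @ [b]) ! i, (x # ys @ [b]) ! Suc i) \<in> R" if "i < Suc (length ys)" for i
      proof (cases i)
        case 0
        then show ?thesis using ys(1,2) step(1) by (cases ys) auto
      next
        case (Suc j)
        then show ?thesis using ys(6) that by simp
      qed
      then show ?thesis using False ys step.prems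
        by (intro exI[of _ "x # ys"] exI[of _ b]) auto
    next
      case True
      \<comment> \<open>The return path from \<open>y\<close> already passes through
        \<open>x\<close>, so its tail starting at \<open>x\<close> serves.\<close>
      then obtain us vs where split: "ys = us @ x # vs" by (metis split_list)
      have "(((x # vs) @ [b]) ! i, ((x # vs) @ [b]) ! Suc i) \<in> R" if "i < length (x # vs)" for i
        using ys(6)[rule_format, of "length us + i"] that
        by (simp add: split nth_append del: append_Cons) 
      then show ?thesis using ys split by (intro exI[of _ "x # vs"] exI[of _ b]) auto
    qed
  qed
qed

end

lemma rtrancl_crossing:
  assumes "(x, y) \<in> R\<^sup>*" "x \<in> W" "y \<notin> W"
  shows "\<exists>a b. (a, b) \<in> R \<and> a \<in> W \<and> b \<notin> W"
  using assms
proof (induction rule: rtrancl_induct)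
  case (step y z)
  then show ?case by (cases "y \<in> W") auto
qed simp

context bip_graph
begin

text \<open>Strong connectivity supplies an arc leaving \<open>W\<close> and a directed way back,
  together an ear. Its arcs out of \<open>B\<close> come from edges of \<open>M\<close>. With k
  inner vertices there are at least (k + 1) div 2 of them, and none of these edges lies inside
  \<open>W\<close>, so the inequality \<open>count\<close> is preserved.\<close>

lemma ear_extension:
  assumes M: "M \<subseteq> E" and conn: "\<And>x y. x \<in> V \<Longrightarrow> y \<in> V \<Longrightarrow> (x, y) \<in> (dgraph M)\<^sup>*"
    and seq: "ear_seq E r Ls" and W: "W = ear_verts r Ls" "W \<subset> V"
    and count: "n_even Ls + card W \<le> 2 * card {e \<in> M. e \<subseteq> W} + 1"
  shows "\<exists>L. ear_seq E r (Ls @ [L]) \<and> W \<subset> W \<union> set L \<and> set L \<subseteq> V \<and>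
    n_even (Ls @ [L]) + card (W \<union> set L) \<le> 2 * card {e \<in> M. e \<subseteq> W \<union> set L} + 1"
proof -
  have r: "r \<in> W" by (simp add: W(1) ear_verts_def)
  obtain y where y: "y \<in> V" "y \<notin> W" using W(2) by blast
  then have "(r, y) \<in> (dgraph M)\<^sup>*" using conn r W(2) by blast
  then obtain a x where ax: "(a, x) \<in> dgraph M" "a \<in> W" "x \<notin> W"
    using rtrancl_crossing[of r y _ W] r y by metis
  have "x \<in> V" using ax(1) edge_V[of a x] by (simp add: dgraph_def)
  then have "(x, r) \<in> (dgraph M)\<^sup>*" using conn r W(2) by blast
  from shortest_return[OF this r ax(3)] obtain xs b where xs: "xs \<noteq> []" "hd xs = x" "distinct xs"
    "set xs \<inter> W = {}" "b \<in> W" 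
    and arcs: "\<forall>i < length xs. ((xs @ [b]) ! i, (xs @ [b]) ! Suc i) \<in> dgraph M"
    by (elim exE conjE)
  define L where "L = a # xs @ [b]"
  let ?k = "length xs"
  have len: "length L = ?k + 2" by (simp add: L_def)
  have arc: "(L ! i, L ! Suc i) \<in> dgraph M" if "i \<le> ?k" for i
  proof (cases i)
    case 0
    then show ?thesis using ax(1) xs(1,2) by (cases xs) (simp_all add: L_def)
  next
    case (Suc j)
    then show ?thesis using arcs[rule_format, of j] that by (simp add: L_def)
  qed
  have walk: "walk_edges L \<subseteq> E"
  proof
    fix e assume "e \<in> walk_edges L"
    then obtain i where "e = {L ! i, L ! Suc i}" "i \<le> ?k" by (auto simp: walk_edges_def len)
    then show "e \<in> E" using arc[of i] by (simp add: dgraph_def)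
  qed
  have new: "\<not> {L ! i, L ! Suc i} \<subseteq> W" if "i \<le> ?k" for i
  proof (cases i)
    case 0
    then have "L ! Suc i = x" using xs(1,2) by (cases xs) (simp_all add: L_def)
    then show ?thesis using ax(3) by simp
  next
    case (Suc j)
    then have "L ! i = xs ! j" using that by (simp add: L_def nth_append)
    moreover have "xs ! j \<in> set xs" using Suc that by simp
    ultimately show ?thesis using xs(4) by auto
  qed
  have "is_ear E L \<and> set L \<inter> W = endpoints L"
    unfolding ear_shape[OF loopfree] using ax(2) xs walk L_def by blast
  moreover have "walk_edges L \<inter> ear_edges Ls = {}"
  proof -
    have "e \<notin> ear_edges Ls" if e: "e \<in> walk_edges L" for e
    proof -
      obtain i where "e = {L ! i, L ! Suc i}" "i \<le> ?k" using e by (auto simp: walk_edges_def len)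
      then have "\<not> e \<subseteq> W" using new by simp
      then show ?thesis using ear_edges_sub[of e Ls r] W(1) by blast
    qed
    then show ?thesis by blast
  qed
  ultimately have seq': "ear_seq E r (Ls @ [L])" using seq W(1) by (intro ear_seq.snoc) simp_all
  have setL: "W \<union> set L = W \<union> set xs" using ax(2) xs(5) by (auto simp: L_def)
  have "x \<in> set xs" using xs(1,2) by auto
  then have larger: "W \<subset> W \<union> set L" using ax(3) setL by blast
  have inV: "set L \<subseteq> V" using walk_in_V[OF walk] len by auto
  have finW: "finite W" using W(2) finV finite_subset by blast
  have cardW: "card (W \<union> set L) = card W + ?k"
    unfolding setL using card_Un_disjoint[OF finW, of "set xs"] xs(3,4)
    by (simp add: distinct_card Int_commute)
  define I where "I = {i. i \<le> ?k \<and> L ! i \<in> B}"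
  define g where "g = (\<lambda>i. {L ! i, L ! Suc i})"
  have finI: "finite I" by (simp add: I_def)
  have Bk: "L ! i \<in> B \<longleftrightarrow> (L ! 0 \<in> B \<longleftrightarrow> even i)" if "i \<le> ?k" for i
  proof -
    have "L ! i \<in> V" "L ! 0 \<in> V" using inV that len by (auto intro!: subsetD[OF inV])
    then have "L ! i \<in> B \<longleftrightarrow> L ! i \<notin> A" "L ! 0 \<in> B \<longleftrightarrow> L ! 0 \<notin> A" using AB_V AB_disj by blast+
    then show ?thesis using walk_alternates[OF walk, of i] that len by auto
  qed
  have cardI: "(?k + 1) div 2 \<le> card I"
  proof -
    let ?h = "\<lambda>j. if L ! 0 \<in> B then 2 * j else 2 * j + 1"
    have "?h ` {..<(?k + 1) div 2} \<subseteq> I"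
    proof (rule image_subsetI)
      fix j assume "j \<in> {..<(?k + 1) div 2}"
      then have "2 * j + 1 \<le> ?k" by auto
      then show "?h j \<in> I" using Bk[of "?h j"] by (simp add: I_def)
    qed
    moreover have "inj_on ?h {..<(?k + 1) div 2}" by (auto simp: inj_on_def split: if_splits)
    ultimately show ?thesis using card_inj_on_le[OF _ _ finI] by fastforce
  qed
  have dist: "distinct (a # xs)" using xs(3,4) ax(2) by auto
  \<comment> \<open>An edge is determined by its end in \<open>B\<close>, and the vertices
    \<open>a # xs\<close> from which the steps start are distinct even when the ear is
    closed.\<close>
  have inj: "inj_on g I"
  proof (rule inj_onI)
    fix i j assume ij: "i \<in> I" "j \<in> I" "g i = g j"
    have iE: "{L ! i, L ! Suc i} \<in> E" and jE: "{L ! j, L ! Suc j} \<in> E"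
      using arc[of i] arc[of j] ij by (auto simp: I_def dgraph_def)
    have "L ! Suc j \<in> A" using edge_BA[OF jE] ij by (simp add: I_def)
    then have "L ! i \<noteq> L ! Suc j" using ij AB_disj by (auto simp: I_def)
    then have "L ! i = L ! j" using ij(3) by (auto simp: g_def doubleton_eq_iff)
    moreover have "L ! i = (a # xs) ! i" "L ! j = (a # xs) ! j"
      using ij by (auto simp: L_def I_def nth_append nth_Cons split: nat.splits)
    ultimately show "i = j" using dist ij nth_eq_iff_index_eq[of "a # xs" i j] by (simp add: I_def)
  qed
  let ?M = "\<lambda>W. {e \<in> M. e \<subseteq> W}"
  have gM: "g ` I \<subseteq> M"
  proof (rule image_subsetI)
    fix i assume i: "i \<in> I"
    then have "L ! i \<notin> A" using AB_disj by (auto simp: I_def)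
    then show "g i \<in> M" using arc[of i] i by (simp add: I_def dgraph_def g_def)
  qed
  have "g ` I \<subseteq> ?M (W \<union> set L)"
  proof (rule image_subsetI)
    fix i assume i: "i \<in> I"
    then have "L ! i \<in> set L" "L ! Suc i \<in> set L" by (simp_all add: I_def len)
    then show "g i \<in> ?M (W \<union> set L)" using gM i by (auto simp: g_def)
  qed
  then have "?M W \<union> g ` I \<subseteq> ?M (W \<union> set L)" by auto
  moreover have finM: "finite M" using M finE finite_subset by blast
  ultimately have "card (?M W \<union> g ` I) \<le> card (?M (W \<union> set L))" by (intro card_mono) auto
  moreover have "?M W \<inter> g ` I = {}" using new by (auto simp: g_def I_def)
  ultimately have "card (?M W) + card I \<le> card (?M (W \<union> set L))"
    using card_Un_disjoint[of "?M W" "g ` I"] finM finI card_image[OF inj] by simp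
  moreover have "2 * ((?k + 1) div 2) = ?k + of_bool (even (walk_length L))"
    by (cases "even ?k") (auto simp: L_def walk_length_def elim!: evenE oddE)
  ultimately have "n_even (Ls @ [L]) + card (W \<union> set L) \<le> 2 * card (?M (W \<union> set L)) + 1"
    using count cardI cardW by simp
  then show ?thesis using seq' larger inV by blast
qed

lemma spanning_ear_seq:
  assumes M: "M \<subseteq> E" and conn: "\<And>x y. x \<in> V \<Longrightarrow> y \<in> V \<Longrightarrow> (x, y) \<in> (dgraph M)\<^sup>*" and r: "r \<in> V"
  shows "\<exists>Ls. ear_seq E r Ls \<and> ear_verts r Ls = V \<and> n_even Ls + card V \<le> 2 * card M + 1"
proof -
  have "\<exists>Ls'. ear_seq E r Ls' \<and> ear_verts r Ls' = V \<and> n_even Ls' + card V \<le> 2 * card M + 1"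
    if "ear_seq E r Ls" "ear_verts r Ls \<subseteq> V"
      "n_even Ls + card (ear_verts r Ls) \<le> 2 * card {e \<in> M. e \<subseteq> ear_verts r Ls} + 1" for Ls
    using that
  proof (induction "card V - card (ear_verts r Ls)" arbitrary: Ls rule: less_induct)
    case less
    let ?W = "ear_verts r Ls"
    show ?case
    proof (cases "?W = V")
      case True
      have "card {e \<in> M. e \<subseteq> V} \<le> card M"
        using M finE finite_subset by (intro card_mono) auto
      then have "n_even Ls + card V \<le> 2 * card M + 1" using less.prems(3) True by simp
      then show ?thesis using less.prems(1) True by blast
    next
      case False
      then have sub: "?W \<subset> V" using less.prems by blast
      obtain L where L: "ear_seq E r (Ls @ [L])" "?W \<subset> ?W \<union> set L" "set L \<subseteq> V"
        "n_even (Ls @ [L]) + card (?W \<union> set L) \<le> 2 * card {e \<in> M. e \<subseteq> ?W \<union> set L} + 1"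
        using ear_extension[OF M conn less.prems(1) refl sub less.prems(3)] by blast
      have sub': "?W \<union> set L \<subseteq> V" using sub L(3) by blast
      have "card ?W < card (?W \<union> set L)"
        using L(2) sub' finV finite_subset by (intro psubset_card_mono) auto
      moreover have "card (?W \<union> set L) \<le> card V" using sub' finV by (intro card_mono) auto
      ultimately have "card V - card (ear_verts r (Ls @ [L])) < card V - card ?W" by simp
      from less.hyps[OF this L(1)] show ?thesis using L(4) sub' by simp
    qed
  qed
  from this[of "[]"] show ?thesis using r by (simp add: ear_seq.Nil)
qed

text \<open>A missing edge joins two vertices already reached, so it is an ear of length 1. This
  length is odd and leaves \<open>n_even\<close> unchanged.\<close>

lemma fill_ear_seq:
  assumes "ear_seq E r Ls" "ear_verts r Ls = V"
  shows "\<exists>Ls'. ear_seq E r Ls' \<and> ear_verts r Ls' = V \<and> ear_edges Ls' = E \<and> n_even Ls' = n_even Ls"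
  using assms
proof (induction "card (E - ear_edges Ls)" arbitrary: Ls rule: less_induct)
  case less
  show ?case
  proof (cases "ear_edges Ls = E")
    case True
    then show ?thesis using less.prems by blast
  next
    case False
    then obtain e where e: "e \<in> E" "e \<notin> ear_edges Ls" using ear_seq_edges[OF less.prems(1)] by blast
    then obtain x y where xy: "e = {x, y}" using edges by blast
    then have "{x, y} \<in> E" using e by simp
    then have nxy: "x \<noteq> y" "x \<in> V" "y \<in> V" using edge_neq edge_V by blast+
    let ?L = "[x, y]"
    have "is_ear E ?L" using nxy e xy by (simp add: is_ear_def is_open_path_def)
    moreover have "set ?L \<inter> ear_verts r Ls = endpoints ?L"
      using nxy less.prems(2) by (auto simp: endpoints_def)
    moreover have "walk_edges ?L \<inter> ear_edges Ls = {}" using e xy by simp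
    ultimately have seq: "ear_seq E r (Ls @ [?L])" using less.prems by (intro ear_seq.snoc)
    have verts: "ear_verts r (Ls @ [?L]) = V" using less.prems(2) nxy by auto
    have "E - ear_edges (Ls @ [?L]) \<subset> E - ear_edges Ls" using e xy by auto
    then have "card (E - ear_edges (Ls @ [?L])) < card (E - ear_edges Ls)"
      using finE by (intro psubset_card_mono) auto
    from less.hyps[OF this seq verts] show ?thesis by (simp add: walk_length_def)
  qed
qed

text \<open>The existence of a decomposition is stated separately because it is what makes the
  infimum in \<open>ear_phi\<close> attained. Taking \<open>M = E\<close> gives it for every
  connected bipartite graph on at least two vertices.\<close>

lemma ear_phi_le:
  assumes "2 \<le> card V" "M \<subseteq> E" "\<And>x y. x \<in> V \<Longrightarrow> y \<in> V \<Longrightarrow> (x, y) \<in> (dgraph M)\<^sup>*"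
  shows "\<exists>Ls. generalized_ear_decomposition E Ls" "ear_phi E + card V \<le> 2 * card M + 1"
proof -
  obtain r where r: "r \<in> V" using assms(1) by fastforce
  obtain Ls where Ls: "ear_seq E r Ls" "ear_verts r Ls = V" "ear_edges Ls = E"
    "n_even Ls + card V \<le> 2 * card M + 1"
    using spanning_ear_seq[OF assms(2,3) r] fill_ear_seq by metis
  have "Ls \<noteq> []" using Ls(2) assms(1) by auto
  then have d: "generalized_ear_decomposition E Ls"
    using decomposition_of_ear_seq[OF loopfree Ls(1) _ Ls(3)] by blast
  then show "\<exists>Ls. generalized_ear_decomposition E Ls" by blast
  have "ear_phi E \<le> n_even Ls"
    unfolding ear_phi_def n_even_def by (rule cInf_lower) (use d in auto)
  then show "ear_phi E + card V \<le> 2 * card M + 1" using Ls(4) by linarith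
qed

lemma matching_of_ear_phi:
  assumes "2 \<le> card V" "V = \<Union> E" "\<exists>Ls. generalized_ear_decomposition E Ls"
  shows "\<exists>M \<subseteq> E. 2 * card M + 1 \<le> ear_phi E + card V \<and>
    (\<forall>x \<in> V. \<forall>y \<in> V. (x, y) \<in> (dgraph M)\<^sup>*)"
proof -
  let ?S = "{length (filter (\<lambda>L. even (walk_length L)) Ls) |Ls. generalized_ear_decomposition E Ls}"
  have "Inf ?S \<in> ?S" using assms(3) by (intro Inf_nat_def1) blast
  then obtain Ls where Ls: "generalized_ear_decomposition E Ls" "ear_phi E = n_even Ls"
    unfolding ear_phi_def n_even_def by blast
  let ?r = "hd (hd Ls)"
  have seq: "ear_seq E ?r Ls" by (rule ear_seq_of_decomposition[OF Ls(1)])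
  have E: "ear_edges Ls = E" using Ls(1) by (simp add: generalized_ear_decomposition_def ear_edges_def)
  have ears: "is_ear E L" if "L \<in> set Ls" for L using ear_seq_ears[OF seq that] .
  have "set L \<subseteq> V" if "L \<in> set Ls" for L
  proof -
    have "walk_edges L \<subseteq> E" "2 \<le> length L" using ears[OF that]
      by (auto simp: is_ear_def is_open_path_def is_cycle_def is_2cycle_def walk_length_def insert_commute)
    then show ?thesis using walk_in_V by blast
  qed
  moreover have "?r \<in> set (hd Ls)" "hd Ls \<in> set Ls"
  proof -
    show "hd Ls \<in> set Ls" using Ls(1) by (simp add: generalized_ear_decomposition_def)
    from ears[OF this] have "hd Ls \<noteq> []"
      by (auto simp: is_ear_def is_open_path_def is_cycle_def is_2cycle_def walk_length_def)
    then show "?r \<in> set (hd Ls)" by simp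
  qed
  ultimately have sub: "ear_verts ?r Ls \<subseteq> V" unfolding ear_verts_def by blast
  have "V \<subseteq> ear_verts ?r Ls" using assms(2) E ear_edges_sub[of _ Ls ?r] by blast
  then have W: "ear_verts ?r Ls = V" using sub by blast
  obtain M where M: "M \<subseteq> E" "2 * card M + 1 \<le> ear_phi E + card V"
    "\<forall>x \<in> V. (?r, x) \<in> (dgraph M)\<^sup>* \<and> (x, ?r) \<in> (dgraph M)\<^sup>*"
    using matching_of_ear_seq[OF seq] E W Ls(2) by auto
  then show ?thesis by (meson rtrancl_trans)
qed

end

section \<open>Exponent vectors with disconnected degree complex\<close>

context bip_graph
begin

lemma edgeE:
  assumes "e \<in> E"
  obtains a b where "e = {a, b}" "a \<in> A" "b \<in> B"
  using assms edges by blast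

text \<open>\<open>good s\<close> says that the degree complex of \<open>I\<^sup>s\<^sup>+\<^sup>1\<close> at some exponent vector has only the two
  facets \<open>A\<close> and \<open>B\<close>; here \<open>C\<close> ranges over the complements of faces.\<close>

definition good :: "nat \<Rightarrow> bool" where
  "good s \<longleftrightarrow> (\<exists>f :: 'v \<Rightarrow> nat. sum f A = s \<and> sum f B = s \<and>
    (\<forall>C. cover C \<longrightarrow> \<not> A \<subseteq> C \<longrightarrow> \<not> B \<subseteq> C \<longrightarrow> s < sum f C))"

text \<open>Adding the degree vector of one edge raises the weights of \<open>A\<close> and
  \<open>B\<close> by exactly one and that of every cover by at least one. Hence depth 1 persists
  once it is reached.\<close>

lemma good_Suc:
  assumes "E \<noteq> {}" "good s"
  shows "good (Suc s)"
proof -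
  obtain u v where uv: "u \<in> A" "v \<in> B" "{u, v} \<in> E" using assms(1) edges by blast
  obtain f where f: "sum f A = s" "sum f B = s"
    "\<And>C. cover C \<Longrightarrow> \<not> A \<subseteq> C \<Longrightarrow> \<not> B \<subseteq> C \<Longrightarrow> s < sum f C"
    using assms(2) unfolding good_def by blast
  have neq: "u \<noteq> v" "u \<notin> B" "v \<notin> A" using uv AB_disj by auto
  let ?g = "f(u := Suc (f u), v := Suc (f v))"
  have "?g(u := ?g u - 1, v := ?g v - 1) = f" using neq by (auto simp: fun_eq_iff)
  then have eq: "sum ?g C = sum f C + of_bool (u \<in> C) + of_bool (v \<in> C)" if "finite C" for C
    using sum_fun_upd_decrement[of C ?g u] sum_fun_upd_decrement[of C "?g(u := ?g u - 1)" v] that neq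
    by simp
  have "sum ?g A = Suc s" "sum ?g B = Suc s" using eq finA finB f neq uv by simp_all
  moreover have "Suc s < sum ?g C" if C: "cover C" "\<not> A \<subseteq> C" "\<not> B \<subseteq> C" for C
  proof -
    have "u \<in> C \<or> v \<in> C" using C(1) uv(3) unfolding cover_def by blast
    then show ?thesis using eq[OF cover_fin[OF C(1)]] f(3)[OF C] by auto
  qed
  ultimately show ?thesis unfolding good_def by blast
qed

lemma induced_bip_graph:
  assumes "U \<subseteq> V"
  shows "bip_graph U (A \<inter> U) (B \<inter> U) (induced_edges E U)"
proof
  show "finite U" using assms finV finite_subset by blast
  show "A \<inter> U \<union> B \<inter> U = U" using assms AB_V by blast
  show "A \<inter> U \<inter> (B \<inter> U) = {}" using AB_disj by blast
  show "induced_edges E U \<subseteq> {{a, b} |a b. a \<in> A \<inter> U \<and> b \<in> B \<inter> U}"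
  proof
    fix e assume "e \<in> induced_edges E U"
    then have e: "e \<in> E" "e \<subseteq> U" by (simp_all add: induced_edges_def)
    from e(1) obtain a b where "e = {a, b}" "a \<in> A" "b \<in> B" by (rule edgeE)
    then show "e \<in> {{a, b} |a b. a \<in> A \<inter> U \<and> b \<in> B \<inter> U}" using e(2) by auto
  qed
qed

lemma sum_degrees:
  assumes "finite M" "finite X"
  shows "(\<Sum>v \<in> X. card {e \<in> M. v \<in> e}) = (\<Sum>e \<in> M. card (e \<inter> X))"
proof -
  have "(\<Sum>v \<in> X. card {e \<in> M. v \<in> e}) = (\<Sum>v \<in> X. \<Sum>e \<in> M. of_bool (v \<in> e))"
    using assms by (intro sum.cong refl) (simp add: sum.If_cases of_bool_def Int_def)
  also have "\<dots> = (\<Sum>e \<in> M. \<Sum>v \<in> X. of_bool (v \<in> e))" by (rule sum.swap)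
  also have "\<dots> = (\<Sum>e \<in> M. card (e \<inter> X))"
    using assms by (intro sum.cong refl) (simp add: sum.If_cases of_bool_def Int_def conj_commute)
  finally show ?thesis .
qed

text \<open>The weight is the degree vector of \<open>M\<close>, so every cover weighs at least
  \<open>card M\<close>. A cover \<open>C\<close> attaining this bound meets each edge of
  \<open>M\<close> only once, and then \<open>(A - C) \<union> (B \<inter> C)\<close> is closed
  under the arcs. If \<open>C\<close> contains neither part, domination puts a vertex of
  \<open>U\<close> inside this set and another outside, against strong connectivity.\<close>

lemma good_of_matching:
  assumes U: "U \<subseteq> V" "dominating V E U" and M: "M \<subseteq> induced_edges E U"
    and conn: "\<forall>x \<in> U. \<forall>y \<in> U. (x, y) \<in> (bip_graph.dgraph (A \<inter> U) (induced_edges E U) M)\<^sup>*"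
  shows "good (card M)"
proof -
  interpret U: bip_graph U "A \<inter> U" "B \<inter> U" "induced_edges E U" by (rule induced_bip_graph[OF U(1)])
  define f where "f = (\<lambda>v. card {e \<in> M. v \<in> e})"
  have finM: "finite M" using M U.finE finite_subset by blast
  have ME: "M \<subseteq> E" using M by (auto simp: induced_edges_def)
  have sumf: "sum f X = (\<Sum>e \<in> M. card (e \<inter> X))" if "finite X" for X
    unfolding f_def using sum_degrees[OF finM that] .
  have one: "card (e \<inter> A) = 1 \<and> card (e \<inter> B) = 1" if "e \<in> M" for e
  proof -
    have "e \<in> E" using \<open>e \<in> M\<close> ME by blast
    then obtain a b where ab: "e = {a, b}" "a \<in> A" "b \<in> B" by (rule edgeE)
    then have "e \<inter> A = {a}" "e \<inter> B = {b}" using AB_disj by auto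
    then show ?thesis by simp
  qed
  have "sum f A = card M" "sum f B = card M" using sumf finA finB one by simp_all
  moreover have "card M < sum f C" if C: "cover C" "\<not> A \<subseteq> C" "\<not> B \<subseteq> C" for C
  proof (rule ccontr)
    assume neg: "\<not> card M < sum f C"
    have ge: "1 \<le> card (e \<inter> C)" if "e \<in> M" for e
    proof -
      have "e \<in> E" using \<open>e \<in> M\<close> ME by blast
      then obtain a b where "e = {a, b}" "{a, b} \<in> E" by (metis edgeE)
      then have "e \<inter> C \<noteq> {}" using C(1) unfolding cover_def by blast
      then show ?thesis using cover_fin[OF C(1)] by (simp add: Suc_leI card_gt_0_iff)
    qed
    have eq1: "card (e \<inter> C) = 1" if e: "e \<in> M" for e
    proof (rule ccontr)
      assume "card (e \<inter> C) \<noteq> 1"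
      then have "1 < card (e \<inter> C)" using ge[OF e] by linarith
      then have "(\<Sum>e \<in> M. 1) < (\<Sum>e \<in> M. card (e \<inter> C))"
        using sum_strict_mono_ex1[OF finM, of "\<lambda>_. 1" "\<lambda>e. card (e \<inter> C)"] ge e by blast
      then show False using neg sumf[OF cover_fin[OF C(1)]] by simp
    qed
    let ?S = "(A - C) \<union> (B \<inter> C)"
    have closed: "y \<in> ?S" if xy: "(x, y) \<in> U.dgraph M" "x \<in> ?S" for x y
    proof -
      have e: "{x, y} \<in> E" and or: "x \<in> A \<or> {x, y} \<in> M"
        using xy(1) unfolding U.dgraph_def by (auto simp: induced_edges_def)
      show ?thesis
      proof (cases "x \<in> A")
        case True
        then have "x \<notin> C" using xy(2) AB_disj by blast
        then have "y \<in> C" using e C(1) unfolding cover_def by blast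
        then show ?thesis using edge_AB[OF e True] by blast
      next
        case False
        then have x: "x \<in> B" "x \<in> C" "{x, y} \<in> M" using xy(2) or by auto
        have "y \<notin> C"
        proof
          assume "y \<in> C"
          then have "{x, y} \<inter> C = {x, y}" using x by blast
          then show False using eq1[OF x(3)] edge_neq[OF e] by simp
        qed
        then show ?thesis using edge_BA[OF e x(1)] by blast
      qed
    qed
    obtain a b where ab: "a \<in> A" "a \<notin> C" "b \<in> B" "b \<notin> C" using C by blast
    have "\<exists>x \<in> U. x \<in> ?S"
    proof (cases "a \<in> U")
      case False
      then have "a \<in> V - U" using ab A_sub by blast
      then obtain u where u: "u \<in> U" "{a, u} \<in> E"
        using U(2) unfolding dominating_def by (metis insert_commute)
      then have "u \<in> C" using C(1) ab(2) unfolding cover_def by blast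
      then show ?thesis using u edge_AB[OF u(2) ab(1)] by blast
    qed (use ab in blast)
    then obtain x where x: "x \<in> U" "x \<in> ?S" by blast
    have "\<exists>y \<in> U. y \<notin> ?S"
    proof (cases "b \<in> U")
      case True
      then show ?thesis using ab AB_disj by blast
    next
      case False
      then have "b \<in> V - U" using ab B_sub by blast
      then obtain u where u: "u \<in> U" "{b, u} \<in> E"
        using U(2) unfolding dominating_def by (metis insert_commute)
      then have "u \<in> C" using C(1) ab(4) unfolding cover_def by blast
      then show ?thesis using u edge_BA[OF u(2) ab(3)] AB_disj by blast
    qed
    then obtain y where y: "y \<in> U" "y \<notin> ?S" by blast
    have "(x, y) \<in> (U.dgraph M)\<^sup>*" using conn x y by blast
    then show False using rtrancl_crossing[OF _ x(2) y(2)] closed by blast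
  qed
  ultimately show ?thesis unfolding good_def by blast
qed

text \<open>Otherwise replacing \<open>v\<close> in \<open>A\<close> by its neighbours, all of
  weight zero, gives a cover of weight at most \<open>s\<close>. It cannot contain \<open>B\<close>,
  whose weight is positive. Applied on both sides, this makes the support of \<open>f\<close>
  dominating.\<close>

lemma nbr_of_good_weight:
  fixes f :: "'v \<Rightarrow> nat"
  assumes f: "sum f A = s" "sum f B = s" "0 < s"
    "\<And>C. cover C \<Longrightarrow> \<not> A \<subseteq> C \<Longrightarrow> \<not> B \<subseteq> C \<Longrightarrow> s < sum f C"
    and v: "v \<in> A" "f v = 0"
  shows "\<exists>u. {u, v} \<in> E \<and> 0 < f u"
proof (rule ccontr)
  assume neg: "\<not> ?thesis"
  let ?N = "{u \<in> B. {u, v} \<in> E}"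
  let ?C = "(A - {v}) \<union> ?N"
  have N0: "sum f ?N = 0" using neg by simp
  have "cover ?C"
    unfolding cover_def
  proof (intro conjI allI impI)
    show "?C \<subseteq> V" using AB_V by blast
    fix x y assume xy: "{x, y} \<in> E"
    then have yx: "{y, x} \<in> E" by (simp add: insert_commute)
    from edge_cases[OF xy] show "x \<in> ?C \<or> y \<in> ?C"
    proof
      assume "x \<in> A \<and> y \<in> B"
      then show ?thesis using yx by (cases "x = v") auto
    next
      assume "x \<in> B \<and> y \<in> A"
      then show ?thesis using xy by (cases "y = v") auto
    qed
  qed
  moreover have "\<not> A \<subseteq> ?C" using v(1) AB_disj by blast
  moreover have "\<not> B \<subseteq> ?C"
  proof
    assume "B \<subseteq> ?C"
    then have "?N = B" using AB_disj by blast
    then show False using N0 f by simp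
  qed
  ultimately have "s < sum f ?C" using f(4) by blast
  also have "\<dots> \<le> sum f (A - {v}) + sum f ?N"
    using finA finB by (subst sum.union_disjoint) (use AB_disj in auto)
  also have "\<dots> \<le> s" using N0 f(1) sum_mono2[OF finA, of "A - {v}" f] by simp
  finally show False by simp
qed

end

section \<open>Connected bipartite graphs and the combinatorial value of s(G)\<close>

locale conn_bip_graph = bip_graph V A B E
  for V A B :: "'v set" and E :: "'v set set" +
  assumes card_V: "2 \<le> card V"
    and conn_V: "connected_graph V E"
begin

lemma nbr_exists:
  assumes "v \<in> V"
  shows "\<exists>u. {v, u} \<in> E"
proof -
  obtain w where w: "w \<in> V" "w \<noteq> v"
    using card_V assms by (metis One_nat_def card.empty card.insert empty_iff finite.emptyI
      insertI1 numeral_le_one_iff semiring_norm(69) subsetI subset_singletonD insert_iff)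
  then have "(v, w) \<in> {(x, y). {x, y} \<in> E}\<^sup>*" using conn_V assms unfolding connected_graph_def by blast
  then show ?thesis using w by (cases rule: converse_rtranclE) auto
qed

lemma V_Union: "V = \<Union> E"
  using nbr_exists edges AB_V by blast

lemma E_nonempty: "E \<noteq> {}"
  using V_Union card_V by auto

lemma A_nonempty: "A \<noteq> {}" and B_nonempty: "B \<noteq> {}"
  using E_nonempty edges by auto

lemma strongly_connected_E: "x \<in> V \<Longrightarrow> y \<in> V \<Longrightarrow> (x, y) \<in> (dgraph E)\<^sup>*"
proof -
  have "dgraph E = {(x, y). {x, y} \<in> E}" by (auto simp: dgraph_def)
  then show "x \<in> V \<Longrightarrow> y \<in> V \<Longrightarrow> (x, y) \<in> (dgraph E)\<^sup>*"
    using conn_V unfolding connected_graph_def by simp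
qed

text \<open>The parts in the definition are existentially quantified and must be matched with
  \<open>A\<close> and \<open>B\<close>. Two vertices from different parts \<open>A\<close> and
  \<open>B\<close> on the same side \<open>X\<close> would have a common neighbour in
  \<open>Y\<close>, and this would lie in both \<open>A\<close> and \<open>B\<close>.\<close>

lemma complete_iff: "complete_bipartite_graph V E \<longleftrightarrow> (\<forall>a \<in> A. \<forall>b \<in> B. {a, b} \<in> E)"
proof
  assume "complete_bipartite_graph V E"
  then obtain X Y where XY: "X \<noteq> {}" "Y \<noteq> {}" "X \<union> Y = V"
    and E: "E = {{a, b} |a b. a \<in> X \<and> b \<in> Y}"
    unfolding complete_bipartite_graph_def by blast
  have nXX: False if "a \<in> A" "b \<in> B" "a \<in> X" "b \<in> X" for a b
  proof -
    obtain y where "y \<in> Y" using XY by blast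
    then have "{a, y} \<in> E" "{b, y} \<in> E" using E that by blast+
    then show False using edge_AB[of a y] edge_BA[of b y] that AB_disj by blast
  qed
  have nYY: False if "a \<in> A" "b \<in> B" "a \<in> Y" "b \<in> Y" for a b
  proof -
    obtain x where "x \<in> X" using XY by blast
    then have "{x, a} \<in> E" "{x, b} \<in> E" using E that by blast+
    then have "{a, x} \<in> E" "{b, x} \<in> E" by (simp_all add: insert_commute)
    then show False using edge_AB[of a x] edge_BA[of b x] that AB_disj by blast
  qed
  have "{a, b} \<in> E" if ab: "a \<in> A" "b \<in> B" for a b
  proof -
    have "a \<in> X \<union> Y" "b \<in> X \<union> Y" using ab AB_V XY(3) by auto
    then have "a \<in> X \<and> b \<in> Y \<or> b \<in> X \<and> a \<in> Y" using nXX[OF ab] nYY[OF ab] by blast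
    then show ?thesis
    proof
      assume "b \<in> X \<and> a \<in> Y"
      then have "{b, a} \<in> E" using E by blast
      then show ?thesis by (simp add: insert_commute)
    qed (use E in blast)
  qed
  then show "\<forall>a \<in> A. \<forall>b \<in> B. {a, b} \<in> E" by blast
next
  assume "\<forall>a \<in> A. \<forall>b \<in> B. {a, b} \<in> E"
  then have "E = {{a, b} |a b. a \<in> A \<and> b \<in> B}" using edges by blast
  then show "complete_bipartite_graph V E"
    unfolding complete_bipartite_graph_def using A_nonempty B_nonempty AB_V AB_disj by blast
qed

text \<open>A cover missing a vertex of each part would miss an edge, so even the zero weight
  qualifies. This is why the complete bipartite case has the value 0.\<close>

lemma good_0_of_complete:
  assumes "complete_bipartite_graph V E"
  shows "good 0"
proof -
  have "A \<subseteq> C \<or> B \<subseteq> C" if "cover C" for C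
    using that assms unfolding complete_iff cover_def by blast
  then show ?thesis unfolding good_def by (intro exI[of _ "\<lambda>_. 0"]) auto
qed

text \<open>A single dominating vertex makes a bipartite graph a star. At least two vertices are
  required for the ear decompositions of the induced subgraph.\<close>

lemma card_dominating:
  assumes "\<not> complete_bipartite_graph V E" "U \<subseteq> V" "U \<noteq> {}" "dominating V E U"
  shows "2 \<le> card U"
proof (rule ccontr)
  assume "\<not> 2 \<le> card U"
  moreover have "card U \<noteq> 0" using finite_subset[OF assms(2) finV] assms(3) by simp
  ultimately have "card U = 1" by linarith
  then obtain u where U: "U = {u}" by (rule card_1_singletonE)
  have adj: "{u, v} \<in> E" if "v \<in> V" "v \<noteq> u" for v
    using assms(4) that U unfolding dominating_def by blast
  have "{a, b} \<in> E" if "a \<in> A" "b \<in> B" for a b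
  proof -
    have ab: "a \<in> V" "b \<in> V" "a \<noteq> b" using that AB_V AB_disj by auto
    show ?thesis
    proof (cases "a = u \<or> b = u")
      case True
      then show ?thesis using adj[of a] adj[of b] ab by (auto simp: insert_commute)
    next
      case False
      then have "{u, a} \<in> E" "{u, b} \<in> E" using adj ab by blast+
      then show ?thesis using edge_cases[of u a] edge_cases[of u b] that AB_disj by blast
    qed
  qed
  then show False using assms(1) complete_iff by blast
qed

lemma good_of_dominating:
  assumes nc: "\<not> complete_bipartite_graph V E"
    and U: "U \<subseteq> V" "connected_graph U (induced_edges E U)" "dominating V E U"
  shows "\<exists>m. good m \<and> real m \<le> ear_mu U (induced_edges E U)"
proof -
  have "U \<noteq> {}" using U(2) by (simp add: connected_graph_def)
  then have card: "2 \<le> card U" using card_dominating nc U by blast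
  interpret U: conn_bip_graph U "A \<inter> U" "B \<inter> U" "induced_edges E U"
    by (intro conn_bip_graph.intro induced_bip_graph conn_bip_graph_axioms.intro card U)
  obtain M where M: "M \<subseteq> induced_edges E U" "2 * card M + 1 \<le> ear_phi (induced_edges E U) + card U"
    "\<forall>x \<in> U. \<forall>y \<in> U. (x, y) \<in> (U.dgraph M)\<^sup>*"
    using U.matching_of_ear_phi[OF card U.V_Union
        U.ear_phi_le(1)[OF card order_refl U.strongly_connected_E]] by blast
  have "good (card M)" by (rule good_of_matching[OF U(1,3) M(1,3)])
  moreover have "real (card M) \<le> ear_mu U (induced_edges E U)"
    using M(2) unfolding ear_mu_def by simp
  ultimately show ?thesis by blast
qed

end

context conn_bip_graph
begin

text \<open>The witness is the support \<open>U\<close> of the weight. A cover of the induced graph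
  becomes a cover of the whole graph by adding vertices of weight zero, so
  \<open>koenig_matching\<close> applies on \<open>U\<close> with the value \<open>s\<close>. The
  set \<open>M\<close> it returns makes the digraph on \<open>U\<close> strongly connected.\<close>

lemma dominating_of_good:
  assumes nc: "\<not> complete_bipartite_graph V E" and "good s"
  shows "\<exists>U. U \<subseteq> V \<and> connected_graph U (induced_edges E U) \<and> dominating V E U \<and>
    ear_mu U (induced_edges E U) \<le> real s"
proof -
  obtain f where f: "sum f A = s" "sum f B = s"
    and cov: "\<And>C. cover C \<Longrightarrow> \<not> A \<subseteq> C \<Longrightarrow> \<not> B \<subseteq> C \<Longrightarrow> s < sum f C"
    using assms(2) unfolding good_def by blast
  have s: "0 < s"
  proof -
    obtain a b where ab: "a \<in> A" "b \<in> B" "{a, b} \<notin> E" using nc complete_iff by blast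
    \<comment> \<open>The complement of two non-adjacent vertices is a cover containing neither
      part. Its weight exceeds \<open>s\<close> but is at most the total weight
      \<open>s + s\<close>.\<close>
    let ?C = "V - {a, b}"
    have "cover ?C"
      unfolding cover_def
    proof (intro conjI allI impI)
      fix x y assume xy: "{x, y} \<in> E"
      have "{x, y} \<noteq> {a, b}" using xy ab by auto
      moreover have "x \<noteq> y" "x \<in> V" "y \<in> V" using xy edge_neq edge_V by blast+
      ultimately show "x \<in> ?C \<or> y \<in> ?C" by auto
    qed simp
    moreover have "\<not> A \<subseteq> ?C" "\<not> B \<subseteq> ?C" using ab by auto
    ultimately have "s < sum f ?C" using cov by blast
    also have "\<dots> \<le> sum f V" using finV by (intro sum_mono2) auto
    also have "\<dots> = s + s" using f sum_split_AB[of V f] A_sub B_sub by (simp add: Int_absorb1)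
    finally show ?thesis by simp
  qed
  define U where "U = {v \<in> V. 0 < f v}"
  have UV: "U \<subseteq> V" by (simp add: U_def)
  interpret U: bip_graph U "A \<inter> U" "B \<inter> U" "induced_edges E U" by (rule induced_bip_graph[OF UV])
  have sumU: "sum f (X \<inter> U) = sum f X" if "X \<subseteq> V" for X
    using that finite_subset[OF that finV] by (intro sum.mono_neutral_left) (auto simp: U_def)
  have fU: "sum f (A \<inter> U) = s" "sum f (B \<inter> U) = s" using f sumU A_sub B_sub by simp_all
  have sumfin: "finite X" if "X \<subseteq> V" for X using finite_subset[OF that finV] .
  have dom: "dominating V E U"
    unfolding dominating_def
  proof
    fix v assume "v \<in> V - U"
    then have v: "v \<in> V" "f v = 0" by (auto simp: U_def)
    have "\<exists>u. {u, v} \<in> E \<and> 0 < f u"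
    proof (cases "v \<in> A")
      case True
      show ?thesis by (rule nbr_of_good_weight[OF f s cov True v(2)])
    next
      case False
      interpret sw: bip_graph V B A E
      proof
        show "E \<subseteq> {{a, b} |a b. a \<in> B \<and> b \<in> A}"
        proof
          fix e assume "e \<in> E"
          then obtain a b where "e = {a, b}" "a \<in> A" "b \<in> B" by (rule edgeE)
          then have "e = {b, a} \<and> b \<in> B \<and> a \<in> A" by (simp add: insert_commute)
          then show "e \<in> {{a, b} |a b. a \<in> B \<and> b \<in> A}" by blast
        qed
      qed (use finV AB_V AB_disj in auto)
      have "v \<in> B" using False v AB_V by blast
      then show ?thesis using sw.nbr_of_good_weight[OF f(2,1) s cov _ v(2)] by blast
    qed
    then show "\<exists>u \<in> U. {u, v} \<in> E" using edge_V by (auto simp: U_def)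
  qed
  have extend: "cover (C \<union> (V - U))" if "U.cover C" for C
    unfolding cover_def
  proof (intro conjI allI impI)
    show "C \<union> (V - U) \<subseteq> V" using that UV unfolding U.cover_def by blast
    fix x y assume xy: "{x, y} \<in> E"
    show "x \<in> C \<union> (V - U) \<or> y \<in> C \<union> (V - U)"
    proof (cases "x \<in> U \<and> y \<in> U")
      case True
      then have "{x, y} \<in> induced_edges E U" using xy by (simp add: induced_edges_def)
      then show ?thesis using that unfolding U.cover_def by blast
    next
      case False
      then show ?thesis using edge_V[OF xy] by blast
    qed
  qed
  have "s \<le> sum f C" if C: "U.cover C" for C
  proof -
    let ?C = "C \<union> (V - U)"
    have CU: "C \<subseteq> U" using C unfolding U.cover_def by blast
    then have "?C \<inter> U = C" by blast
    then have eq: "sum f ?C = sum f C" using sumU[of ?C] CU UV by auto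
    have fin: "finite ?C" using CU UV by (intro sumfin) blast
    have "s \<le> sum f ?C"
    proof (cases "A \<subseteq> ?C \<or> B \<subseteq> ?C")
      case True
      then show ?thesis using f sum_mono2[OF fin, of A f] sum_mono2[OF fin, of B f] by auto
    next
      case False
      then show ?thesis using cov[OF extend[OF C]] by simp
    qed
    then show ?thesis using eq by simp
  qed
  from U.koenig_matching[OF fU this] obtain M where M: "M \<subseteq> induced_edges E U" "card M \<le> s"
    and nbrs: "\<And>Y. Y \<subseteq> B \<inter> U \<Longrightarrow> sum f Y \<le> sum f {a \<in> A \<inter> U. \<exists>b \<in> Y. {a, b} \<in> M}" by blast
  text \<open>A set closed under the arcs yields a cover of weight at most \<open>s\<close>.\<close>
  have closed_full: "S = U"
    if S: "S \<subseteq> U" "S \<noteq> {}" and closed: "\<And>x y. x \<in> S \<Longrightarrow> (x, y) \<in> U.dgraph M \<Longrightarrow> y \<in> S" for S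
  proof -
    have fin: "finite (A \<inter> S)" "finite (B \<inter> S)" using finA finB by auto
    have "{a \<in> A \<inter> U. \<exists>b \<in> B \<inter> S. {a, b} \<in> M} \<subseteq> A \<inter> S"
    proof
      fix a assume "a \<in> {a \<in> A \<inter> U. \<exists>b \<in> B \<inter> S. {a, b} \<in> M}"
      then obtain b where b: "a \<in> A" "b \<in> B" "b \<in> S" "{b, a} \<in> M" by (auto simp: insert_commute)
      then have "(b, a) \<in> U.dgraph M" using M(1) unfolding U.dgraph_def by blast
      then show "a \<in> A \<inter> S" using closed b by blast
    qed
    then have le: "sum f (B \<inter> S) \<le> sum f (A \<inter> S)"
      using nbrs[of "B \<inter> S"] S(1) sum_mono2[OF fin(1), of _ f] by (meson order_trans inf_mono order_refl zero_le)
    let ?C = "(A - S) \<union> (B \<inter> S)"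
    let ?D = "?C \<union> (V - U)"
    have "U.cover (?C \<inter> U)"
      unfolding U.cover_def
    proof (intro conjI allI impI)
      fix x y assume xy: "{x, y} \<in> induced_edges E U"
      have arc: "(x, y) \<in> U.dgraph M" if "{x, y} \<in> induced_edges E U" "x \<in> A" for x y
        using that U.edge_V[OF that(1)] unfolding U.dgraph_def by blast
      have yx: "{y, x} \<in> induced_edges E U" using xy by (simp add: insert_commute)
      have xyU: "x \<in> U" "y \<in> U" using U.edge_V[OF xy] by simp_all
      from U.edge_cases[OF xy] show "x \<in> ?C \<inter> U \<or> y \<in> ?C \<inter> U"
      proof
        assume "x \<in> A \<inter> U \<and> y \<in> B \<inter> U"
        then show ?thesis using arc[OF xy] closed[of x y] by blast
      next
        assume "x \<in> B \<inter> U \<and> y \<in> A \<inter> U"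
        then show ?thesis using arc[OF yx] closed[of y x] by blast
      qed
    qed simp
    from extend[OF this] have cD: "cover (?C \<inter> U \<union> (V - U))" .
    have eqD: "?C \<inter> U \<union> (V - U) = ?D" using AB_V by blast
    have DU: "?D \<inter> U = ?C \<inter> U" by blast
    have "?C \<subseteq> V" "?D \<subseteq> V" using A_sub B_sub by blast+
    from sumU[OF this(1)] sumU[OF this(2)] have "sum f ?D = sum f ?C" unfolding DU by simp
    also have "\<dots> = sum f (A - S) + sum f (B \<inter> S)"
      using AB_disj finA finB by (intro sum.union_disjoint) auto
    finally have wD: "sum f ?D = sum f (A - S) + sum f (B \<inter> S)" .
    have sA: "sum f (A - S) + sum f (A \<inter> S) = s"
      using f(1) sum.Int_Diff[OF finA, of f S] by simp
    then have "sum f ?D \<le> s" using wD le by linarith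
    \<comment> \<open>If this cover contains \<open>A\<close>, then \<open>S\<close> misses
      \<open>A\<close>, and by \<open>le\<close> it has no weight in \<open>B\<close> either, so it
      is empty. If it contains \<open>B\<close>, then \<open>S\<close> contains the
      \<open>B\<close>-side of \<open>U\<close>, and \<open>le\<close> leaves no weight on
      \<open>A - S\<close>.\<close>
    then have "A \<subseteq> ?D \<or> B \<subseteq> ?D" using cov[of ?D] cD eqD by fastforce
    then have "B \<inter> U \<subseteq> S"
    proof
      assume "A \<subseteq> ?D"
      then have "A \<inter> S = {}" using S(1) AB_disj by blast
      then have "sum f (B \<inter> S) = 0" using le by simp
      then have "B \<inter> S = {}" using fin S(1) by (auto simp: U_def)
      then have "S = {}" using \<open>A \<inter> S = {}\<close> S(1) UV AB_V by blast
      then show ?thesis using S(2) by simp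
    next
      assume "B \<subseteq> ?D"
      then show ?thesis using AB_disj by blast
    qed
    then have "B \<inter> S = B \<inter> U" using S(1) by blast
    then have "sum f (B \<inter> S) = s" using fU by simp
    then have "sum f (A - S) = 0" using sA le by linarith
    then have "\<forall>a \<in> A - S. f a = 0" using finA by simp
    then have "A \<inter> U \<subseteq> S" unfolding U_def by force
    then show "S = U" using \<open>B \<inter> U \<subseteq> S\<close> S(1) UV AB_V by blast
  qed
  have strong: "(x, y) \<in> (U.dgraph M)\<^sup>*" if xy: "x \<in> U" "y \<in> U" for x y
  proof -
    let ?S = "{z \<in> U. (x, z) \<in> (U.dgraph M)\<^sup>*}"
    have "?S = U"
    proof (rule closed_full)
      show "?S \<noteq> {}" using xy by blast
      fix z w assume zw: "z \<in> ?S" "(z, w) \<in> U.dgraph M"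
      then have "w \<in> U" using U.edge_V[of z w] unfolding U.dgraph_def by blast
      then show "w \<in> ?S" using zw by (auto intro: rtrancl_into_rtrancl)
    qed simp
    then show ?thesis using xy by blast
  qed
  have ne: "A \<inter> U \<noteq> {}" "B \<inter> U \<noteq> {}" using fU s by auto
  then obtain a b where ab: "a \<in> A \<inter> U" "b \<in> B \<inter> U" by blast
  have "a \<noteq> b" using ab AB_disj by blast
  then have "card {a, b} = 2" by simp
  moreover have "card {a, b} \<le> card U" using ab U.finV by (intro card_mono) auto
  ultimately have card: "2 \<le> card U" by simp
  have "U.dgraph M \<subseteq> {(x, y). {x, y} \<in> induced_edges E U}" unfolding U.dgraph_def by blast
  then have "connected_graph U (induced_edges E U)"
    unfolding connected_graph_def using ne strong rtrancl_mono by blast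
  moreover have "ear_phi (induced_edges E U) + card U \<le> 2 * s + 1"
    using U.ear_phi_le(2)[OF card M(1) strong] M(2) by linarith
  then have "ear_mu U (induced_edges E U) \<le> real s" unfolding ear_mu_def by simp
  ultimately show ?thesis using UV dom by blast
qed

lemma dominating_V: "dominating V E V"
  by (simp add: dominating_def)

lemma induced_V: "induced_edges E V = E"
  using V_Union by (auto simp: induced_edges_def)

lemma good_exists: "\<exists>s. good s"
proof (cases "complete_bipartite_graph V E")
  case True
  then show ?thesis using good_0_of_complete by blast
next
  case False
  then show ?thesis using good_of_dominating[OF False order_refl _ dominating_V] conn_V induced_V by auto
qed

lemma s_invariant_eq: "s_invariant V E = real (LEAST s. good s)"
proof (cases "complete_bipartite_graph V E")
  case True
  then have "(LEAST s. good s) = 0" using good_0_of_complete by (intro Least_eq_0)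
  then show ?thesis using True by (simp add: s_invariant_def)
next
  case False
  let ?D = "{U. U \<subseteq> V \<and> connected_graph U (induced_edges E U) \<and> dominating V E U}"
  let ?S = "{ear_mu U (induced_edges E U) |U.
    U \<subseteq> V \<and> connected_graph U (induced_edges E U) \<and> dominating V E U}"
  have img: "?S = (\<lambda>U. ear_mu U (induced_edges E U)) ` ?D" by auto
  have "finite (Pow V)" using finV by simp
  then have fin: "finite ?S" unfolding img by (intro finite_imageI) (auto elim: rev_finite_subset)
  have good: "good (LEAST s. good s)" using good_exists by (rule LeastI_ex)
  obtain U where U: "U \<in> ?D" "ear_mu U (induced_edges E U) \<le> real (LEAST s. good s)"
    using dominating_of_good[OF False good] by blast
  have le: "Min ?S \<le> real (LEAST s. good s)"
    using Min_le[OF fin, of "ear_mu U (induced_edges E U)"] U by force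
  have "?S \<noteq> {}" using U by blast
  then have "Min ?S \<in> ?S" using fin by (rule Min_in[rotated])
  then obtain W where W: "W \<in> ?D" "Min ?S = ear_mu W (induced_edges E W)" by blast
  then obtain m where m: "good m" "real m \<le> Min ?S" using good_of_dominating[OF False, of W] by auto
  have "(LEAST s. good s) \<le> m" using m(1) by (rule Least_le)
  then have "real (LEAST s. good s) \<le> Min ?S" using m(2) by linarith
  then have "Min ?S = real (LEAST s. good s)" using le by linarith
  then show ?thesis using False by (simp add: s_invariant_def)
qed

end

section \<open>Power sums\<close>

abbreviation lookup :: "('a \<Rightarrow>\<^sub>0 'b::zero) \<Rightarrow> 'a \<Rightarrow> 'b" where
  "lookup \<equiv> Poly_Mapping.lookup"

definition wt :: "'v set \<Rightarrow> ('v \<Rightarrow>\<^sub>0 nat) \<Rightarrow> nat" where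
  "wt C m = (\<Sum>i \<in> C. lookup m i)"

lemma wt_add [simp]: "wt C (m + m') = wt C m + wt C m'"
  by (simp add: wt_def lookup_add sum.distrib)

lemma wt_single: "finite C \<Longrightarrow> wt C (Poly_Mapping.single i k) = (if i \<in> C then k else 0)"
  by (simp add: wt_def lookup_single when_def sum.delta)

lemma lookup_single_times:
  fixes g :: "('v, 'k::field) mpoly"
  shows "lookup (Poly_Mapping.single a c * g) (m + a) = c * lookup g m"
proof -
  have "lookup (Poly_Mapping.single a c * g) (m + a) =
    (\<Sum>l. (c * (\<Sum>q. lookup g q when m + a = l + q)) when a = l)"
    by (simp add: lookup_mult lookup_single when_mult)
  also have "\<dots> = c * (\<Sum>q. lookup g q when m + a = a + q)" by simp
  also have "(\<lambda>q. lookup g q when m + a = a + q) = (\<lambda>q. lookup g q when m = q)"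
    by (simp add: add.commute[of m a])
  finally show ?thesis by simp
qed

lemma lookup_times_nonzero:
  fixes f g :: "('v, 'k::field) mpoly"
  assumes "lookup (f * g) x \<noteq> 0"
  obtains a b where "x = a + b" "lookup f a \<noteq> 0" "lookup g b \<noteq> 0"
proof -
  have "x \<in> Poly_Mapping.keys (f * g)" using assms by (simp add: in_keys_iff)
  then obtain a b where "x = a + b" "a \<in> Poly_Mapping.keys f" "b \<in> Poly_Mapping.keys g"
    using keys_mult[of f g] by blast
  then show thesis using that by (simp add: in_keys_iff)
qed

lemma lookup_single_times_nonzero:
  fixes g :: "('v, 'k::field) mpoly"
  assumes "lookup (Poly_Mapping.single a c * g) x \<noteq> 0"
  obtains m where "x = m + a" "lookup g m \<noteq> 0"
proof -
  obtain a' b where *: "x = a' + b" "lookup (Poly_Mapping.single a c) a' \<noteq> 0" "lookup g b \<noteq> 0"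
    using assms by (rule lookup_times_nonzero)
  then have "a' = a" by (auto simp: lookup_single when_def split: if_splits)
  then show thesis using * that[of b] by (simp add: add.commute)
qed

lemma poly_sum_monomials:
  fixes p :: "('v, 'k::field) mpoly"
  shows "p = (\<Sum>m \<in> Poly_Mapping.keys p. Poly_Mapping.single m (lookup p m))"
proof (rule poly_mapping_eqI)
  fix x
  have "lookup (\<Sum>m \<in> Poly_Mapping.keys p. Poly_Mapping.single m (lookup p m)) x =
    (\<Sum>m \<in> Poly_Mapping.keys p. if m = x then lookup p m else 0)"
    by (simp add: lookup_sum lookup_single when_def)
  also have "\<dots> = lookup p x" by (simp add: sum.delta in_keys_iff)
  finally show "lookup p x = lookup (\<Sum>m \<in> Poly_Mapping.keys p. Poly_Mapping.single m (lookup p m)) x"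
    by simp
qed

definition polys :: "'v set \<Rightarrow> ('v, 'k::field) mpoly set" where
  "polys V = {p. \<forall>m \<in> Poly_Mapping.keys p. Poly_Mapping.keys m \<subseteq> V}"

lemma polys_zero [simp]: "0 \<in> polys V" and polys_one [simp]: "1 \<in> polys V"
  by (simp_all add: polys_def)

lemma polys_add: "p \<in> polys V \<Longrightarrow> q \<in> polys V \<Longrightarrow> p + q \<in> polys V"
  using Poly_Mapping.keys_add[of p q] unfolding polys_def by blast

lemma polys_uminus: "p \<in> polys V \<Longrightarrow> - p \<in> polys V"
  by (simp add: polys_def in_keys_iff)

lemma polys_diff: "p \<in> polys V \<Longrightarrow> q \<in> polys V \<Longrightarrow> p - q \<in> polys V"
  using polys_add[of p V "- q"] polys_uminus[of q V] by simp

lemma polys_mult: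
  assumes "p \<in> polys V" "q \<in> polys V"
  shows "p * q \<in> polys V"
  unfolding polys_def
proof (intro CollectI ballI)
  fix m assume "m \<in> Poly_Mapping.keys (p * q)"
  then obtain a b where ab: "m = a + b" "a \<in> Poly_Mapping.keys p" "b \<in> Poly_Mapping.keys q"
    using keys_mult[of p q] by blast
  then show "Poly_Mapping.keys m \<subseteq> V"
    using assms Poly_Mapping.keys_add[of a b] unfolding polys_def by blast
qed

lemma polys_sum: "(\<And>i. i \<in> I \<Longrightarrow> f i \<in> polys V) \<Longrightarrow> sum f I \<in> polys V"
  by (induction I rule: infinite_finite_induct) (auto intro: polys_add)

lemma polys_single: "Poly_Mapping.keys m \<subseteq> V \<Longrightarrow> Poly_Mapping.single m c \<in> polys V"
  by (simp add: polys_def)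

lemma keys_add_single:
  fixes m :: "'v \<Rightarrow>\<^sub>0 nat"
  assumes "Poly_Mapping.keys m \<subseteq> V" "i \<in> V"
  shows "Poly_Mapping.keys (m + Poly_Mapping.single i k) \<subseteq> V"
  using assms Poly_Mapping.keys_add[of m "Poly_Mapping.single i k"] by (auto split: if_splits)

lemma keys_of_add:
  fixes m m' :: "'v \<Rightarrow>\<^sub>0 nat"
  assumes "Poly_Mapping.keys (m + m') \<subseteq> V"
  shows "Poly_Mapping.keys m \<subseteq> V"
proof
  fix i assume "i \<in> Poly_Mapping.keys m"
  then have "i \<in> Poly_Mapping.keys (m + m')" by (simp add: in_keys_iff lookup_add)
  then show "i \<in> V" using assms by blast
qed

lemma split_off_single:
  fixes m :: "'v \<Rightarrow>\<^sub>0 nat"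
  assumes "k \<le> lookup m i"
  shows "\<exists>m'. m = m' + Poly_Mapping.single i k"
proof
  show "m = (m - Poly_Mapping.single i k) + Poly_Mapping.single i k"
    using assms by (intro poly_mapping_eqI) (auto simp: lookup_add lookup_minus lookup_single when_def)
qed

text \<open>For \<open>Q m\<close> of the form \<open>wt C m < t\<close> this is membership in the
  t-th power of the prime P_C generated by the variables of \<open>C\<close>. A general predicate
  also allows the exponents that are small for two covers at once.\<close>

definition zero_on :: "(('v \<Rightarrow>\<^sub>0 nat) \<Rightarrow> bool) \<Rightarrow> ('v, 'k::field) mpoly \<Rightarrow> bool" where
  "zero_on Q p \<longleftrightarrow> (\<forall>m. Q m \<longrightarrow> lookup p m = 0)"

lemma zero_on_0 [simp]: "zero_on Q 0"
  by (simp add: zero_on_def)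

lemma zero_on_add: "zero_on Q p \<Longrightarrow> zero_on Q q \<Longrightarrow> zero_on Q (p + q)"
  by (simp add: zero_on_def lookup_add)

lemma zero_on_diff: "zero_on Q p \<Longrightarrow> zero_on Q q \<Longrightarrow> zero_on Q (p - q)"
  by (simp add: zero_on_def lookup_minus)

lemma zero_on_mult:
  assumes "zero_on Q p" "\<And>m m'. Q (m + m') \<Longrightarrow> Q m"
  shows "zero_on Q (q * p)"
  unfolding zero_on_def
proof (intro allI impI)
  fix x assume x: "Q x"
  show "lookup (q * p) x = 0"
  proof (rule ccontr)
    assume "lookup (q * p) x \<noteq> 0"
    then obtain a b where "x = a + b" "lookup p b \<noteq> 0" by (rule lookup_times_nonzero)
    then show False using assms x by (metis zero_on_def add.commute)
  qed
qed

definition psum :: "('v \<Rightarrow> nat) \<Rightarrow> 'v set \<Rightarrow> ('v, 'k::field) mpoly" where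
  "psum N V = (\<Sum>i \<in> V. Poly_Mapping.single (Poly_Mapping.single i (N i)) 1)"

lemma psum_polys: "psum N V \<in> polys V"
  unfolding psum_def by (intro polys_sum polys_single) (auto split: if_splits)

lemma psum_times: "psum N V * g = (\<Sum>i \<in> V. Poly_Mapping.single (Poly_Mapping.single i (N i)) 1 * g)"
  by (simp add: psum_def sum_distrib_right)

lemma psum_nonzero:
  fixes g :: "('v, 'k::field) mpoly"
  assumes "lookup (psum N V * g) x \<noteq> 0"
  obtains i m where "i \<in> V" "x = m + Poly_Mapping.single i (N i)" "lookup g m \<noteq> 0"
proof -
  have "(\<Sum>i \<in> V. lookup (Poly_Mapping.single (Poly_Mapping.single i (N i)) 1 * g) x) \<noteq> 0"
    using assms by (simp add: psum_times lookup_sum)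
  then obtain i where i: "i \<in> V" "lookup (Poly_Mapping.single (Poly_Mapping.single i (N i)) 1 * g) x \<noteq> 0"
    by (metis (mono_tags, lifting) sum.neutral)
  from i(2) obtain m where "x = m + Poly_Mapping.single i (N i)" "lookup g m \<noteq> 0"
    by (rule lookup_single_times_nonzero)
  then show thesis using i(1) that by blast
qed

lemma psum_unique:
  fixes g :: "('v, 'k::field) mpoly"
  assumes "finite V" "j \<in> V"
    and unique: "\<And>i m'. i \<in> V \<Longrightarrow> i \<noteq> j \<Longrightarrow> m + Poly_Mapping.single j (N j) = m' + Poly_Mapping.single i (N i) \<Longrightarrow>
      lookup g m' = 0"
  shows "lookup (psum N V * g) (m + Poly_Mapping.single j (N j)) = lookup g m"
proof -
  let ?x = "m + Poly_Mapping.single j (N j)"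
  let ?t = "\<lambda>i. lookup (Poly_Mapping.single (Poly_Mapping.single i (N i)) 1 * g) ?x"
  have "?t i = 0" if i: "i \<in> V" "i \<noteq> j" for i
  proof (rule ccontr)
    assume "?t i \<noteq> 0"
    then obtain m' where "?x = m' + Poly_Mapping.single i (N i)" "lookup g m' \<noteq> 0"
      by (rule lookup_single_times_nonzero)
    then show False using unique i by blast
  qed
  then have "(\<Sum>i \<in> V - {j}. ?t i) = 0" by (intro sum.neutral) blast
  moreover have "lookup (psum N V * g) ?x = ?t j + (\<Sum>i \<in> V - {j}. ?t i)"
    using assms(1,2) by (simp add: psum_times lookup_sum lookup_add sum.remove)
  ultimately show ?thesis using lookup_single_times[of "Poly_Mapping.single j (N j)" 1 g m] by simp
qed

text \<open>Look at a nonzero coefficient of \<open>u\<close> whose exponent at \<open>i\<close> is largest.\<close>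

lemma psum_regular:
  fixes u :: "('v, 'k::field) mpoly"
  assumes "finite V" "i \<in> V" "0 < N i"
    and down: "\<And>m m'. Q (m + m') \<Longrightarrow> Q m" and up: "\<And>m k. Q m \<Longrightarrow> Q (m + Poly_Mapping.single i k)"
    and "zero_on Q (psum N V * u)"
  shows "zero_on Q u"
proof (rule ccontr)
  assume "\<not> zero_on Q u"
  let ?S = "{m \<in> Poly_Mapping.keys u. Q m}"
  have S: "finite ?S" "?S \<noteq> {}" using \<open>\<not> zero_on Q u\<close> by (auto simp: zero_on_def in_keys_iff)
  define K where "K = Max ((\<lambda>m. lookup m i) ` ?S)"
  have "K \<in> (\<lambda>m. lookup m i) ` ?S" unfolding K_def using S by (intro Max_in) simp_all
  then obtain m where m1: "m \<in> ?S" "lookup m i = K" by blast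
  have m2: "lookup m' i \<le> K" if "m' \<in> ?S" for m'
    unfolding K_def using S(1) that by (intro Max_ge) auto
  let ?x = "m + Poly_Mapping.single i (N i)"
  have Qx: "Q ?x" using up m1(1) by simp
  have "lookup (psum N V * u) ?x = lookup u m"
  proof (rule psum_unique[OF assms(1,2)])
    fix j m' assume j: "j \<in> V" "j \<noteq> i" "?x = m' + Poly_Mapping.single j (N j)"
    have "Q m'" using Qx down unfolding j(3) by blast
    moreover have "lookup m' i = lookup m i + N i"
      using arg_cong[OF j(3), of "\<lambda>m. lookup m i"] j(2) by (simp add: lookup_add lookup_single)
    ultimately show "lookup u m' = 0" using m2[of m'] m1(2) assms(3) by (auto simp: in_keys_iff)
  qed
  then show False using assms(6) Qx m1(1) by (simp add: zero_on_def in_keys_iff)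
qed

text \<open>With respect to lowest \<open>C\<close>-degree and then highest \<open>F\<close>-degree, the leading form of the power sum is
  the pure power of the variable with the largest exponent.\<close>

lemma psum_leading:
  fixes u :: "('v, 'k::field) mpoly"
  assumes V: "finite V" "C \<inter> F = {}" "C \<union> F = V" and a: "a \<in> F"
    and top: "\<forall>j \<in> F. j \<noteq> a \<longrightarrow> N j < N a" and pos: "\<forall>j \<in> V. 0 < N j"
    and u: "lookup u m0 \<noteq> 0"
  shows "\<exists>m. lookup u m \<noteq> 0 \<and> wt C m \<le> wt C m0 \<and>
    lookup (psum N V * u) (m + Poly_Mapping.single a (N a)) \<noteq> 0 \<and>
    (\<forall>x. lookup (psum N V * u) x \<noteq> 0 \<longrightarrow> wt C m \<le> wt C x \<and>
      (wt C x = wt C m \<longrightarrow> wt F x \<le> wt F m + N a \<and>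
        (wt F x = wt F m + N a \<longrightarrow> (\<exists>m'. x = m' + Poly_Mapping.single a (N a)))))"
proof -
  have fin: "finite C" "finite F" using V by (auto intro: finite_subset)
  let ?K = "Poly_Mapping.keys u"
  define d where "d = Min (wt C ` ?K)"
  have K: "?K \<noteq> {}" "finite ?K" using u by (auto simp: in_keys_iff)
  have dle: "d \<le> wt C m" if "lookup u m \<noteq> 0" for m
    unfolding d_def using that K by (intro Min_le) (auto simp: in_keys_iff)
  have "d \<in> wt C ` ?K" unfolding d_def using K by (intro Min_in) auto
  then obtain m1 where m1: "lookup u m1 \<noteq> 0" "wt C m1 = d" by (auto simp: in_keys_iff)
  let ?T = "{m \<in> ?K. wt C m = d}"
  define D where "D = Max (wt F ` ?T)"
  have T: "?T \<noteq> {}" "finite ?T" using m1 by (auto simp: in_keys_iff)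
  have leD: "wt F m \<le> D" if "lookup u m \<noteq> 0" "wt C m = d" for m
    unfolding D_def using that T by (intro Max_ge) (auto simp: in_keys_iff)
  have "D \<in> wt F ` ?T" unfolding D_def using T by (intro Max_in) auto
  then obtain m where m: "lookup u m \<noteq> 0" "wt C m = d" "wt F m = D" by (auto simp: in_keys_iff)
  have wC: "wt C (m' + Poly_Mapping.single i (N i)) = wt C m' + (if i \<in> C then N i else 0)" for m' i
    using fin by (simp add: wt_single)
  have wF: "wt F (m' + Poly_Mapping.single i (N i)) = wt F m' + (if i \<in> F then N i else 0)" for m' i
    using fin by (simp add: wt_single)
  \<comment> \<open>A product term of lowest \<open>C\<close>-weight uses a lowest term of
    \<open>u\<close> and a variable outside \<open>C\<close>. Among these variables only that of
    \<open>a\<close> raises the \<open>F\<close>-weight by the maximal amount.\<close>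
  have key: "wt F (m' + Poly_Mapping.single i (N i)) \<le> D + N a \<and>
      (wt F (m' + Poly_Mapping.single i (N i)) = D + N a \<longrightarrow> i = a)"
    if i: "i \<in> V" "lookup u m' \<noteq> 0" "wt C (m' + Poly_Mapping.single i (N i)) = d" for i m'
  proof -
    have "i \<notin> C" "wt C m' = d" using i dle[OF i(2)] bspec[OF pos i(1)] wC[of m' i] by (auto split: if_splits)
    then have iF: "i \<in> F" and "wt F m' \<le> D" using i V leD by auto
    then show ?thesis using bspec[OF top iF] wF[of m' i] by (cases "i = a") auto
  qed
  have aC: "a \<notin> C" using a V by blast
  have "lookup (psum N V * u) (m + Poly_Mapping.single a (N a)) = lookup u m"
  proof (rule psum_unique)
    fix i m' assume i: "i \<in> V" "i \<noteq> a"
      "m + Poly_Mapping.single a (N a) = m' + Poly_Mapping.single i (N i)"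
    show "lookup u m' = 0"
    proof (rule ccontr)
      assume nz: "lookup u m' \<noteq> 0"
      have "wt C (m' + Poly_Mapping.single i (N i)) = d" "wt F (m' + Poly_Mapping.single i (N i)) = D + N a"
        unfolding i(3)[symmetric] wC wF using aC a m by simp_all
      then show False using key[OF i(1) nz] i(2) by blast
    qed
  qed (use V a in auto)
  then have "lookup (psum N V * u) (m + Poly_Mapping.single a (N a)) \<noteq> 0" using m(1) by simp
  moreover have "wt C m \<le> wt C x \<and> (wt C x = wt C m \<longrightarrow> wt F x \<le> wt F m + N a \<and>
      (wt F x = wt F m + N a \<longrightarrow> (\<exists>m'. x = m' + Poly_Mapping.single a (N a))))"
    if x: "lookup (psum N V * u) x \<noteq> 0" for x
  proof -
    obtain i m' where i: "i \<in> V" "x = m' + Poly_Mapping.single i (N i)" "lookup u m' \<noteq> 0"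
      using x by (rule psum_nonzero)
    have "wt C m \<le> wt C x" using dle[OF i(3)] m(2) unfolding i(2) wC by simp
    moreover have "wt F x \<le> D + N a \<and> (wt F x = D + N a \<longrightarrow> i = a)" if "wt C x = wt C m"
      using key[OF i(1,3)] that m(2) i(2) by simp
    ultimately show ?thesis using m(3) i(2) by blast
  qed
  ultimately show ?thesis using m(1,2) dle[OF u] by (intro exI[of _ m]) simp
qed

text \<open>Below weight \<open>t\<close> the two products agree, hence so do their leading forms.
  On one side the leading form contains a monomial of \<open>r\<close> times a power of the variable
  of \<open>b\<close>; on the other side every leading monomial is divisible by the
  \<open>N a\<close>-th power of the variable of \<open>a\<close>. That power would divide a
  monomial of \<open>r\<close>, against \<open>red\<close>.\<close>

lemma psum_coprime:
  fixes r h :: "('v, 'k::field) mpoly"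
  assumes V: "finite V" "C \<inter> F = {}" "C \<union> F = V" and ab: "a \<in> F" "b \<in> F" "a \<noteq> b"
    and topa: "\<forall>j \<in> F. j \<noteq> a \<longrightarrow> N j < N a" and posN: "\<forall>j \<in> V. 0 < N j"
    and topb: "\<forall>j \<in> F. j \<noteq> b \<longrightarrow> N' j < N' b" and posN': "\<forall>j \<in> V. 0 < N' j"
    and red: "\<And>m. lookup r m \<noteq> 0 \<Longrightarrow> lookup m a < N a"
    and zero: "zero_on (\<lambda>m. wt C m < t) (psum N' V * r - psum N V * h)"
  shows "zero_on (\<lambda>m. wt C m < t) r"
proof (rule ccontr)
  assume "\<not> ?thesis"
  then obtain m0 where m0: "wt C m0 < t" "lookup r m0 \<noteq> 0" by (auto simp: zero_on_def)
  have fin: "finite C" "finite F" using V by (auto intro: finite_subset)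
  have nC: "a \<notin> C" "b \<notin> C" using ab V by auto
  have agree: "lookup (psum N' V * r) x = lookup (psum N V * h) x" if "wt C x < t" for x
    using zero that by (simp add: zero_on_def lookup_minus)
  obtain m where m: "lookup r m \<noteq> 0" "wt C m \<le> wt C m0"
    "lookup (psum N' V * r) (m + Poly_Mapping.single b (N' b)) \<noteq> 0"
    and bd: "\<forall>x. lookup (psum N' V * r) x \<noteq> 0 \<longrightarrow> wt C m \<le> wt C x \<and>
      (wt C x = wt C m \<longrightarrow> wt F x \<le> wt F m + N' b \<and>
        (wt F x = wt F m + N' b \<longrightarrow> (\<exists>m'. x = m' + Poly_Mapping.single b (N' b))))"
    using psum_leading[OF V ab(2) topb posN' m0(2)] by (elim exE conjE)
  let ?x = "m + Poly_Mapping.single b (N' b)"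
  have Cx: "wt C ?x = wt C m" and Fx: "wt F ?x = wt F m + N' b"
    using nC ab fin by (simp_all add: wt_single)
  then have hx: "lookup (psum N V * h) ?x \<noteq> 0" using m agree[of ?x] m0(1) by simp
  then obtain i m2 where "lookup h m2 \<noteq> 0" by (rule psum_nonzero)
  obtain m' where m': "lookup (psum N V * h) (m' + Poly_Mapping.single a (N a)) \<noteq> 0"
    and bd': "\<forall>x. lookup (psum N V * h) x \<noteq> 0 \<longrightarrow> wt C m' \<le> wt C x \<and>
      (wt C x = wt C m' \<longrightarrow> wt F x \<le> wt F m' + N a \<and>
        (wt F x = wt F m' + N a \<longrightarrow> (\<exists>m''. x = m'' + Poly_Mapping.single a (N a))))"
    using psum_leading[OF V ab(1) topa posN \<open>lookup h m2 \<noteq> 0\<close>] by (elim exE conjE)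
  let ?y = "m' + Poly_Mapping.single a (N a)"
  have Cy: "wt C ?y = wt C m'" and Fy: "wt F ?y = wt F m' + N a"
    using nC ab fin by (simp_all add: wt_single)
  have le1: "wt C m' \<le> wt C m" using bd'[rule_format, OF hx] Cx by simp
  then have ry: "lookup (psum N' V * r) ?y \<noteq> 0" using m' agree[of ?y] Cy m(2) m0(1) by simp
  have eqC: "wt C m' = wt C m" using le1 bd[rule_format, OF ry] Cy by simp
  have "wt F ?x = wt F m' + N a" using bd'[rule_format, OF hx] bd[rule_format, OF ry] Cx Cy Fx Fy eqC by simp
  then obtain m3 where "?x = m3 + Poly_Mapping.single a (N a)" using bd'[rule_format, OF hx] Cx eqC by auto
  then have "lookup ?x a = lookup m3 a + N a" by (simp add: lookup_add)
  then have "N a \<le> lookup m a" using ab(3) by (simp add: lookup_add lookup_single)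
  then show False using red[OF m(1)] by simp
qed

text \<open>Division with remainder by the power sum, regarded as monic in the variable of
  \<open>a\<close>, modulo the polynomials that vanish on \<open>Q\<close>.\<close>

definition reducible_to :: "'v set \<Rightarrow> ('v \<Rightarrow> nat) \<Rightarrow> 'v \<Rightarrow> (('v \<Rightarrow>\<^sub>0 nat) \<Rightarrow> bool) \<Rightarrow> ('v, 'k::field) mpoly set" where
  "reducible_to V N a Q = {g. \<exists>w \<in> polys V. \<exists>r \<in> polys V.
    zero_on Q (g - psum N V * w - r) \<and> (\<forall>m. lookup r m \<noteq> 0 \<longrightarrow> lookup m a < N a)}"

lemma reducible_add:
  assumes "g \<in> reducible_to V N a Q" "g' \<in> reducible_to V N a Q"
  shows "g + g' \<in> reducible_to V N a Q"
proof -
  obtain w r where 1: "w \<in> polys V" "r \<in> polys V" "zero_on Q (g - psum N V * w - r)"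
    "\<And>m. lookup r m \<noteq> 0 \<Longrightarrow> lookup m a < N a" using assms(1) unfolding reducible_to_def by blast
  obtain w' r' where 2: "w' \<in> polys V" "r' \<in> polys V" "zero_on Q (g' - psum N V * w' - r')"
    "\<And>m. lookup r' m \<noteq> 0 \<Longrightarrow> lookup m a < N a" using assms(2) unfolding reducible_to_def by blast
  have "zero_on Q (g + g' - psum N V * (w + w') - (r + r'))"
    using zero_on_add[OF 1(3) 2(3)] by (simp add: algebra_simps)
  moreover have "lookup m a < N a" if "lookup (r + r') m \<noteq> 0" for m
    using that 1(4)[of m] 2(4)[of m] by (cases "lookup r m = 0") (simp_all add: lookup_add)
  ultimately show ?thesis using polys_add[OF 1(1) 2(1)] polys_add[OF 1(2) 2(2)]
    unfolding reducible_to_def by blast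
qed

lemma reducible_sum:
  "(\<And>i. i \<in> I \<Longrightarrow> f i \<in> reducible_to V N a Q) \<Longrightarrow> sum f I \<in> reducible_to V N a Q"
proof (induction I rule: infinite_finite_induct)
  case empty
  show ?case unfolding reducible_to_def by (auto intro!: bexI[of _ 0])
next
  case (infinite A)
  then show ?case unfolding reducible_to_def by (auto intro!: bexI[of _ 0])
qed (auto intro: reducible_add)

text \<open>Replace the \<open>N a\<close>-th power of the variable of \<open>a\<close> by minus the
  other summands of the power sum. A variable in \<open>C\<close> raises the
  \<open>C\<close>-weight, which is capped at \<open>t\<close>; a variable in \<open>F\<close> keeps
  it and lowers the \<open>F\<close>-weight because \<open>N a\<close> is largest. So the rewriting
  terminates.\<close>

lemma reducible_monomial:
  assumes V: "finite V" "C \<inter> F = {}" "C \<union> F = V" and a: "a \<in> F"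
    and top: "\<forall>j \<in> F. j \<noteq> a \<longrightarrow> N j < N a" and pos: "\<forall>j \<in> V. 0 < N j"
  shows "Poly_Mapping.keys m \<subseteq> V \<Longrightarrow>
    (Poly_Mapping.single m c :: ('v, 'k::field) mpoly) \<in> reducible_to V N a (\<lambda>m. wt C m < t)"
proof (induction "(t - wt C m, wt F m)" arbitrary: m c rule: wf_induct_rule[OF wf_lex_prod[OF wf_less_than wf_less_than]])
  case (1 m)
  have fin: "finite C" "finite F" using V by (auto intro: finite_subset)
  consider "t \<le> wt C m" | "lookup m a < N a" | "wt C m < t" "N a \<le> lookup m a" by linarith
  then show ?case
  proof cases
    case 1
    then have "zero_on (\<lambda>m. wt C m < t) (Poly_Mapping.single m c :: ('v, 'k) mpoly)"
      by (auto simp: zero_on_def lookup_single when_def)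
    then show ?thesis unfolding reducible_to_def by (auto intro!: bexI[of _ 0])
  next
    case 2
    then have "lookup m' a < N a" if "lookup (Poly_Mapping.single m c :: ('v, 'k) mpoly) m' \<noteq> 0" for m'
      using that by (auto simp: lookup_single when_def split: if_splits)
    then show ?thesis using polys_single[OF 1(2)] unfolding reducible_to_def
      by (intro CollectI bexI[of _ 0] bexI[of _ "Poly_Mapping.single m c"]) auto
  next
    case 3
    obtain m' where m': "m = m' + Poly_Mapping.single a (N a)" using split_off_single[OF 3(2)] by blast
    have keys': "Poly_Mapping.keys m' \<subseteq> V" using 1(2) keys_of_add unfolding m' by blast
    let ?e = "\<lambda>i. m' + Poly_Mapping.single i (N i)"
    let ?w = "Poly_Mapping.single m' c :: ('v, 'k) mpoly"
    have aV: "a \<in> V" "a \<notin> C" using a V by auto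
    have "psum N V * ?w = (\<Sum>i \<in> V. Poly_Mapping.single (?e i) c)"
      by (simp add: psum_times mult_single add.commute)
    also have "\<dots> = Poly_Mapping.single m c + (\<Sum>i \<in> V - {a}. Poly_Mapping.single (?e i) c)"
      using V(1) aV m' by (simp add: sum.remove)
    finally have eq: "Poly_Mapping.single m c = psum N V * ?w + (\<Sum>i \<in> V - {a}. Poly_Mapping.single (?e i) (- c))"
      by (simp add: single_uminus sum_negf)
    have "psum N V * ?w \<in> reducible_to V N a (\<lambda>m. wt C m < t)"
      using polys_single[OF keys', of c] unfolding reducible_to_def
      by (intro CollectI bexI[of _ ?w] bexI[of _ 0]) auto
    moreover have "(Poly_Mapping.single (?e i) (- c) :: ('v, 'k) mpoly) \<in> reducible_to V N a (\<lambda>m. wt C m < t)"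
      if i: "i \<in> V - {a}" for i
    proof (rule 1(1))
      show "Poly_Mapping.keys (?e i) \<subseteq> V" using keys_add_single[OF keys'] i by blast
      have wm: "wt C m = wt C m'" "wt F m = wt F m' + N a" using aV a fin by (simp_all add: m' wt_single)
      have "t - wt C (?e i) < t - wt C m \<or> t - wt C (?e i) = t - wt C m \<and> wt F (?e i) < wt F m"
      proof (cases "i \<in> C")
        case True
        then have "wt C (?e i) = wt C m + N i" using fin wm by (simp add: wt_single)
        moreover have "0 < N i" using pos i by simp
        ultimately have "t - wt C (?e i) < t - wt C m" using 3(1) by linarith
        then show ?thesis by simp
      next
        case False
        then have "i \<in> F" using i V by blast
        then have "wt C (?e i) = wt C m" "wt F (?e i) < wt F m"
          using fin wm False bspec[OF top, of i] i by (simp_all add: wt_single)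
        then show ?thesis by simp
      qed
      then show "((t - wt C (?e i), wt F (?e i)), (t - wt C m, wt F m)) \<in> less_than <*lex*> less_than"
        by auto
    qed
    ultimately show ?thesis unfolding eq by (intro reducible_add reducible_sum) auto
  qed
qed

text \<open>Divide \<open>g\<close> by the first power sum. The second power sum times the remainder
  is again a multiple of the first one, so the remainder vanishes by
  \<open>psum_coprime\<close>.\<close>

lemma psum_regular_pair:
  fixes g h :: "('v, 'k::field) mpoly"
  assumes V: "finite V" "C \<inter> F = {}" "C \<union> F = V" and ab: "a \<in> F" "b \<in> F" "a \<noteq> b"
    and topa: "\<forall>j \<in> F. j \<noteq> a \<longrightarrow> N j < N a" and posN: "\<forall>j \<in> V. 0 < N j"
    and topb: "\<forall>j \<in> F. j \<noteq> b \<longrightarrow> N' j < N' b" and posN': "\<forall>j \<in> V. 0 < N' j"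
    and g: "g \<in> polys V"
    and zero: "zero_on (\<lambda>m. wt C m < t) (psum N' V * g - psum N V * h)"
  shows "\<exists>w \<in> polys V. zero_on (\<lambda>m. wt C m < t) (g - psum N V * w)"
proof -
  let ?Q = "\<lambda>m. wt C m < t"
  have "g \<in> reducible_to V N a ?Q"
    by (subst poly_sum_monomials[of g], intro reducible_sum reducible_monomial[OF V ab(1) topa posN]) (use g in \<open>auto simp: polys_def\<close>)
  then obtain w r where w: "w \<in> polys V" "zero_on ?Q (g - psum N V * w - r)"
    and red: "\<And>m. lookup r m \<noteq> 0 \<Longrightarrow> lookup m a < N a" unfolding reducible_to_def by blast
  have "zero_on ?Q (psum N' V * (g - psum N V * w - r))"
    by (rule zero_on_mult[OF w(2)]) simp
  then have "zero_on ?Q ((psum N' V * g - psum N V * h) - psum N' V * (g - psum N V * w - r))"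
    by (rule zero_on_diff[OF zero])
  then have "zero_on ?Q (psum N' V * r - psum N V * (h - psum N' V * w))"
    by (simp add: algebra_simps)
  then have "zero_on ?Q r"
    using psum_coprime[OF V ab topa posN topb posN' red] by blast
  from zero_on_add[OF w(2) this] have "zero_on ?Q (g - psum N V * w)" by simp
  then show ?thesis using w(1) by blast
qed

section \<open>Depth of quotients of polynomial rings\<close>

lemma mpoly_ring_simps [simp]:
  "carrier (mpoly_ring V) = polys V"
  "p \<otimes>\<^bsub>mpoly_ring V\<^esub> q = p * q"
  "p \<oplus>\<^bsub>mpoly_ring V\<^esub> q = p + q"
  "\<zero>\<^bsub>mpoly_ring V\<^esub> = 0"
  "\<one>\<^bsub>mpoly_ring V\<^esub> = 1"
  by (simp_all add: mpoly_ring_def polys_def)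

lemma ideal_mpolyI:
  fixes J :: "('v, 'k::field) mpoly set"
  assumes "J \<subseteq> polys V" "0 \<in> J" "\<And>p q. p \<in> J \<Longrightarrow> q \<in> J \<Longrightarrow> p + q \<in> J"
    and mult: "\<And>p q. p \<in> polys V \<Longrightarrow> q \<in> J \<Longrightarrow> p * q \<in> J"
  shows "ideal J (mpoly_ring V)"
proof -
  interpret R: cring "mpoly_ring V :: ('v, 'k) mpoly ring" by (rule cring_mpoly_ring)
  show ?thesis
  proof (rule idealI)
    show "ring (mpoly_ring V :: ('v, 'k) mpoly ring)" by (rule R.ring_axioms)
    show "subgroup J (add_monoid (mpoly_ring V))"
    proof (rule subgroup.intro)
      fix x assume x: "x \<in> J"
      then have xc: "x \<in> polys V" using assms(1) by blast
      have "\<ominus>\<^bsub>mpoly_ring V\<^esub> x = - x"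
        using R.minus_equality[of "- x" x] xc polys_uminus[OF xc] by simp
      moreover have "- 1 * x \<in> J" using x by (intro mult polys_uminus) simp_all
      ultimately show "inv\<^bsub>add_monoid (mpoly_ring V)\<^esub> x \<in> J" by (simp add: a_inv_def)
    qed (use assms in auto)
    show "x \<otimes>\<^bsub>mpoly_ring V\<^esub> a \<in> J" "a \<otimes>\<^bsub>mpoly_ring V\<^esub> x \<in> J"
      if "a \<in> J" "x \<in> carrier (mpoly_ring V)" for a x
      using mult[of x a] that by (simp_all add: mult.commute)
  qed
qed

lemma ideal_mpolyD:
  fixes J :: "('v, 'k::field) mpoly set"
  assumes "ideal J (mpoly_ring V)"
  shows ideal_sub: "J \<subseteq> polys V" and ideal_zero: "0 \<in> J"
    and ideal_add: "\<And>p q. p \<in> J \<Longrightarrow> q \<in> J \<Longrightarrow> p + q \<in> J"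
    and ideal_mult: "\<And>p q. p \<in> polys V \<Longrightarrow> q \<in> J \<Longrightarrow> p * q \<in> J"
    and ideal_diff: "\<And>p q. p \<in> J \<Longrightarrow> q \<in> J \<Longrightarrow> p - q \<in> J"
proof -
  interpret ideal J "mpoly_ring V" by fact
  show "J \<subseteq> polys V" using a_subset by simp
  show "0 \<in> J" using additive_subgroup.zero_closed[OF is_additive_subgroup] by simp
  show add: "p + q \<in> J" if "p \<in> J" "q \<in> J" for p q using additive_subgroup.a_closed[OF is_additive_subgroup that] by simp
  show mult: "p * q \<in> J" if "p \<in> polys V" "q \<in> J" for p q using I_l_closed[of q p] that by simp
  have "- 1 * q \<in> J" if "q \<in> J" for q using that by (intro mult polys_uminus) simp_all
  then show "p - q \<in> J" if "p \<in> J" "q \<in> J" for p q using add[of p "- q"] that by force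
qed

lemma genideal_mpoly:
  fixes S :: "('v, 'k::field) mpoly set"
  assumes "S \<subseteq> polys V"
  shows genideal_mpoly_ideal: "ideal (Idl\<^bsub>mpoly_ring V\<^esub> S) (mpoly_ring V)"
    and genideal_mpoly_self: "S \<subseteq> Idl\<^bsub>mpoly_ring V\<^esub> S"
    and genideal_mpoly_least: "\<And>J. ideal J (mpoly_ring V) \<Longrightarrow> S \<subseteq> J \<Longrightarrow> Idl\<^bsub>mpoly_ring V\<^esub> S \<subseteq> J"
proof -
  interpret R: cring "mpoly_ring V :: ('v, 'k) mpoly ring" by (rule cring_mpoly_ring)
  show "ideal (Idl\<^bsub>mpoly_ring V\<^esub> S) (mpoly_ring V)" "S \<subseteq> Idl\<^bsub>mpoly_ring V\<^esub> S"
    using R.genideal_ideal[of S] R.genideal_self[of S] assms by simp_all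
  show "\<And>J. ideal J (mpoly_ring V) \<Longrightarrow> S \<subseteq> J \<Longrightarrow> Idl\<^bsub>mpoly_ring V\<^esub> S \<subseteq> J"
    by (rule R.genideal_minimal)
qed

lemma genideal_of_ideal:
  fixes J :: "('v, 'k::field) mpoly set"
  assumes "ideal J (mpoly_ring V)"
  shows "Idl\<^bsub>mpoly_ring V\<^esub> J = J"
  using genideal_mpoly_self[OF ideal_sub[OF assms]]
    genideal_mpoly_least[OF ideal_sub[OF assms] assms order_refl] by (rule subset_antisym[rotated])

lemma genideal_insert:
  fixes J :: "('v, 'k::field) mpoly set"
  assumes J: "ideal J (mpoly_ring V)" and f: "f \<in> polys V"
  shows "Idl\<^bsub>mpoly_ring V\<^esub> (J \<union> {f}) = {j + r * f |j r. j \<in> J \<and> r \<in> polys V}" (is "?I = ?K")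
proof (rule subset_antisym)
  note J' = ideal_mpolyD[OF J]
  have sub: "J \<union> {f} \<subseteq> polys V" using J'(1) f by simp
  have "ideal ?K (mpoly_ring V)"
  proof (rule ideal_mpolyI)
    show "?K \<subseteq> polys V" using J'(1) f by (auto intro!: polys_add polys_mult)
    show "0 \<in> ?K" using J'(2) by (intro CollectI exI[of _ 0]) simp
    fix p q assume q: "q \<in> ?K"
    then obtain j r where jr: "q = j + r * f" "j \<in> J" "r \<in> polys V" by blast
    show "p * q \<in> ?K" if "p \<in> polys V"
      using jr J'(4)[OF that jr(2)] polys_mult[OF that jr(3)]
      by (intro CollectI exI[of _ "p * j"] exI[of _ "p * r"]) (simp add: algebra_simps)
    assume "p \<in> ?K"
    then obtain j' r' where jr': "p = j' + r' * f" "j' \<in> J" "r' \<in> polys V" by blast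
    show "p + q \<in> ?K"
      using jr jr' J'(3)[OF jr'(2) jr(2)] polys_add[OF jr'(3) jr(3)]
      by (intro CollectI exI[of _ "j' + j"] exI[of _ "r' + r"]) (simp add: algebra_simps)
  qed
  moreover have "J \<union> {f} \<subseteq> ?K"
  proof
    fix x assume "x \<in> J \<union> {f}"
    then consider "x \<in> J" | "x = f" by blast
    then show "x \<in> ?K"
    proof cases
      case 1
      then show ?thesis by (intro CollectI exI[of _ x] exI[of _ 0]) simp
    next
      case 2
      then show ?thesis using J'(2) by (intro CollectI exI[of _ 0] exI[of _ 1]) simp
    qed
  qed
  ultimately show "?I \<subseteq> ?K" by (rule genideal_mpoly_least[OF sub])
  note I' = ideal_mpolyD[OF genideal_mpoly_ideal[OF sub]]
  show "?K \<subseteq> ?I"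
  proof
    fix x assume "x \<in> ?K"
    then obtain j r where jr: "x = j + r * f" "j \<in> J" "r \<in> polys V" by blast
    have "j \<in> ?I" "f \<in> ?I" using genideal_mpoly_self[OF sub] jr by auto
    then show "x \<in> ?I" unfolding jr(1) using jr(3) by (intro I'(3) I'(4))
  qed
qed

lemma nonzerodivisor_quot_iff:
  assumes "cring A" "ideal K A" "f \<in> carrier A"
  shows "nonzerodivisor (A Quot K) (K +>\<^bsub>A\<^esub> f) \<longleftrightarrow> (\<forall>b \<in> carrier A. f \<otimes>\<^bsub>A\<^esub> b \<in> K \<longrightarrow> b \<in> K)"
proof -
  interpret ideal K A by fact
  have zero_iff: "K +>\<^bsub>A\<^esub> x = K \<longleftrightarrow> x \<in> K" if "x \<in> carrier A" for x
    using a_rcos_self[OF that] a_rcos_const by metis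
  have "carrier (A Quot K) = (\<lambda>b. K +>\<^bsub>A\<^esub> b) ` carrier A"
    by (auto simp: FactRing_def A_RCOSETS_def')
  moreover have "(K +>\<^bsub>A\<^esub> f) \<otimes>\<^bsub>A Quot K\<^esub> (K +>\<^bsub>A\<^esub> b) = K +>\<^bsub>A\<^esub> (f \<otimes>\<^bsub>A\<^esub> b)" if "b \<in> carrier A" for b
    using rcoset_mult_add[OF assms(3) that] by (simp add: FactRing_def)
  moreover have "\<zero>\<^bsub>A Quot K\<^esub> = K" by (simp add: FactRing_def)
  ultimately show ?thesis
    using assms(3) zero_iff m_closed unfolding nonzerodivisor_def by auto
qed

lemma max_hom_ideal:
  shows "ideal (max_hom_ideal V :: ('v, 'k::field) mpoly set) (mpoly_ring V)"
    and mvar_in_max: "i \<in> V \<Longrightarrow> (mvar i :: ('v, 'k) mpoly) \<in> max_hom_ideal V"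
    and max_hom_ideal_least: "ideal J (mpoly_ring V) \<Longrightarrow> (mvar ` V :: ('v, 'k) mpoly set) \<subseteq> J \<Longrightarrow> max_hom_ideal V \<subseteq> J"
proof -
  have sub: "(mvar ` V :: ('v, 'k) mpoly set) \<subseteq> polys V"
    unfolding mvar_def by (auto intro!: polys_single split: if_splits)
  show "ideal (max_hom_ideal V :: ('v, 'k) mpoly set) (mpoly_ring V)"
    unfolding max_hom_ideal_def by (rule genideal_mpoly_ideal[OF sub])
  show "i \<in> V \<Longrightarrow> (mvar i :: ('v, 'k) mpoly) \<in> max_hom_ideal V"
    unfolding max_hom_ideal_def using genideal_mpoly_self[OF sub] by blast
  show "ideal J (mpoly_ring V) \<Longrightarrow> (mvar ` V :: ('v, 'k) mpoly set) \<subseteq> J \<Longrightarrow> max_hom_ideal V \<subseteq> J"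
    unfolding max_hom_ideal_def by (rule genideal_mpoly_least[OF sub])
qed

lemma max_hom_ideal_const:
  fixes p :: "('v, 'k::field) mpoly"
  assumes "p \<in> max_hom_ideal V"
  shows "lookup p 0 = 0"
proof -
  let ?J = "{p :: ('v, 'k) mpoly. p \<in> polys V \<and> zero_on (\<lambda>m. m = 0) p}"
  have down: "m = 0" if "m + m' = 0" for m m' :: "'v \<Rightarrow>\<^sub>0 nat"
  proof (rule poly_mapping_eqI)
    fix i
    show "lookup m i = lookup 0 i"
      using arg_cong[OF that, of "\<lambda>m. lookup m i"] by (simp add: lookup_add)
  qed
  have "ideal ?J (mpoly_ring V)"
    by (rule ideal_mpolyI) (auto intro: polys_add polys_mult zero_on_add zero_on_mult down)
  moreover have "(mvar ` V :: ('v, 'k) mpoly set) \<subseteq> ?J"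
  proof (rule image_subsetI)
    fix i assume "i \<in> V"
    have "Poly_Mapping.single i (1 :: nat) \<noteq> 0"
      by (metis lookup_single_eq lookup_zero zero_neq_one)
    then show "(mvar i :: ('v, 'k) mpoly) \<in> ?J" using \<open>i \<in> V\<close>
      by (auto simp: mvar_def zero_on_def lookup_single when_def intro!: polys_single split: if_splits)
  qed
  ultimately have "max_hom_ideal V \<subseteq> ?J" by (rule max_hom_ideal_least)
  then show ?thesis using assms by (auto simp: zero_on_def)
qed

definition regular_mod :: "'v set \<Rightarrow> ('v, 'k::field) mpoly set \<Rightarrow> ('v, 'k) mpoly \<Rightarrow> bool" where
  "regular_mod V J f \<longleftrightarrow> f \<in> polys V \<and> (\<forall>b \<in> polys V. f * b \<in> J \<longrightarrow> b \<in> J)"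

lemma regular_seq_mpoly:
  fixes J :: "('v, 'k::field) mpoly set"
  assumes J: "ideal J (mpoly_ring V)"
  shows "regular_seq_on_quot (mpoly_ring V) J fs \<longleftrightarrow> set fs \<subseteq> polys V \<and>
    (\<forall>i < length fs. regular_mod V (Idl\<^bsub>mpoly_ring V\<^esub> (J \<union> set (take i fs))) (fs ! i)) \<and>
    Idl\<^bsub>mpoly_ring V\<^esub> (J \<union> set fs) \<noteq> polys V"
proof -
  have "nonzerodivisor (mpoly_ring V Quot Idl\<^bsub>mpoly_ring V\<^esub> (J \<union> set (take i fs)))
      (Idl\<^bsub>mpoly_ring V\<^esub> (J \<union> set (take i fs)) +>\<^bsub>mpoly_ring V\<^esub> (fs ! i)) \<longleftrightarrow>
      regular_mod V (Idl\<^bsub>mpoly_ring V\<^esub> (J \<union> set (take i fs))) (fs ! i)"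
    if fs: "set fs \<subseteq> polys V" and i: "i < length fs" for i
  proof -
    have sub: "J \<union> set (take i fs) \<subseteq> polys V"
      using ideal_sub[OF J] fs set_take_subset[of i fs] by blast
    have "fs ! i \<in> polys V" using fs i nth_mem by blast
    then show ?thesis
      using nonzerodivisor_quot_iff[OF cring_mpoly_ring genideal_mpoly_ideal[OF sub], of "fs ! i"]
      by (simp add: regular_mod_def)
  qed
  then show ?thesis unfolding regular_seq_on_quot_def by (auto simp: Let_def)
qed

text \<open>Rees' exchange argument: if \<open>p\<close> is regular and \<open>p g = f h\<close> modulo \<open>J\<close>, then \<open>h\<close> is a socle element
  modulo \<open>J + (p)\<close>, so no regular sequence starting with \<open>p\<close> can be continued.\<close>

lemma depth_one:
  fixes J :: "('v, 'k::field) mpoly set"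
  assumes J: "ideal J (mpoly_ring V)" and f: "f \<in> max_hom_ideal V" "regular_mod V J f"
    and g: "g \<in> polys V" "g \<notin> Idl\<^bsub>mpoly_ring V\<^esub> (J \<union> {f})"
    and socle: "\<And>i. i \<in> V \<Longrightarrow> mvar i * g \<in> Idl\<^bsub>mpoly_ring V\<^esub> (J \<union> {f})"
  shows "depth_quot V J = 1"
proof -
  note J' = ideal_mpolyD[OF J]
  let ?K = "\<lambda>f. Idl\<^bsub>mpoly_ring V\<^esub> (J \<union> {f})"
  have fp: "f \<in> polys V" using f(2) by (simp add: regular_mod_def)
  have K: "?K f = {j + r * f |j r. j \<in> J \<and> r \<in> polys V}" by (rule genideal_insert[OF J fp])
  have sub: "J \<union> {f} \<subseteq> polys V" using J'(1) fp by simp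
  note K' = ideal_mpolyD[OF genideal_mpoly_ideal[OF sub]]
  \<comment> \<open>A competing regular sequence may consist of any elements of the maximal ideal,
    so the socle property is extended from the variables to all of them.\<close>
  have maxg: "p * g \<in> ?K f" if "p \<in> max_hom_ideal V" for p
  proof -
    let ?A = "{p \<in> polys V. p * g \<in> ?K f}"
    have "ideal ?A (mpoly_ring V)"
    proof (rule ideal_mpolyI)
      show "0 \<in> ?A" using K'(2) by simp
      show "p + q \<in> ?A" if "p \<in> ?A" "q \<in> ?A" for p q
        using that K'(3)[of "p * g" "q * g"] by (simp add: polys_add distrib_right)
      show "p * q \<in> ?A" if "p \<in> polys V" "q \<in> ?A" for p q
        using that K'(4)[of p "q * g"] by (simp add: polys_mult mult.assoc)
    qed simp
    moreover have "mvar ` V \<subseteq> ?A"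
      using socle ideal_sub[OF max_hom_ideal(1)] mvar_in_max by (auto intro!: subsetD[OF ideal_sub[OF max_hom_ideal(1)]])
    ultimately have "max_hom_ideal V \<subseteq> ?A" by (rule max_hom_ideal_least)
    then show ?thesis using that by blast
  qed
  let ?S = "{enat (length fs) |fs. regular_seq_on_quot (mpoly_ring V) J fs \<and> set fs \<subseteq> max_hom_ideal V}"
  have "regular_seq_on_quot (mpoly_ring V) J [f]"
    unfolding regular_seq_mpoly[OF J] using fp f(2) genideal_of_ideal[OF J] g by auto
  then have "enat (length [f]) \<in> ?S" using f(1) by force
  then have one: "1 \<in> ?S" by (simp add: one_enat_def)
  have "n \<le> 1" if n: "n \<in> ?S" for n
  proof (rule ccontr)
    assume "\<not> n \<le> 1"
    then obtain fs where fs: "regular_seq_on_quot (mpoly_ring V) J fs" "set fs \<subseteq> max_hom_ideal V"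
      "1 < length fs" using n by (auto simp: one_enat_def)
    define p where "p = fs ! 0"
    define q where "q = fs ! 1"
    note r = fs(1)[unfolded regular_seq_mpoly[OF J]]
    have "regular_mod V (Idl\<^bsub>mpoly_ring V\<^esub> (J \<union> set (take 0 fs))) p"
      using r fs(3) unfolding p_def by (metis less_trans zero_less_one)
    then have p: "regular_mod V J p" using genideal_of_ideal[OF J] by simp
    have "take 1 fs = [p]" using fs(3) by (cases fs) (simp_all add: p_def)
    then have q: "regular_mod V (?K p) q" using r fs(3) unfolding q_def by fastforce
    have pm: "p \<in> max_hom_ideal V" "q \<in> max_hom_ideal V" 
      unfolding p_def q_def using fs(3) by (auto intro!: subsetD[OF fs(2)] nth_mem)
    have pp: "p \<in> polys V" "q \<in> polys V" using p q by (simp_all add: regular_mod_def)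
    have Kp: "?K p = {j + r * p |j r. j \<in> J \<and> r \<in> polys V}" by (rule genideal_insert[OF J pp(1)])
    obtain j h where h: "p * g = j + h * f" "j \<in> J" "h \<in> polys V" using maxg[OF pm(1)] K by blast
    obtain j2 r2 where r2: "q * g = j2 + r2 * f" "j2 \<in> J" "r2 \<in> polys V" using maxg[OF pm(2)] K by blast
    \<comment> \<open>Two expressions for \<open>p * q * g\<close> modulo \<open>J\<close> are
      compared. Cancelling the regular element \<open>f\<close> puts \<open>q * h\<close> into the
      ideal generated by \<open>J\<close> and \<open>p\<close>.\<close>
    have "f * (q * h - r2 * p) = p * j2 - q * j"
    proof -
      have "f * (q * h - r2 * p) = q * (p * g - j) - p * (q * g - j2)"
        unfolding h(1) r2(1) by (simp add: algebra_simps)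
      then show ?thesis by (simp add: algebra_simps)
    qed
    moreover have "p * j2 - q * j \<in> J" using pp h r2 by (intro J'(5) J'(4))
    moreover have "q * h - r2 * p \<in> polys V" using pp h r2 by (intro polys_diff polys_mult)
    ultimately have "q * h - r2 * p \<in> J" using f(2) unfolding regular_mod_def by metis
    then have "q * h \<in> ?K p" unfolding Kp using r2(3)
      by (intro CollectI exI[of _ "q * h - r2 * p"] exI[of _ r2]) simp
    then have "h \<in> ?K p" using q h(3) unfolding regular_mod_def by blast
    \<comment> \<open>With \<open>h\<close> a multiple of \<open>p\<close> modulo \<open>J\<close>,
      cancelling \<open>p\<close> makes \<open>g\<close> a multiple of \<open>f\<close> modulo
      \<open>J\<close>, contrary to its choice.\<close>
    then obtain j3 r3 where r3: "h = j3 + r3 * p" "j3 \<in> J" "r3 \<in> polys V" unfolding Kp by blast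
    have "p * (g - r3 * f) = j + f * j3" using h(1) unfolding r3(1) by (simp add: algebra_simps)
    moreover have "j + f * j3 \<in> J" using h r3 fp by (intro J'(3) J'(4))
    moreover have "g - r3 * f \<in> polys V" using g r3 fp by (intro polys_diff polys_mult)
    ultimately have "g - r3 * f \<in> J" using p unfolding regular_mod_def by metis
    then have "g \<in> ?K f" unfolding K using r3(3)
      by (intro CollectI exI[of _ "g - r3 * f"] exI[of _ r3]) simp
    then show False using g(2) by simp
  qed
  then have "Sup ?S = 1" using one by (intro Sup_eqI) auto
  then show ?thesis by (simp add: depth_quot_def)
qed

lemma depth_ge_two:
  fixes J :: "('v, 'k::field) mpoly set"
  assumes J: "ideal J (mpoly_ring V)" "J \<subseteq> max_hom_ideal V"
    and f: "f1 \<in> max_hom_ideal V" "f2 \<in> max_hom_ideal V"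
    and reg: "regular_mod V J f1" "regular_mod V (Idl\<^bsub>mpoly_ring V\<^esub> (J \<union> {f1})) f2"
  shows "2 \<le> depth_quot V J"
proof -
  let ?M = "max_hom_ideal V :: ('v, 'k) mpoly set"
  have fp: "f1 \<in> polys V" "f2 \<in> polys V" using reg by (simp_all add: regular_mod_def)
  have sub: "J \<union> {f1, f2} \<subseteq> polys V" using ideal_sub[OF J(1)] fp by simp
  have "Idl\<^bsub>mpoly_ring V\<^esub> (J \<union> {f1, f2}) \<subseteq> ?M"
    using J(2) f by (intro genideal_mpoly_least[OF sub max_hom_ideal(1)]) simp
  moreover have "1 \<notin> ?M" using max_hom_ideal_const[of 1 V] by force
  ultimately have "Idl\<^bsub>mpoly_ring V\<^esub> (J \<union> {f1, f2}) \<noteq> polys V" using polys_one by blast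
  then have "regular_seq_on_quot (mpoly_ring V) J [f1, f2]"
    unfolding regular_seq_mpoly[OF J(1)]
    using fp reg genideal_of_ideal[OF J(1)] by (auto simp: less_Suc_eq)
  then have "enat (length [f1, f2]) \<le> depth_quot V J"
    unfolding depth_quot_def using f by (intro Sup_upper) force
  then show ?thesis by (simp add: numeral_eq_enat eval_nat_numeral)
qed

section \<open>Powers of edge ideals\<close>

lemma ideal_sum:
  fixes J :: "('v, 'k::field) mpoly set"
  assumes "ideal J (mpoly_ring V)" "\<And>i. i \<in> I \<Longrightarrow> f i \<in> J"
  shows "sum f I \<in> J"
  using assms(2)
  by (induction I rule: infinite_finite_induct) (auto intro: ideal_zero[OF assms(1)] ideal_add[OF assms(1)])

lemma mvar_polys: "i \<in> V \<Longrightarrow> mvar i \<in> polys V"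
  unfolding mvar_def by (intro polys_single) simp

lemma single_in_max:
  assumes "Poly_Mapping.keys m \<subseteq> V" "m \<noteq> 0"
  shows "(Poly_Mapping.single m c :: ('v, 'k::field) mpoly) \<in> max_hom_ideal V"
proof -
  obtain i where i: "i \<in> Poly_Mapping.keys m" using assms(2) by (metis keys_eq_empty all_not_in_conv)
  then have "1 \<le> lookup m i" by (simp add: in_keys_iff)
  from split_off_single[OF this] obtain m' where m': "m = m' + Poly_Mapping.single i 1" ..
  have "(Poly_Mapping.single m c :: ('v, 'k) mpoly) = Poly_Mapping.single m' c * mvar i"
    by (simp add: mvar_def mult_single m')
  moreover have "Poly_Mapping.keys m' \<subseteq> V" using assms(1) keys_of_add unfolding m' by blast
  ultimately show ?thesis
    using i assms(1) by (auto intro!: ideal_mult[OF max_hom_ideal(1)] polys_single mvar_in_max)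
qed

lemma psum_in_max:
  assumes "\<forall>i \<in> V. 0 < N i"
  shows "(psum N V :: ('v, 'k::field) mpoly) \<in> max_hom_ideal V"
  unfolding psum_def
proof (rule ideal_sum[OF max_hom_ideal(1)], rule single_in_max)
  fix i assume i: "i \<in> V"
  then show "Poly_Mapping.keys (Poly_Mapping.single i (N i)) \<subseteq> V" by simp
  have "lookup (Poly_Mapping.single i (N i)) i \<noteq> lookup 0 i" using assms i by simp
  then show "Poly_Mapping.single i (N i) \<noteq> 0" by metis
qed

context bip_graph
begin

text \<open>The t-th symbolic power of the edge ideal, read off from monomials. Its conditions come
  from the minimal covers, since a larger cover only has larger weights.\<close>

definition cov_pow :: "nat \<Rightarrow> ('v, 'k::field) mpoly set" where
  "cov_pow t = {p \<in> polys V. \<forall>C. cover C \<longrightarrow> zero_on (\<lambda>m. wt C m < t) p}"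

lemma cov_pow_ideal: "ideal (cov_pow t :: ('v, 'k::field) mpoly set) (mpoly_ring V)"
  by (rule ideal_mpolyI) (auto simp: cov_pow_def intro: polys_add polys_mult zero_on_add zero_on_mult)

lemma cov_pow_single:
  assumes "Poly_Mapping.keys m \<subseteq> V" "\<And>C. cover C \<Longrightarrow> t \<le> wt C m"
  shows "(Poly_Mapping.single m c :: ('v, 'k::field) mpoly) \<in> cov_pow t"
proof -
  have "zero_on (\<lambda>m. wt C m < t) (Poly_Mapping.single m c :: ('v, 'k) mpoly)" if "cover C" for C
    using assms(2)[OF that] by (auto simp: zero_on_def lookup_single when_def)
  then show ?thesis using polys_single[OF assms(1)] by (simp add: cov_pow_def)
qed

lemma cov_pow_mult:
  fixes p q :: "('v, 'k::field) mpoly"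
  assumes p: "p \<in> cov_pow s" and q: "q \<in> cov_pow t"
  shows "p * q \<in> cov_pow (s + t)"
proof -
  have "zero_on (\<lambda>m. wt C m < s + t) (p * q)" if C: "cover C" for C
    unfolding zero_on_def
  proof (intro allI impI)
    fix x assume x: "wt C x < s + t"
    show "lookup (p * q) x = 0"
    proof (rule ccontr)
      assume "lookup (p * q) x \<noteq> 0"
      then obtain a b where ab: "x = a + b" "lookup p a \<noteq> 0" "lookup q b \<noteq> 0"
        by (rule lookup_times_nonzero)
      have "\<not> wt C a < s" "\<not> wt C b < t" using p q C ab unfolding cov_pow_def zero_on_def by blast+
      then show False using x ab(1) by simp
    qed
  qed
  then show ?thesis using p q by (auto simp: cov_pow_def intro: polys_mult)
qed

lemma edge_generators: "({mvar i * mvar j |i j. {i, j} \<in> E} :: ('v, 'k::field) mpoly set) \<subseteq> cov_pow 1"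
proof
  fix p :: "('v, 'k) mpoly" assume "p \<in> {mvar i * mvar j |i j. {i, j} \<in> E}"
  then obtain i j where ij: "p = mvar i * mvar j" "{i, j} \<in> E" by blast
  let ?m = "Poly_Mapping.single i 1 + Poly_Mapping.single j (1 :: nat)"
  have p: "p = Poly_Mapping.single ?m 1" by (simp add: ij(1) mvar_def mult_single)
  show "p \<in> cov_pow 1"
    unfolding p
  proof (rule cov_pow_single)
    show "Poly_Mapping.keys ?m \<subseteq> V" using edge_V[OF ij(2)] by (intro keys_add_single) simp_all
    fix C assume C: "cover C"
    then have "i \<in> C \<or> j \<in> C" using ij(2) by (simp add: cover_def)
    then show "1 \<le> wt C ?m" using cover_fin[OF C] by (auto simp: wt_single)
  qed
qed

lemma edge_ideal_gens_sub: "({mvar i * mvar j |i j. {i, j} \<in> E} :: ('v, 'k::field) mpoly set) \<subseteq> polys V"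
  using edge_generators unfolding cov_pow_def by blast

lemma koenig_monomial:
  assumes "Poly_Mapping.keys m \<subseteq> V" "\<And>C. cover C \<Longrightarrow> Suc t \<le> wt C m"
  shows "\<exists>u v m'. {u, v} \<in> E \<and> m = m' + (Poly_Mapping.single u 1 + Poly_Mapping.single v 1) \<and>
    Poly_Mapping.keys m' \<subseteq> V \<and> (\<forall>C. cover C \<longrightarrow> t \<le> wt C m')"
proof -
  let ?f = "lookup m"
  obtain u v where uv: "{u, v} \<in> E" "0 < ?f u" "0 < ?f v"
    and cov: "\<forall>C. cover C \<longrightarrow> t \<le> sum (?f(u := ?f u - 1, v := ?f v - 1)) C"
    using koenig_step[of t ?f] assms(2) unfolding wt_def by blast
  have neq: "u \<noteq> v" using edge_neq uv(1) by blast
  define m' where "m' = m - (Poly_Mapping.single u 1 + Poly_Mapping.single v 1)"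
  have m': "lookup m' = ?f(u := ?f u - 1, v := ?f v - 1)"
    using neq by (auto simp: m'_def fun_eq_iff lookup_minus lookup_add lookup_single when_def)
  have m: "m = m' + (Poly_Mapping.single u 1 + Poly_Mapping.single v 1)"
    using neq uv by (intro poly_mapping_eqI) (auto simp: m' lookup_add lookup_single when_def)
  then have "Poly_Mapping.keys m' \<subseteq> V" using assms(1) keys_of_add by metis
  moreover have "\<forall>C. cover C \<longrightarrow> t \<le> wt C m'" using cov unfolding wt_def m' .
  ultimately show ?thesis using uv(1) m by blast
qed

text \<open>For bipartite graphs the powers of the edge ideal coincide with the symbolic powers.\<close>

lemma ideal_pow_edge_ideal:
  "ideal_pow V (edge_ideal V E :: ('v, 'k::field) mpoly set) t = cov_pow t"
proof (induction t)
  case 0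
  have "(cov_pow 0 :: ('v, 'k) mpoly set) = polys V" by (auto simp: cov_pow_def zero_on_def)
  then show ?case by (simp add: ideal_pow_def nat_pow_def ideals_set_def)
next
  case (Suc t)
  let ?R = "mpoly_ring V :: ('v, 'k) mpoly ring"
  let ?I = "edge_ideal V E :: ('v, 'k) mpoly set"
  have I: "ideal ?I ?R"
    unfolding edge_ideal_def by (rule genideal_mpoly_ideal[OF edge_ideal_gens_sub])
  have gens: "{mvar i * mvar j |i j. {i, j} \<in> E} \<subseteq> ?I"
    unfolding edge_ideal_def by (rule genideal_mpoly_self[OF edge_ideal_gens_sub])
  have Isub: "?I \<subseteq> cov_pow 1"
    unfolding edge_ideal_def
    by (rule genideal_mpoly_least[OF edge_ideal_gens_sub cov_pow_ideal edge_generators])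
  have pow: "ideal_pow V ?I (Suc t) = ideal_prod ?R (cov_pow t) ?I"
    using Suc.IH by (simp add: ideal_pow_def nat_pow_def ideals_set_def)
  have prod: "ideal (ideal_prod ?R (cov_pow t) ?I) ?R"
    using ring.ideal_prod_is_ideal[OF cring.axioms(1)[OF cring_mpoly_ring] cov_pow_ideal I] .
  have "ideal_prod ?R (cov_pow t) ?I = cov_pow (Suc t)"
  proof (rule subset_antisym)
    show "ideal_prod ?R (cov_pow t) ?I \<subseteq> cov_pow (Suc t)"
    proof
      fix x assume "x \<in> ideal_prod ?R (cov_pow t) ?I"
      then show "x \<in> cov_pow (Suc t)"
      proof (induction rule: ideal_prod.induct)
        case (prod i j)
        then have "i * j \<in> cov_pow (t + 1)" using Isub by (intro cov_pow_mult) auto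
        then show ?case by simp
      next
        case (sum p q)
        then show ?case using ideal_add[OF cov_pow_ideal] by simp
      qed
    qed
    show "cov_pow (Suc t) \<subseteq> ideal_prod ?R (cov_pow t) ?I"
    proof
      fix p :: "('v, 'k) mpoly" assume p: "p \<in> cov_pow (Suc t)"
      have "Poly_Mapping.single m (lookup p m) \<in> ideal_prod ?R (cov_pow t) ?I"
        if m: "m \<in> Poly_Mapping.keys p" for m
      proof -
        have mV: "Poly_Mapping.keys m \<subseteq> V" using p m by (auto simp: cov_pow_def polys_def)
        have "Suc t \<le> wt C m" if "cover C" for C
          using p m that unfolding cov_pow_def zero_on_def by (force simp: in_keys_iff)
        from koenig_monomial[OF mV this] obtain u v m' where uv: "{u, v} \<in> E"
          "m = m' + (Poly_Mapping.single u 1 + Poly_Mapping.single v 1)"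
          and m': "Poly_Mapping.keys m' \<subseteq> V" "\<forall>C. cover C \<longrightarrow> t \<le> wt C m'" by blast
        let ?q = "Poly_Mapping.single m' (lookup p m) :: ('v, 'k) mpoly"
        have "?q \<in> cov_pow t" using m' by (intro cov_pow_single) auto
        moreover have "mvar u * mvar v \<in> ?I" using gens uv(1) by blast
        ultimately have "?q \<otimes>\<^bsub>?R\<^esub> (mvar u * mvar v) \<in> ideal_prod ?R (cov_pow t) ?I"
          by (rule ideal_prod.prod)
        moreover have "?q \<otimes>\<^bsub>?R\<^esub> (mvar u * mvar v) = Poly_Mapping.single m (lookup p m)"
          unfolding uv(2) by (simp add: mvar_def mult_single)
        ultimately show ?thesis by simp
      qed
      then show "p \<in> ideal_prod ?R (cov_pow t) ?I"
        by (subst poly_sum_monomials[of p], intro ideal_sum[OF prod])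
    qed
  qed
  then show ?case using pow by simp
qed

section \<open>Reduction to minimal covers\<close>

definition min_cover :: "'v set \<Rightarrow> bool" where
  "min_cover C \<longleftrightarrow> cover C \<and> (\<forall>D. D \<subset> C \<longrightarrow> \<not> cover D)"

lemma min_cover_exists: "cover C \<Longrightarrow> \<exists>D \<subseteq> C. min_cover D"
proof (induction "card C" arbitrary: C rule: less_induct)
  case less
  show ?case
  proof (cases "min_cover C")
    case False
    then obtain D where D: "D \<subset> C" "cover D" using less.prems by (auto simp: min_cover_def)
    then have "card D < card C" using cover_fin[OF less.prems] by (intro psubset_card_mono)
    from less.hyps[OF this D(2)] obtain F where "F \<subseteq> D" "min_cover F" by blast
    then show ?thesis using D(1) by (intro exI[of _ F]) simp
  qed blast
qed

lemma cov_pow_min_cover: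
  fixes p :: "('v, 'k::field) mpoly"
  assumes "p \<in> polys V" "\<And>C. min_cover C \<Longrightarrow> zero_on (\<lambda>m. wt C m < t) p"
  shows "p \<in> cov_pow t"
proof -
  have "zero_on (\<lambda>m. wt C m < t) p" if C: "cover C" for C
    unfolding zero_on_def
  proof (intro allI impI)
    fix m assume m: "wt C m < t"
    obtain D where D: "D \<subseteq> C" "min_cover D" using min_cover_exists[OF C] by blast
    have "wt D m \<le> wt C m" unfolding wt_def using cover_fin[OF C] D(1) by (intro sum_mono2) auto
    then show "lookup p m = 0" using assms(2)[OF D(2)] m by (simp add: zero_on_def)
  qed
  then show ?thesis using assms(1) by (simp add: cov_pow_def)
qed

lemma cov_pow_zero_on: "p \<in> cov_pow t \<Longrightarrow> min_cover C \<Longrightarrow> zero_on (\<lambda>m. wt C m < t) p"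
  by (simp add: cov_pow_def min_cover_def)

lemma min_cover_proper:
  assumes "min_cover C" "V \<noteq> {}"
  shows "\<exists>v. v \<in> V - C"
proof (rule ccontr)
  assume "\<not> ?thesis"
  then have C: "C = V" using assms(1) by (auto simp: min_cover_def cover_def)
  obtain v where v: "v \<in> V" using assms(2) by blast
  have "cover (V - {v})"
    unfolding cover_def
  proof (intro conjI allI impI)
    fix x y assume xy: "{x, y} \<in> E"
    show "x \<in> V - {v} \<or> y \<in> V - {v}" using edge_neq[OF xy] edge_V[OF xy] by blast
  qed blast
  moreover have "V - {v} \<subset> V" using v by blast
  ultimately show False using assms(1) C by (simp add: min_cover_def)
qed

text \<open>A minimal cover leaves some vertex uncovered, and multiplying by its variable does not
  change the weight on the cover. So \<open>psum_regular\<close> applies to each P_C^t in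
  turn.\<close>

lemma psum_regular_cov_pow:
  assumes "V \<noteq> {}" "\<forall>i \<in> V. 0 < N i"
  shows "regular_mod V (cov_pow t :: ('v, 'k::field) mpoly set) (psum N V)"
  unfolding regular_mod_def
proof (intro conjI ballI impI)
  show "psum N V \<in> polys V" by (rule psum_polys)
  fix b :: "('v, 'k) mpoly" assume b: "b \<in> polys V" "psum N V * b \<in> cov_pow t"
  show "b \<in> cov_pow t"
  proof (rule cov_pow_min_cover[OF b(1)])
    fix C assume C: "min_cover C"
    obtain i where i: "i \<in> V" "i \<notin> C" using min_cover_proper[OF C assms(1)] by blast
    have fin: "finite C" using C cover_fin by (simp add: min_cover_def)
    show "zero_on (\<lambda>m. wt C m < t) b"
    proof (rule psum_regular[OF finV i(1)])
      show "zero_on (\<lambda>m. wt C m < t) (psum N V * b)" by (rule cov_pow_zero_on[OF b(2) C])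
    qed (use assms(2) i fin in \<open>simp_all add: wt_single\<close>)
  qed
qed

end

section \<open>Depth of powers of edge ideals\<close>

lemma genideal_insert_multiple:
  fixes J :: "('v, 'k::field) mpoly set"
  assumes "ideal J (mpoly_ring V)" "f \<in> polys V" "r \<in> polys V" "p - f * r \<in> J"
  shows "p \<in> Idl\<^bsub>mpoly_ring V\<^esub> (J \<union> {f})"
  unfolding genideal_insert[OF assms(1,2)] using assms(3,4)
  by (intro CollectI exI[of _ "p - f * r"] exI[of _ r]) (simp add: mult.commute)

context conn_bip_graph
begin

lemma V_nonempty: "V \<noteq> {}"
  using card_V by auto

text \<open>The socle element is \<open>x\<^sup>\<beta> \<Sum>\<^sub>i\<^sub>\<in>\<^sub>A x\<^sub>i\<close>, the connecting image of the class that is \<open>1\<close> on the component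
  \<open>A\<close> and \<open>0\<close> on the component \<open>B\<close> of the degree complex.\<close>

lemma depth_of_good:
  assumes "good s"
  shows "depth_quot V (cov_pow (Suc s) :: ('v, 'k::field) mpoly set) = 1"
proof -
  obtain h where h: "sum h A = s" "sum h B = s"
    and cov: "\<And>C. cover C \<Longrightarrow> \<not> A \<subseteq> C \<Longrightarrow> \<not> B \<subseteq> C \<Longrightarrow> s < sum h C"
    using assms unfolding good_def by blast
  define b where "b = (\<Sum>v \<in> V. Poly_Mapping.single v (h v))"
  have lb: "lookup b v = (if v \<in> V then h v else 0)" for v
    using finV by (simp add: b_def lookup_sum lookup_single when_def sum.delta)
  have bV: "Poly_Mapping.keys b \<subseteq> V" by (auto simp: in_keys_iff lb split: if_splits)
  have wb: "wt C b = sum h C" if "C \<subseteq> V" for C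
    unfolding wt_def using that by (intro sum.cong) (auto simp: lb)
  let ?J = "cov_pow (Suc s) :: ('v, 'k) mpoly set"
  let ?e = "\<lambda>i. Poly_Mapping.single i (1 :: nat)"
  let ?x = "\<lambda>m. Poly_Mapping.single m (1 :: 'k)"
  let ?f = "psum (\<lambda>_. 1) V :: ('v, 'k) mpoly"
  define g where "g = (\<Sum>i \<in> A. ?x (b + ?e i))"
  note J = cov_pow_ideal[where ?'k = 'k, of "Suc s"]
  note J' = ideal_mpolyD[OF J]
  have fp: "?f \<in> polys V" by (rule psum_polys)
  have reg: "regular_mod V ?J ?f" by (rule psum_regular_cov_pow[OF V_nonempty]) simp
  have fm: "?f \<in> max_hom_ideal V" by (rule psum_in_max) simp
  have gp: "g \<in> polys V"
    unfolding g_def using A_sub by (intro polys_sum polys_single keys_add_single bV) auto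
  \<comment> \<open>A cover containing \<open>A\<close> or \<open>B\<close> weighs at least
    \<open>s\<close> and gains one from \<open>i\<close> or \<open>j\<close>; any other cover weighs
    more than \<open>s\<close> already.\<close>
  have AB: "?x (b + ?e i + ?e j) \<in> ?J" if ij: "i \<in> A" "j \<in> B" for i j
  proof (rule cov_pow_single)
    show "Poly_Mapping.keys (b + ?e i + ?e j) \<subseteq> V"
      using ij A_sub B_sub by (intro keys_add_single bV) auto
    fix C assume C: "cover C"
    have w: "wt C (b + ?e i + ?e j) = sum h C + of_bool (i \<in> C) + of_bool (j \<in> C)"
      using wb cover_fin[OF C] C by (simp add: wt_single cover_def)
    consider "A \<subseteq> C" | "B \<subseteq> C" | "\<not> A \<subseteq> C" "\<not> B \<subseteq> C" by blast
    then show "Suc s \<le> wt C (b + ?e i + ?e j)"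
    proof cases
      case 1
      then have "s \<le> sum h C" using h(1) cover_fin[OF C] by (metis sum_mono2 zero_le)
      then show ?thesis using w 1 ij by auto
    next
      case 2
      then have "s \<le> sum h C" using h(2) cover_fin[OF C] by (metis sum_mono2 zero_le)
      then show ?thesis using w 2 ij by auto
    next
      case 3
      then show ?thesis using cov[OF C] w by simp
    qed
  qed
  have gmul: "mvar i * g = (\<Sum>j \<in> A. ?x (b + ?e j + ?e i))" for i
    by (simp add: g_def mvar_def sum_distrib_left mult_single ac_simps)
  have gB: "mvar i * g \<in> ?J" if "i \<in> B" for i
    unfolding gmul using AB that by (intro ideal_sum[OF J]) auto
  \<comment> \<open>For \<open>i\<close> in \<open>A\<close> the product with \<open>g\<close> is
    the part over \<open>A\<close> of a multiple of the sum of all variables; the part over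
    \<open>B\<close> lies in the ideal by \<open>AB\<close>.\<close>
  have gA: "mvar i * g - ?f * ?x (b + ?e i) \<in> ?J" if i: "i \<in> A" for i
  proof -
    have "?f * ?x (b + ?e i) = (\<Sum>j \<in> V. ?x (b + ?e j + ?e i))"
      by (simp add: psum_times mult_single ac_simps)
    also have "\<dots> = (\<Sum>j \<in> A. ?x (b + ?e j + ?e i)) + (\<Sum>j \<in> B. ?x (b + ?e j + ?e i))"
      unfolding AB_V[symmetric] by (rule sum.union_disjoint[OF finA finB AB_disj])
    finally have eq: "mvar i * g - ?f * ?x (b + ?e i) = 0 - (\<Sum>j \<in> B. ?x (b + ?e i + ?e j))"
      unfolding gmul by (simp add: ac_simps)
    have "(\<Sum>j \<in> B. ?x (b + ?e i + ?e j)) \<in> ?J" using AB i by (intro ideal_sum[OF J]) auto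
    then show ?thesis unfolding eq by (intro J'(5) J'(2))
  qed
  have xp: "?x (b + ?e i) \<in> polys V" if "i \<in> V" for i
    using that by (intro polys_single keys_add_single bV)
  show ?thesis
  proof (rule depth_one[OF J fm reg gp])
    show "mvar i * g \<in> Idl\<^bsub>mpoly_ring V\<^esub> (?J \<union> {?f})" if "i \<in> V" for i
    proof (cases "i \<in> A")
      case True
      then show ?thesis using gA that by (intro genideal_insert_multiple[OF J fp xp]) auto
    next
      case False
      then have "i \<in> B" using that AB_V by blast
      then show ?thesis using gB by (intro genideal_insert_multiple[OF J fp polys_zero]) simp
    qed
    show "g \<notin> Idl\<^bsub>mpoly_ring V\<^esub> (?J \<union> {?f})"
    proof
      assume "g \<in> Idl\<^bsub>mpoly_ring V\<^esub> (?J \<union> {?f})"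
      then obtain j r where r: "g = j + r * ?f" "j \<in> ?J" "r \<in> polys V"
        unfolding genideal_insert[OF J fp] by blast
      \<comment> \<open>If \<open>g\<close> were \<open>r\<close> times the sum of all variables
        modulo the ideal, cancellation would determine the coefficient of \<open>r\<close> at
        \<open>b\<close>: a variable from \<open>A\<close>, tested on the cover \<open>B\<close>,
        gives 1, and a variable from \<open>B\<close>, tested on the cover \<open>A\<close>, gives
        0.\<close>
      have coeff: "lookup (mvar i * r) (b + ?e i) = lookup r b" for i
        using lookup_single_times[of "?e i" 1 r b] by (simp add: mvar_def)
      obtain u v where uv: "u \<in> A" "v \<in> B" using A_nonempty B_nonempty by blast
      have uvV: "u \<in> V" "v \<in> V" using uv AB_V by auto
      have nuv: "u \<notin> B" "v \<notin> A" using uv AB_disj by auto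
      have "?f * (mvar u * r - ?x (b + ?e u)) = (mvar u * g - ?f * ?x (b + ?e u)) - mvar u * j"
        unfolding r(1) by (simp add: algebra_simps)
      also have "\<dots> \<in> ?J" using gA[OF uv(1)] J'(4)[OF mvar_polys[OF uvV(1)] r(2)] by (rule J'(5))
      finally have "mvar u * r - ?x (b + ?e u) \<in> ?J"
        using reg r(3) uvV xp unfolding regular_mod_def by (meson mvar_polys polys_diff polys_mult)
      then have "lookup (mvar u * r - ?x (b + ?e u)) (b + ?e u) = 0"
        using cover_B wb[OF B_sub] h(2) finB nuv unfolding cov_pow_def zero_on_def by (simp add: wt_single)
      then have "lookup r b = 1" using coeff[of u] by (simp add: lookup_minus)
      moreover have "?f * (mvar v * r) = mvar v * g - mvar v * j"
        unfolding r(1) by (simp add: algebra_simps)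
      then have "?f * (mvar v * r) \<in> ?J"
        using J'(5)[OF gB[OF uv(2)] J'(4)[OF mvar_polys[OF uvV(2)] r(2)]] by simp
      then have "mvar v * r \<in> ?J"
        using reg r(3) uvV unfolding regular_mod_def by (meson mvar_polys polys_mult)
      then have "lookup (mvar v * r) (b + ?e v) = 0"
        using cover_A wb[OF A_sub] h(1) finA nuv unfolding cov_pow_def zero_on_def by (simp add: wt_single)
      then have "lookup r b = 0" using coeff[of v] by simp
      ultimately show False by simp
    qed
  qed
qed

lemma good_of_complete: "complete_bipartite_graph V E \<Longrightarrow> good s"
  using good_0_of_complete good_Suc[OF E_nonempty] by (induction s) auto

text \<open>If \<open>v\<close> were the only uncovered vertex, minimality would make every other
  vertex adjacent to \<open>v\<close>. The graph would be a star, for which every \<open>s\<close>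
  is good. Two uncovered vertices are what lets the two power sums have different leading
  variables.\<close>

lemma min_cover_two_uncovered:
  assumes "\<not> good s" "min_cover C"
  shows "\<exists>a b. a \<in> V - C \<and> b \<in> V - C \<and> a \<noteq> b"
proof (rule ccontr)
  assume neg: "\<not> ?thesis"
  obtain v where v: "v \<in> V - C" using min_cover_proper[OF assms(2) V_nonempty] by blast
  have C: "cover C" using assms(2) by (simp add: min_cover_def)
  have inC: "x \<in> C" if "x \<in> V" "x \<noteq> v" for x using neg v that by blast
  have adj: "{x, v} \<in> E" if x: "x \<in> V" "x \<noteq> v" for x
  proof -
    have "\<not> cover (C - {x})" using assms(2) inC[OF x] unfolding min_cover_def by blast
    then obtain y z where yz: "{y, z} \<in> E" "y \<notin> C - {x}" "z \<notin> C - {x}"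
      using C unfolding cover_def by blast
    have "y = x \<or> y = v" "z = x \<or> z = v" using yz inC edge_V[OF yz(1)] by blast+
    then have "{y, z} = {x, v}" using edge_neq[OF yz(1)] by auto
    then show ?thesis using yz(1) by simp
  qed
  have "{a, b} \<in> E" if ab: "a \<in> A" "b \<in> B" for a b
  proof -
    have V: "a \<in> V" "b \<in> V" "a \<noteq> b" using ab AB_V AB_disj by auto
    consider "a = v" | "b = v" | "a \<noteq> v" "b \<noteq> v" by blast
    then show ?thesis
    proof cases
      case 1
      then show ?thesis using adj[of b] V by (simp add: insert_commute)
    next
      case 2
      then show ?thesis using adj[of a] V by simp
    next
      case 3
      then have "{a, v} \<in> E" "{b, v} \<in> E" using adj V by simp_all
      then have "v \<in> B" "v \<in> A" using edge_AB edge_BA ab by blast+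
      then show ?thesis using AB_disj by blast
    qed
  qed
  then have "complete_bipartite_graph V E" using complete_iff by blast
  then show False using good_of_complete assms(1) by blast
qed

lemma min_cover_A: "min_cover A" and min_cover_B: "min_cover B"
proof -
  have "\<not> cover D" if D: "D \<subset> X" and X: "X = A \<and> Y = B \<or> X = B \<and> Y = A" for D X Y
  proof
    assume c: "cover D"
    obtain v where v: "v \<in> X" "v \<notin> D" using D by blast
    have "v \<in> V" using v X AB_V by blast
    then obtain u where u: "{v, u} \<in> E" using nbr_exists by blast
    then have "u \<in> Y" using v X edge_AB edge_BA by blast
    then have "u \<notin> D" using D X AB_disj by blast
    then show False using c u v unfolding cover_def by blast
  qed
  then show "min_cover A" "min_cover B" using cover_A cover_B unfolding min_cover_def by blast+
qed

text \<open>If a function on the facets of the degree complex that agrees on intersecting facets is not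
  constant, then \<open>A\<close> and \<open>B\<close> are the only facets.\<close>

lemma good_of_disconnected:
  assumes C: "min_cover C" "wt C b \<le> s" and D: "min_cover D" "wt D b \<le> s"
    and agree: "\<And>C D. min_cover C \<Longrightarrow> min_cover D \<Longrightarrow> wt C b \<le> s \<Longrightarrow> wt D b \<le> s \<Longrightarrow> C \<union> D \<noteq> V \<Longrightarrow>
      val C = val D"
    and neq: "val C \<noteq> val D"
  shows "good s"
proof -
  have sub: "C \<subseteq> V" "D \<subseteq> V" "cover C" "cover D" using C D by (auto simp: min_cover_def cover_def)
  have "C \<union> D = V" using agree[OF C(1) D(1) C(2) D(2)] neq by blast
  have min: "X = Y" if "min_cover X" "min_cover Y" "Y \<subseteq> X" for X Y
    using that unfolding min_cover_def by blast
  have both: "wt A b \<le> s \<and> wt B b \<le> s \<and> val A \<noteq> val B"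
  proof -
    \<comment> \<open>Two facets with disjoint complements bound the total weight by
      \<open>s + s\<close>, so \<open>A\<close> or \<open>B\<close> is itself among the covers of
      weight at most \<open>s\<close>. A cover with a value different from that part must contain
      the opposite part, hence equals it by minimality.\<close>
    have "wt V b \<le> wt C b + wt D b"
      unfolding wt_def \<open>C \<union> D = V\<close>[symmetric] using sub cover_fin by (simp add: sum_Un_nat)
    moreover have "wt V b = wt A b + wt B b"
      unfolding wt_def using sum_split_AB[of V "lookup b"] A_sub B_sub by (simp add: Int_absorb1)
    ultimately have "wt A b \<le> s \<or> wt B b \<le> s" using C(2) D(2) by linarith
    then show ?thesis
    proof
      assume wA: "wt A b \<le> s"
      obtain X where X: "min_cover X" "wt X b \<le> s" "val X \<noteq> val A"
        using C D neq by metis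
      then have "X \<union> A = V" using agree[OF X(1) min_cover_A X(2) wA] by blast
      then have "B \<subseteq> X" using AB_V AB_disj by blast
      then have "X = B" using min X(1) min_cover_B by blast
      then show ?thesis using X wA by simp
    next
      assume wB: "wt B b \<le> s"
      obtain X where X: "min_cover X" "wt X b \<le> s" "val X \<noteq> val B"
        using C D neq by metis
      then have "X \<union> B = V" using agree[OF X(1) min_cover_B X(2) wB] by blast
      then have "A \<subseteq> X" using AB_V AB_disj by blast
      then have "X = A" using min X(1) min_cover_A by blast
      then show ?thesis using X wB by simp
    qed
  qed
  have other: "s < wt X b" if X: "cover X" "\<not> A \<subseteq> X" "\<not> B \<subseteq> X" for X
  proof (rule ccontr)
    assume "\<not> s < wt X b"
    obtain Y where Y: "Y \<subseteq> X" "min_cover Y" using min_cover_exists[OF X(1)] by blast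
    have "wt Y b \<le> wt X b" unfolding wt_def using cover_fin[OF X(1)] Y(1) by (intro sum_mono2) auto
    then have wY: "wt Y b \<le> s" using \<open>\<not> s < wt X b\<close> by simp
    have nYA: "\<not> A \<subseteq> Y" and nYB: "\<not> B \<subseteq> Y" using X Y by auto
    have "Y \<union> A \<noteq> V" using nYB AB_V AB_disj by blast
    moreover have "Y \<union> B \<noteq> V" using nYA AB_V AB_disj by blast
    ultimately have "val Y = val A" "val Y = val B"
      using agree[OF Y(2) min_cover_A wY] agree[OF Y(2) min_cover_B wY] both by blast+
    then show False using both by simp
  qed
  obtain u v where uv: "u \<in> A" "v \<in> B" using A_nonempty B_nonempty by blast
  then have nuv: "u \<notin> B" "v \<notin> A" "u \<noteq> v" using AB_disj by auto
  \<comment> \<open>Padding one vertex on each side brings both parts to weight exactly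
    \<open>s\<close>, while the weights of the other covers can only grow.\<close>
  define c where "c = b + Poly_Mapping.single u (s - wt A b) + Poly_Mapping.single v (s - wt B b)"
  have "wt A c = s" "wt B c = s" using both uv nuv finA finB by (simp_all add: c_def wt_single)
  moreover have "s < wt X c" if "cover X" "\<not> A \<subseteq> X" "\<not> B \<subseteq> X" for X
    using other[OF that] by (simp add: c_def)
  ultimately show ?thesis unfolding good_def wt_def by (intro exI[of _ "lookup c"]) simp
qed

text \<open>Modulo each \<open>P\<^sub>C\<^sup>s\<^sup>+\<^sup>1\<close> the quotient of \<open>g\<close> by the first power sum exists. The coefficients of
  these quotients at an exponent vector agree on intersecting facets of its degree complex, so they
  glue.\<close>

lemma psum_pair_cov_pow:
  fixes g h :: "('v, 'k::field) mpoly"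
  assumes ng: "\<not> good s" and inj: "inj_on N V" and pos: "\<forall>i \<in> V. 0 < N i" and K: "\<forall>i \<in> V. N i < K"
    and g: "g \<in> polys V" and zero: "psum (\<lambda>i. K - N i) V * g - psum N V * h \<in> cov_pow (Suc s)"
  shows "\<exists>r \<in> polys V. g - psum N V * r \<in> cov_pow (Suc s)"
proof -
  let ?Q = "\<lambda>C m. wt C m < Suc s"
  have "\<exists>w \<in> polys V. zero_on (?Q C) (g - psum N V * w)" if C: "min_cover C" for C
  proof -
    let ?F = "V - C"
    have F: "finite ?F" using finV by simp
    have CV: "C \<subseteq> V" using C by (simp add: min_cover_def cover_def)
    obtain x y where xy: "x \<in> ?F" "y \<in> ?F" "x \<noteq> y" using min_cover_two_uncovered[OF ng C] by blast
    \<comment> \<open>The uncovered vertices of largest and smallest exponent lead the two power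
      sums; passing to \<open>K - N\<close> exchanges their roles.\<close>
    have "Max (N ` ?F) \<in> N ` ?F" "Min (N ` ?F) \<in> N ` ?F" using F xy by (auto intro!: Max_in Min_in)
    then obtain a b where a: "a \<in> ?F" "N a = Max (N ` ?F)" and b: "b \<in> ?F" "N b = Min (N ` ?F)" by auto
    have ge: "N j \<le> N a" "N b \<le> N j" if "j \<in> ?F" for j using F that unfolding a(2) b(2) by auto
    have neqN: "N i \<noteq> N j" if "i \<in> ?F" "j \<in> ?F" "i \<noteq> j" for i j
      using inj that by (auto simp: inj_on_def)
    have topa: "\<forall>j \<in> ?F. j \<noteq> a \<longrightarrow> N j < N a" using ge(1) neqN a(1) by (auto simp: order_less_le)
    have topb: "\<forall>j \<in> ?F. j \<noteq> b \<longrightarrow> K - N j < K - N b"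
    proof (intro ballI impI)
      fix j assume j: "j \<in> ?F" "j \<noteq> b"
      then have "N b < N j" using ge(2)[OF j(1)] neqN[OF b(1) j(1)] by auto
      moreover have "N j < K" using K j by blast
      ultimately show "K - N j < K - N b" by simp
    qed
    have "a \<noteq> b"
    proof
      assume "a = b"
      then have "N x = N a" "N y = N a" using ge xy by (metis le_antisym)+
      then show False using neqN xy by metis
    qed
    moreover have "\<forall>j \<in> V. 0 < K - N j" using K by simp
    moreover have "C \<inter> ?F = {}" "C \<union> ?F = V" using CV by auto
    ultimately show ?thesis
      using psum_regular_pair[OF finV _ _ a(1) b(1) _ topa pos topb _ g cov_pow_zero_on[OF zero C]] by blast
  qed
  then obtain w where wp: "\<And>C. min_cover C \<Longrightarrow> w C \<in> polys V"
    and wz: "\<And>C. min_cover C \<Longrightarrow> zero_on (?Q C) (g - psum N V * w C)" by metis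
  have agree: "lookup (w C) b = lookup (w D) b"
    if CD: "min_cover C" "min_cover D" "wt C b \<le> s" "wt D b \<le> s" for C D b
  proof (rule ccontr)
    assume neq: "lookup (w C) b \<noteq> lookup (w D) b"
    have "lookup (w C) b = lookup (w D) b"
      if CD: "min_cover C" "min_cover D" "wt C b \<le> s" "wt D b \<le> s" and "C \<union> D \<noteq> V" for C D
    proof -
      \<comment> \<open>A vertex outside both covers makes the power sum regular on the exponents
        that are small for both. There both products with the power sum agree with \<open>g\<close>,
        so the two quotients agree.\<close>
      let ?P = "\<lambda>m. wt C m \<le> s \<and> wt D m \<le> s"
      have covs: "cover C" "cover D" using CD by (simp_all add: min_cover_def)
      have fin: "finite C" "finite D" using covs cover_fin by blast+
      have "C \<union> D \<subseteq> V" using covs by (simp add: cover_def)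
      then obtain i where i: "i \<in> V" "i \<notin> C" "i \<notin> D" using \<open>C \<union> D \<noteq> V\<close> by blast
      have "zero_on ?P (g - psum N V * w C)" "zero_on ?P (g - psum N V * w D)"
        using wz[OF CD(1)] wz[OF CD(2)] by (simp_all add: zero_on_def less_Suc_eq_le)
      from zero_on_diff[OF this(2,1)] have z: "zero_on ?P (psum N V * (w C - w D))"
        by (simp add: algebra_simps)
      have "zero_on ?P (w C - w D)"
      proof (rule psum_regular[OF finV i(1)])
        show "zero_on ?P (psum N V * (w C - w D))" by (rule z)
      qed (use pos i fin in \<open>auto simp: wt_single\<close>)
      then show ?thesis using CD by (simp add: zero_on_def lookup_minus)
    qed
    then have "good s" using good_of_disconnected[of C b s D "\<lambda>C. lookup (w C) b"] CD neq by blast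
    then show False using ng by simp
  qed
  \<comment> \<open>By \<open>agree\<close> the choice of the cover is immaterial. The default 0 is
    taken at exponents where no minimal cover imposes a condition.\<close>
  define val where "val b = (if \<exists>C. min_cover C \<and> wt C b \<le> s
    then lookup (w (SOME C. min_cover C \<and> wt C b \<le> s)) b else 0)" for b
  have val: "val b = lookup (w C) b" if C: "min_cover C" "wt C b \<le> s" for C b
  proof -
    let ?D = "SOME C. min_cover C \<and> wt C b \<le> s"
    have ex: "\<exists>C. min_cover C \<and> wt C b \<le> s" using C by blast
    then have D: "min_cover ?D \<and> wt ?D b \<le> s" by (rule someI_ex)
    have "val b = lookup (w ?D) b" unfolding val_def using ex by (simp only: if_True simp_thms)
    also have "\<dots> = lookup (w C) b" using D C by (intro agree) simp_all
    finally show ?thesis .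
  qed
  let ?Cs = "{C. min_cover C}"
  have "?Cs \<subseteq> Pow V" by (auto simp: min_cover_def cover_def)
  then have "finite ?Cs" using finV by (simp add: finite_subset)
  \<comment> \<open>Restricting to the finitely many exponents occurring in some \<open>w C\<close>
    makes \<open>r\<close> a polynomial; elsewhere all the coefficients to be matched are
    zero.\<close>
  define S where "S = (\<Union>C \<in> ?Cs. Poly_Mapping.keys (w C))"
  have finS: "finite S" unfolding S_def using \<open>finite ?Cs\<close> by simp
  define r where "r = (\<Sum>b \<in> S. Poly_Mapping.single b (val b))"
  have lr: "lookup r b = (if b \<in> S then val b else 0)" for b
    using finS by (simp add: r_def lookup_sum lookup_single when_def sum.delta)
  have rp: "r \<in> polys V"
    unfolding r_def
  proof (intro polys_sum polys_single)
    fix b assume "b \<in> S"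
    then obtain C where "min_cover C" "b \<in> Poly_Mapping.keys (w C)" by (auto simp: S_def)
    then show "Poly_Mapping.keys b \<subseteq> V" using wp unfolding polys_def by blast
  qed
  have "g - psum N V * r \<in> cov_pow (Suc s)"
  proof (rule cov_pow_min_cover)
    show "g - psum N V * r \<in> polys V" using g rp by (intro polys_diff polys_mult psum_polys)
    fix C assume C: "min_cover C"
    have "zero_on (?Q C) (w C - r)"
      unfolding zero_on_def
    proof (intro allI impI)
      fix b assume b: "?Q C b"
      show "lookup (w C - r) b = 0"
      proof (cases "b \<in> S")
        case True
        then show ?thesis using val[OF C, of b] b by (simp add: lookup_minus lr)
      next
        case False
        then have "b \<notin> Poly_Mapping.keys (w C)" using C by (auto simp: S_def)
        then show ?thesis using False by (simp add: lookup_minus lr in_keys_iff)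
      qed
    qed
    then have "zero_on (?Q C) (psum N V * (w C - r))" by (rule zero_on_mult) simp
    from zero_on_add[OF wz[OF C] this] show "zero_on (?Q C) (g - psum N V * r)"
      by (simp add: algebra_simps)
  qed
  then show ?thesis using rp by blast
qed

lemma depth_of_not_good:
  assumes "\<not> good s"
  shows "2 \<le> depth_quot V (cov_pow (Suc s) :: ('v, 'k::field) mpoly set)"
proof -
  obtain N0 :: "'v \<Rightarrow> nat" where N0: "inj_on N0 V" using finite_imp_inj_to_nat_seg[OF finV] by blast
  \<comment> \<open>The exponents are made positive and distinct. \<open>K\<close> below exceeds all
    of them, so the exponents \<open>K - N i\<close> are positive as well and ordered the other way
    round.\<close>
  define N where "N i = Suc (N0 i)" for i
  have inj: "inj_on N V" and pos: "\<forall>i \<in> V. 0 < N i" using N0 by (auto simp: N_def inj_on_def)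
  define K where "K = Suc (Max (N ` V))"
  have K: "\<forall>i \<in> V. N i < K" unfolding K_def using finV by (auto simp: less_Suc_eq_le)
  let ?J = "cov_pow (Suc s) :: ('v, 'k) mpoly set"
  let ?f = "psum N V :: ('v, 'k) mpoly" and ?f' = "psum (\<lambda>i. K - N i) V :: ('v, 'k) mpoly"
  note J = cov_pow_ideal[where ?'k = 'k, of "Suc s"]
  show ?thesis
  proof (rule depth_ge_two[OF J])
    show "?J \<subseteq> max_hom_ideal V"
    proof
      fix p assume p: "p \<in> ?J"
      show "p \<in> max_hom_ideal V"
      proof (subst poly_sum_monomials[of p], rule ideal_sum[OF max_hom_ideal(1)], rule single_in_max)
        fix m assume m: "m \<in> Poly_Mapping.keys p"
        then show "Poly_Mapping.keys m \<subseteq> V" using p by (auto simp: cov_pow_def polys_def)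
        have "wt A 0 < Suc s" by (simp add: wt_def)
        then have "lookup p 0 = 0" using p cover_A unfolding cov_pow_def zero_on_def by blast
        then show "m \<noteq> 0" using m by (auto simp: in_keys_iff)
      qed
    qed
    show "?f \<in> max_hom_ideal V" using pos by (rule psum_in_max)
    show "?f' \<in> max_hom_ideal V" using K by (intro psum_in_max) simp
    show "regular_mod V ?J ?f" using pos by (rule psum_regular_cov_pow[OF V_nonempty])
    show "regular_mod V (Idl\<^bsub>mpoly_ring V\<^esub> (?J \<union> {?f})) ?f'"
      unfolding regular_mod_def
    proof (intro conjI ballI impI)
      show "?f' \<in> polys V" by (rule psum_polys)
      fix g assume g: "g \<in> polys V" "?f' * g \<in> Idl\<^bsub>mpoly_ring V\<^esub> (?J \<union> {?f})"
      then obtain j h where h: "?f' * g = j + h * ?f" "j \<in> ?J"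
        unfolding genideal_insert[OF J psum_polys] by blast
      then have "?f' * g - ?f * h \<in> ?J" by (simp add: algebra_simps)
      from psum_pair_cov_pow[OF assms inj pos K g(1) this] obtain r where "r \<in> polys V" "g - ?f * r \<in> ?J"
        by blast
      then show "g \<in> Idl\<^bsub>mpoly_ring V\<^esub> (?J \<union> {?f})" by (rule genideal_insert_multiple[OF J psum_polys])
    qed
  qed
qed

lemma dstab_edge_ideal:
  "dstab V (edge_ideal V E :: ('v, 'k::field) mpoly set) = Suc (LEAST s. good s)"
proof -
  let ?s = "LEAST s. good s"
  let ?d = "\<lambda>t. depth_quot V (ideal_pow V (edge_ideal V E :: ('v, 'k) mpoly set) t)"
  have "good ?s" using good_exists by (rule LeastI_ex)
  then have "good (?s + n)" for n by (induction n) (auto intro: good_Suc[OF E_nonempty])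
  then have good: "good n" if "?s \<le> n" for n using that by (metis le_add_diff_inverse)
  have one: "?d t = 1" if "Suc ?s \<le> t" for t
    using depth_of_good[OF good[of "t - 1"]] that by (cases t) (simp_all add: ideal_pow_edge_ideal)
  show ?thesis
    unfolding dstab_def
  proof (rule Least_equality)
    show "1 \<le> Suc ?s \<and> (\<forall>t \<ge> Suc ?s. ?d t = ?d (Suc ?s))" using one by simp
    fix n assume n: "1 \<le> n \<and> (\<forall>t \<ge> n. ?d t = ?d n)"
    show "Suc ?s \<le> n"
    proof (rule ccontr)
      assume "\<not> Suc ?s \<le> n"
      \<comment> \<open>The power \<open>Suc m\<close> is governed by \<open>good m\<close>.
        Stability from some \<open>n \<le> ?s\<close> on would equate the depths at
        \<open>?s\<close> and \<open>Suc ?s\<close>, but the former is at least 2 because the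
        predecessor of \<open>?s\<close> is not good.\<close>
      then obtain m where m: "?s = Suc m" "n \<le> ?s" using n by (cases ?s) auto
      have "\<And>t. n \<le> t \<Longrightarrow> ?d t = ?d n" using n by blast
      from this[of ?s] this[of "Suc ?s"] have "?d ?s = ?d n" "?d (Suc ?s) = ?d n" using m(2) by simp_all
      then have "?d (Suc m) = 1" using one[of "Suc ?s"] m(1) by simp
      moreover have "\<not> good m" using not_less_Least[of m good] m(1) by simp
      then have "2 \<le> ?d (Suc m)" unfolding ideal_pow_edge_ideal by (rule depth_of_not_good)
      ultimately show False by (simp add: one_enat_def numeral_eq_enat)
    qed
  qed
qed

end

theorem theorem4p1:
  fixes n :: nat and E :: "nat set set"
  assumes "n \<ge> 2"
    and "simple_graph {1..n} E"
    and "connected_graph {1..n} E"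
    and "bipartite_graph {1..n} E"
  shows "real (dstab {1..n} (edge_ideal {1..n} E :: (nat, 'k::field) mpoly set))
    = s_invariant {1..n} E + 1"
proof -
  obtain A B where "bipartition {1..n} E A B" using assms(4) by (auto simp: bipartite_graph_def)
  then interpret conn_bip_graph "{1..n}" A B E
    using assms(1,3) by unfold_locales (auto simp: bipartition_def)
  show ?thesis unfolding dstab_edge_ideal s_invariant_eq by simp
qed

end
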